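(* Let $\mathcal{T}$ be a norm-continuous quantum Markov semigroup on $\mathcal{B}(\mathsf{h})$ with generator $\mathcal{L}$ and faithful normal invariant state $\rho$, and let $\theta$ be a time reversal on $\mathsf{h}$ commuting with $\rho$. Let $G,L_k$ be the operators of a special GKSL representation of $\mathcal{L}$, and let $R=(R_{jk})$ and $C=(c_{kj})$ be the self-adjoint trace-class operators on $\mathsf{k}$ with \[ R_{jk}=\mathrm{tr}\left(\rho^{1/2}L_j^*\rho^{1/2}\theta L_k^*\theta\right),\qquad c_{kj}=\mathrm{tr}\left(\rho L_k^*L_j\right). \] Then $\mathcal{T}$ satisfies the SQDB-$\theta$ condition if and only if the following conditions hold: 1. $\rho^{1/2}\theta G^*\theta=G\rho^{1/2}$; 2. the closed linear spans of $\{\rho^{1/2}\theta L_\ell^*\theta\mid\ell\ge1\}$ and of $\{L_\ell\rho^{1/2}\mid\ell\ge1\}$ in the Hilbert space of Hilbert-Schmidt operators on $\mathsf{h}$ coincide; 3. $R$ and $C$ commute and $C^{-1}R$ is unitary and self-adjoint.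
   Context: $\mathsf{h}$ is a complex separable Hilbert space and $\mathcal{B}(\mathsf{h})$ the algebra of bounded operators on it. A quantum Markov semigroup (QMS) on $\mathcal{B}(\mathsf{h})$ is a weak$^*$-continuous semigroup $\mathcal{T}=(\mathcal{T}_t)_{t\ge0}$ of normal, completely positive, identity preserving maps; it is norm-continuous iff its generator $\mathcal{L}$ is bounded. A faithful normal invariant state is an injective density operator $\rho$ with $\mathrm{tr}(\rho\mathcal{T}_t(x))=\mathrm{tr}(\rho x)$ for all $t,x$. A time reversal is an antiunitary operator $\theta$ on $\mathsf{h}$ (antilinear, $\langle\theta u,\theta v\rangle=\langle v,u\rangle$) with $\theta^2=1$ and $\theta^{-1}=\theta^*=\theta$. SQDB-$\theta$ condition: $\mathrm{tr}(\rho^{1/2}x\rho^{1/2}\mathcal{L}(y))=\mathrm{tr}(\rho^{1/2}\theta y^*\theta\rho^{1/2}\mathcal{L}(\theta x^*\theta))$ for all $x,y\in\mathcal{B}(\mathsf{h})$. Special GKSL representation of $\mathcal{L}$ (with respect to $\rho$): a bounded self-adjoint $H$ and a finite or infinite sequence $(L_\ell)_{\ell\ge1}$ in $\mathcal{B}(\mathsf{h})$ such that (i) $\mathrm{tr}(\rho L_\ell)=0$ for all $\ell$; (ii) $\sum_\ell L_\ell^*L_\ell$ converges strongly; (iii) if $\sum_{\ell\ge0}|c_\ell|^2<\infty$ and $c_0 1+\sum_{\ell\ge1}c_\ell L_\ell=0$ for complex scalars $c_\ell$, then all $c_\ell=0$; (iv) $\mathcal{L}(x)=i[H,x]-\frac12\sum_\ell(L_\ell^*L_\ell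 x-2L_\ell^*xL_\ell+xL_\ell^*L_\ell)$. One sets $G=-\frac12\sum_\ell L_\ell^*L_\ell-iH$. The multiplicity space $\mathsf{k}$ is the $\ell^2$-space on the index set of $(L_\ell)$; matrices indexed by this set are identified with operators on $\mathsf{k}$. The operator $C$ is injective; $C^{-1}$ denotes its (possibly unbounded) inverse with domain the range of $C$. "$C^{-1}R$ is unitary" includes that it is everywhere defined on $\mathsf{k}$. *)

theory Defs
  imports "HOL-Analysis.Analysis"
begin

section \<open>Complex Hilbert spaces\<close>

text \<open>
  The complex inner product is antilinear in its first and linear in its second argument.
  The norm and topology are those of the underlying real inner product space.
\<close>

class chilbert_space = real_inner + complete_space +
  fixes scaleC :: "complex \<Rightarrow> 'a \<Rightarrow> 'a" (infixr "*\<^sub>C" 75)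
    and cinner :: "'a \<Rightarrow> 'a \<Rightarrow> complex"
  assumes scaleC_add_right: "c *\<^sub>C (x + y) = c *\<^sub>C x + c *\<^sub>C y"
    and scaleC_add_left: "(c + d) *\<^sub>C x = c *\<^sub>C x + d *\<^sub>C x"
    and scaleC_scaleC: "c *\<^sub>C (d *\<^sub>C x) = (c * d) *\<^sub>C x"
    and scaleC_of_real: "complex_of_real r *\<^sub>C x = r *\<^sub>R x"
    and cinner_commute: "cinner x y = cnj (cinner y x)"
    and cinner_add_right: "cinner x (y + z) = cinner x y + cinner x z"
    and cinner_scaleC_right: "cinner x (c *\<^sub>C y) = c * cinner x y"
    and inner_eq_Re_cinner: "inner x y = Re (cinner x y)"


section \<open>The Hilbert space of square summable sequences\<close>

typedef ell2 = "{f :: nat \<Rightarrow> complex. summable (\<lambda>n. (cmod (f n))\<^sup>2)}"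
  morphisms ell2_nth Abs_ell2
  by (rule exI[of _ "\<lambda>_. 0"]) simp

setup_lifting type_definition_ell2

lemma cmod_sum_sq_le: "(cmod (a + b))\<^sup>2 \<le> 2 * (cmod a)\<^sup>2 + 2 * (cmod b)\<^sup>2"
proof -
  have "(cmod (a + b))\<^sup>2 \<le> (cmod a + cmod b)\<^sup>2"
    by (intro power_mono norm_triangle_ineq) auto
  also have "\<dots> \<le> 2 * (cmod a)\<^sup>2 + 2 * (cmod b)\<^sup>2"
    using sum_squares_ge_zero[of "cmod a - cmod b" 0]
    by (simp add: power2_eq_square algebra_simps)
  finally show ?thesis .
qed

lemma ell2_summable_add:
  assumes "summable (\<lambda>n. (cmod (f n))\<^sup>2)" "summable (\<lambda>n. (cmod (g n))\<^sup>2)"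
  shows "summable (\<lambda>n. (cmod (f n + g n))\<^sup>2)"
proof (rule summable_comparison_test')
  show "summable (\<lambda>n. 2 * (cmod (f n))\<^sup>2 + 2 * (cmod (g n))\<^sup>2)"
    by (intro summable_add summable_mult assms)
  show "norm ((cmod (f n + g n))\<^sup>2) \<le> 2 * (cmod (f n))\<^sup>2 + 2 * (cmod (g n))\<^sup>2" for n
    using cmod_sum_sq_le[of "f n" "g n"] by simp
qed

lemma ell2_summable_scale:
  assumes "summable (\<lambda>n. (cmod (f n))\<^sup>2)"
  shows "summable (\<lambda>n. (cmod (c * f n))\<^sup>2)"
  using summable_mult[OF assms, of "(cmod c)\<^sup>2"] by (simp add: norm_mult power_mult_distrib)

lemma ell2_summable_mult:
  assumes "summable (\<lambda>n. (cmod (f n))\<^sup>2)" "summable (\<lambda>n. (cmod (g n))\<^sup>2)"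
  shows "summable (\<lambda>n. cnj (f n) * g n)"
proof (rule summable_comparison_test')
  show "summable (\<lambda>n. (cmod (f n))\<^sup>2 + (cmod (g n))\<^sup>2)"
    by (intro summable_add assms)
  show "norm (cnj (f n) * g n) \<le> (cmod (f n))\<^sup>2 + (cmod (g n))\<^sup>2" for n
  proof -
    have "2 * (cmod (f n) * cmod (g n)) \<le> (cmod (f n))\<^sup>2 + (cmod (g n))\<^sup>2"
      using sum_squares_bound[of "cmod (f n)" "cmod (g n)"] by (simp add: mult.assoc)
    moreover have "0 \<le> cmod (f n) * cmod (g n)" by simp
    ultimately have "cmod (f n) * cmod (g n) \<le> (cmod (f n))\<^sup>2 + (cmod (g n))\<^sup>2" by linarith
    then show ?thesis by (simp add: norm_mult)
  qed
qed

instantiation ell2 :: real_inner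
begin

lift_definition zero_ell2 :: ell2 is "\<lambda>_. 0" by simp
lift_definition plus_ell2 :: "ell2 \<Rightarrow> ell2 \<Rightarrow> ell2" is "\<lambda>f g n. f n + g n"
  by (rule ell2_summable_add)
lift_definition uminus_ell2 :: "ell2 \<Rightarrow> ell2" is "\<lambda>f n. - f n" by simp
lift_definition minus_ell2 :: "ell2 \<Rightarrow> ell2 \<Rightarrow> ell2" is "\<lambda>f g n. f n - g n"
  subgoal for f g using ell2_summable_add[of f "\<lambda>n. - g n"] by simp
  done
lift_definition scaleR_ell2 :: "real \<Rightarrow> ell2 \<Rightarrow> ell2" is "\<lambda>r f n. complex_of_real r * f n"
  by (rule ell2_summable_scale)

definition inner_ell2 :: "ell2 \<Rightarrow> ell2 \<Rightarrow> real" where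
  "inner_ell2 f g = Re (\<Sum>n. cnj (ell2_nth f n) * ell2_nth g n)"
definition norm_ell2 :: "ell2 \<Rightarrow> real" where
  "norm_ell2 f = sqrt (inner f f)"
definition sgn_ell2 :: "ell2 \<Rightarrow> ell2" where
  "sgn_ell2 f = inverse (norm f) *\<^sub>R f"
definition dist_ell2 :: "ell2 \<Rightarrow> ell2 \<Rightarrow> real" where
  "dist_ell2 f g = norm (f - g)"
definition uniformity_ell2 :: "(ell2 \<times> ell2) filter" where
  "uniformity_ell2 = (INF e\<in>{0<..}. principal {(x, y). dist x y < e})"
definition open_ell2 :: "ell2 set \<Rightarrow> bool" where
  "open_ell2 U \<longleftrightarrow> (\<forall>x\<in>U. \<forall>\<^sub>F (x', y) in uniformity. x' = x \<longrightarrow> y \<in> U)"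

lemma ell2_nth_summable: "summable (\<lambda>n. (cmod (ell2_nth f n))\<^sup>2)"
  using ell2_nth[of f] by simp

lemma ell2_nth_summable_mult: "summable (\<lambda>n. cnj (ell2_nth f n) * ell2_nth g n)"
  by (rule ell2_summable_mult) (rule ell2_nth_summable)+

lemma ell2_inner_self: "inner f f = (\<Sum>n. (cmod (ell2_nth f n))\<^sup>2)" for f :: ell2
proof -
  have "cnj z * z = complex_of_real ((cmod z)\<^sup>2)" for z
    by (metis complex_norm_square mult.commute)
  then have "inner f f = Re (\<Sum>n. complex_of_real ((cmod (ell2_nth f n))\<^sup>2))"
    unfolding inner_ell2_def by presburger
  also have "(\<Sum>n. complex_of_real ((cmod (ell2_nth f n))\<^sup>2)) =
      complex_of_real (\<Sum>n. (cmod (ell2_nth f n))\<^sup>2)"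
    by (rule suminf_of_real[symmetric]) (rule ell2_nth_summable)
  finally show ?thesis by simp
qed

instance
proof
  fix x y z :: ell2 and a b r :: real
  show "x + y + z = x + (y + z)" by transfer (simp add: add.assoc)
  show "x + y = y + x" by transfer (simp add: add.commute)
  show "0 + x = x" by transfer simp
  show "- x + x = 0" by transfer simp
  show "x - y = x + - y" by transfer simp
  show "a *\<^sub>R (x + y) = a *\<^sub>R x + a *\<^sub>R y" by transfer (simp add: distrib_left)
  show "(a + b) *\<^sub>R x = a *\<^sub>R x + b *\<^sub>R x" by transfer (simp add: distrib_right)
  show "a *\<^sub>R b *\<^sub>R x = (a * b) *\<^sub>R x" by transfer (simp add: mult.assoc)
  show "1 *\<^sub>R x = x" by transfer simp
  show "dist x y = norm (x - y)" by (rule dist_ell2_def)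
  show "sgn x = inverse (norm x) *\<^sub>R x" by (rule sgn_ell2_def)
  show "uniformity = (INF e\<in>{0<..}. principal {(x, y). dist (x :: ell2) y < e})"
    by (rule uniformity_ell2_def)
  show "open U \<longleftrightarrow> (\<forall>x\<in>U. \<forall>\<^sub>F (x', y) in uniformity. x' = x \<longrightarrow> y \<in> U)" for U :: "ell2 set"
    by (rule open_ell2_def)
  show "inner x y = inner y x"
  proof -
    have "(\<Sum>n. cnj (ell2_nth x n) * ell2_nth y n) = (\<Sum>n. cnj (cnj (ell2_nth y n) * ell2_nth x n))"
      by (simp add: mult.commute)
    also have "\<dots> = cnj (\<Sum>n. cnj (ell2_nth y n) * ell2_nth x n)"
      using ell2_nth_summable_mult[of y x] by (metis sums_cnj sums_unique summable_sums)
    finally show ?thesis by (simp add: inner_ell2_def)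
  qed
  show "inner (x + y) z = inner x z + inner y z"
    unfolding inner_ell2_def
    using suminf_add[OF ell2_nth_summable_mult[of x z] ell2_nth_summable_mult[of y z]]
    by (simp add: plus_ell2.rep_eq distrib_right flip: plus_complex.sel)
  show "inner (r *\<^sub>R x) y = r * inner x y"
    unfolding inner_ell2_def
    using suminf_mult[OF ell2_nth_summable_mult[of x y], of "complex_of_real r"]
    by (simp add: scaleR_ell2.rep_eq mult.assoc)
  show "0 \<le> inner x x"
    unfolding ell2_inner_self by (intro suminf_nonneg ell2_nth_summable) simp
  show "inner x x = 0 \<longleftrightarrow> x = 0"
  proof -
    have "inner x x = 0 \<longleftrightarrow> (\<forall>n. ell2_nth x n = 0)"
      unfolding ell2_inner_self using suminf_eq_zero_iff[OF ell2_nth_summable[of x]] by simp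
    also have "\<dots> \<longleftrightarrow> x = 0"
      by transfer auto
    finally show ?thesis .
  qed
  show "norm x = sqrt (inner x x)" by (rule norm_ell2_def)
qed

end

instance ell2 :: complete_space
proof
  fix X :: "nat \<Rightarrow> ell2"
  assume X: "Cauchy X"
  have norm_sq: "(norm f)\<^sup>2 = (\<Sum>n. (cmod (ell2_nth f n))\<^sup>2)" for f :: ell2
    by (metis ell2_inner_self power2_norm_eq_inner)
  have partial_le: "(\<Sum>i<K. (cmod (ell2_nth f i))\<^sup>2) \<le> (norm f)\<^sup>2" for K and f :: ell2
    unfolding norm_sq by (intro sum_le_suminf ell2_nth_summable) auto
  have nth_le: "cmod (ell2_nth f i) \<le> norm f" for i and f :: ell2
  proof -
    have "(cmod (ell2_nth f i))\<^sup>2 \<le> (\<Sum>j<Suc i. (cmod (ell2_nth f j))\<^sup>2)"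
      by (simp add: sum_nonneg)
    also have "\<dots> \<le> (norm f)\<^sup>2" by (rule partial_le)
    finally show ?thesis by (rule power2_le_imp_le) simp
  qed
  have "Cauchy (\<lambda>m. ell2_nth (X m) i)" for i
    unfolding Cauchy_def
  proof (intro allI impI)
    fix e :: real assume "e > 0"
    then obtain M where M: "\<And>m n. m \<ge> M \<Longrightarrow> n \<ge> M \<Longrightarrow> dist (X m) (X n) < e"
      using X unfolding Cauchy_def by blast
    have "dist (ell2_nth (X m) i) (ell2_nth (X n) i) < e" if "m \<ge> M" "n \<ge> M" for m n
      using M[OF that] nth_le[where f = "X m - X n" and i = i]
      by (simp add: dist_norm minus_ell2.rep_eq)
    then show "\<exists>M. \<forall>m\<ge>M. \<forall>n\<ge>M. dist (ell2_nth (X m) i) (ell2_nth (X n) i) < e" by blast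
  qed
  then obtain f where f: "\<And>i. (\<lambda>m. ell2_nth (X m) i) \<longlonglongrightarrow> f i"
    unfolding Cauchy_convergent_iff convergent_def by metis
  have bound: "\<exists>M. \<forall>m\<ge>M. \<forall>K. (\<Sum>i<K. (cmod (ell2_nth (X m) i - f i))\<^sup>2) \<le> e\<^sup>2" if "e > 0" for e
  proof -
    obtain M where M: "\<And>m n. m \<ge> M \<Longrightarrow> n \<ge> M \<Longrightarrow> dist (X m) (X n) < e"
      using X \<open>e > 0\<close> unfolding Cauchy_def by blast
    have "(\<Sum>i<K. (cmod (ell2_nth (X m) i - f i))\<^sup>2) \<le> e\<^sup>2" if "m \<ge> M" for m K
    proof (rule LIMSEQ_le_const2)
      show "(\<lambda>n. \<Sum>i<K. (cmod (ell2_nth (X m) i - ell2_nth (X n) i))\<^sup>2)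
          \<longlonglongrightarrow> (\<Sum>i<K. (cmod (ell2_nth (X m) i - f i))\<^sup>2)"
        by (intro tendsto_intros f)
      have "(\<Sum>i<K. (cmod (ell2_nth (X m) i - ell2_nth (X n) i))\<^sup>2) \<le> e\<^sup>2" if "n \<ge> M" for n
      proof -
        have "(\<Sum>i<K. (cmod (ell2_nth (X m) i - ell2_nth (X n) i))\<^sup>2) \<le> (norm (X m - X n))\<^sup>2"
          using partial_le[where K = K and f = "X m - X n"] by (simp add: minus_ell2.rep_eq)
        also have "\<dots> \<le> e\<^sup>2"
          using M[OF \<open>m \<ge> M\<close> that] by (intro power_mono) (auto simp: dist_norm)
        finally show ?thesis .
      qed
      then show "\<exists>N. \<forall>n\<ge>N. (\<Sum>i<K. (cmod (ell2_nth (X m) i - ell2_nth (X n) i))\<^sup>2) \<le> e\<^sup>2"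
        by blast
    qed
    then show ?thesis by blast
  qed
  have diff_summable: "summable (\<lambda>i. (cmod (ell2_nth (X m) i - f i))\<^sup>2)"
    if "\<forall>K. (\<Sum>i<K. (cmod (ell2_nth (X m) i - f i))\<^sup>2) \<le> B" for m B
  proof (rule bounded_imp_summable)
    show "(\<Sum>i\<le>n. (cmod (ell2_nth (X m) i - f i))\<^sup>2) \<le> B" for n
      unfolding lessThan_Suc_atMost[symmetric] using that by blast
  qed simp
  obtain M0 where "\<forall>K. (\<Sum>i<K. (cmod (ell2_nth (X M0) i - f i))\<^sup>2) \<le> 1\<^sup>2"
    using bound[of 1] by auto
  then have "summable (\<lambda>i. (cmod (ell2_nth (X M0) i - f i))\<^sup>2)"
    by (rule diff_summable)
  then have "summable (\<lambda>i. (cmod (ell2_nth (X M0) i + - (ell2_nth (X M0) i - f i)))\<^sup>2)"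
    by (intro ell2_summable_add ell2_nth_summable) (simp add: norm_minus_commute)
  then have f_mem: "f \<in> {f. summable (\<lambda>n. (cmod (f n))\<^sup>2)}" by simp
  define F where "F = Abs_ell2 f"
  have F: "ell2_nth F = f"
    unfolding F_def by (rule Abs_ell2_inverse[OF f_mem])
  have "X \<longlonglongrightarrow> F"
  proof (rule metric_LIMSEQ_I)
    fix r :: real assume "r > 0"
    then obtain M where M: "\<And>m K. m \<ge> M \<Longrightarrow> (\<Sum>i<K. (cmod (ell2_nth (X m) i - f i))\<^sup>2) \<le> (r / 2)\<^sup>2"
      using bound[of "r / 2"] by auto
    have "dist (X m) F < r" if "m \<ge> M" for m
    proof -
      have "(norm (X m - F))\<^sup>2 = (\<Sum>i. (cmod (ell2_nth (X m) i - f i))\<^sup>2)"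
        by (simp add: norm_sq minus_ell2.rep_eq F)
      also have "\<dots> \<le> (r / 2)\<^sup>2"
        using M[OF that] by (intro suminf_le_const diff_summable) auto
      finally have "norm (X m - F) \<le> r / 2"
        by (rule power2_le_imp_le) (use \<open>r > 0\<close> in simp)
      then show ?thesis using \<open>r > 0\<close> by (simp add: dist_norm)
    qed
    then show "\<exists>M. \<forall>m\<ge>M. dist (X m) F < r" by blast
  qed
  then show "convergent X" by (rule convergentI)
qed

instantiation ell2 :: chilbert_space
begin

lift_definition scaleC_ell2 :: "complex \<Rightarrow> ell2 \<Rightarrow> ell2" is "\<lambda>c f n. c * f n"
  by (rule ell2_summable_scale)

definition cinner_ell2 :: "ell2 \<Rightarrow> ell2 \<Rightarrow> complex" where
  "cinner_ell2 f g = (\<Sum>n. cnj (ell2_nth f n) * ell2_nth g n)"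

instance
proof
  fix x y z :: ell2 and c d :: complex and r :: real
  show "c *\<^sub>C (x + y) = c *\<^sub>C x + c *\<^sub>C y" by transfer (simp add: distrib_left)
  show "(c + d) *\<^sub>C x = c *\<^sub>C x + d *\<^sub>C x" by transfer (simp add: distrib_right)
  show "c *\<^sub>C d *\<^sub>C x = (c * d) *\<^sub>C x" by transfer (simp add: mult.assoc)
  show "complex_of_real r *\<^sub>C x = r *\<^sub>R x" by transfer simp
  show "cinner x y = cnj (cinner y x)"
  proof -
    have "(\<Sum>n. cnj (ell2_nth x n) * ell2_nth y n) = (\<Sum>n. cnj (cnj (ell2_nth y n) * ell2_nth x n))"
      by (simp add: mult.commute)
    also have "\<dots> = cnj (\<Sum>n. cnj (ell2_nth y n) * ell2_nth x n)"
      using ell2_nth_summable_mult[of y x] by (metis sums_cnj sums_unique summable_sums)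
    finally show ?thesis by (simp add: cinner_ell2_def)
  qed
  show "cinner x (y + z) = cinner x y + cinner x z"
    unfolding cinner_ell2_def
    using suminf_add[OF ell2_nth_summable_mult[of x y] ell2_nth_summable_mult[of x z]]
    by (simp add: plus_ell2.rep_eq distrib_left)
  show "cinner x (c *\<^sub>C y) = c * cinner x y"
    unfolding cinner_ell2_def
    using suminf_mult[OF ell2_nth_summable_mult[of x y], of c]
    by (simp add: scaleC_ell2.rep_eq mult.left_commute)
  show "inner x y = Re (cinner x y)"
    by (simp add: inner_ell2_def cinner_ell2_def)
qed

end

lift_definition ket :: "nat \<Rightarrow> ell2" is "\<lambda>n i. if i = n then 1 else 0"
proof -
  fix n :: nat
  show "summable (\<lambda>i. (cmod (if i = n then 1 else 0))\<^sup>2)"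
    by (rule summable_finite[of "{n}"]) auto
qed

text \<open>The space of square summable families indexed by \<^term>\<open>J\<close>, as a closed subspace.\<close>

definition ell2_on :: "nat set \<Rightarrow> ell2 set" where
  "ell2_on J = {f. \<forall>n. n \<notin> J \<longrightarrow> ell2_nth f n = 0}"


section \<open>Operators on Hilbert spaces\<close>

text \<open>
  In this section a Hilbert space is a closed complex subspace \<^term>\<open>S\<close> of a type of class
  \<^class>\<open>chilbert_space\<close>, and an operator on it is a function of which only the values on
  \<^term>\<open>S\<close> matter.
\<close>

definition bounded_op_on :: "'a::chilbert_space set \<Rightarrow> ('a \<Rightarrow> 'a) \<Rightarrow> bool" where
  "bounded_op_on S A \<longleftrightarrow>
     (\<forall>u\<in>S. A u \<in> S) \<and>
     (\<forall>u\<in>S. \<forall>v\<in>S. A (u + v) = A u + A v) \<and>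
     (\<forall>c. \<forall>u\<in>S. A (c *\<^sub>C u) = c *\<^sub>C A u) \<and>
     (\<exists>K. \<forall>u\<in>S. norm (A u) \<le> K * norm u)"

definition self_adjoint_on :: "'a::chilbert_space set \<Rightarrow> ('a \<Rightarrow> 'a) \<Rightarrow> bool" where
  "self_adjoint_on S A \<longleftrightarrow>
     bounded_op_on S A \<and> (\<forall>u\<in>S. \<forall>v\<in>S. cinner (A u) v = cinner u (A v))"

definition positive_op_on :: "'a::chilbert_space set \<Rightarrow> ('a \<Rightarrow> 'a) \<Rightarrow> bool" where
  "positive_op_on S A \<longleftrightarrow>
     bounded_op_on S A \<and> (\<forall>u\<in>S. cinner u (A u) \<in> \<real>\<^sub>\<ge>\<^sub>0)"

definition unitary_on :: "'a::chilbert_space set \<Rightarrow> ('a \<Rightarrow> 'a) \<Rightarrow> bool" where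
  "unitary_on S U \<longleftrightarrow>
     bounded_op_on S U \<and> U ` S = S \<and> (\<forall>u\<in>S. \<forall>v\<in>S. cinner (U u) (U v) = cinner u v)"

definition onb_on :: "'a::chilbert_space set \<Rightarrow> 'a set \<Rightarrow> bool" where
  "onb_on S E \<longleftrightarrow>
     E \<subseteq> S \<and>
     (\<forall>e\<in>E. \<forall>f\<in>E. cinner e f = (if e = f then 1 else 0)) \<and>
     (\<forall>u\<in>S. (\<forall>e\<in>E. cinner e u = 0) \<longrightarrow> u = 0)"

text \<open>
  The quantities below that use this choice do not depend on it, and neither do the
  Hilbert-Schmidt and trace class properties.
\<close>

definition some_onb :: "'a::chilbert_space set \<Rightarrow> 'a set" where
  "some_onb S = (SOME E. onb_on S E)"

text \<open>
  The operator \<^term>\<open>P\<close> is the absolute value of \<^term>\<open>A\<close>: the condition on inner products is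
  the identity between the square of \<^term>\<open>P\<close> and the product of the adjoint of \<^term>\<open>A\<close> with
  \<^term>\<open>A\<close>.
\<close>

definition trace_class_on :: "'a::chilbert_space set \<Rightarrow> ('a \<Rightarrow> 'a) \<Rightarrow> bool" where
  "trace_class_on S A \<longleftrightarrow>
     bounded_op_on S A \<and>
     (\<exists>P. positive_op_on S P \<and>
          (\<forall>u\<in>S. \<forall>v\<in>S. cinner (P u) (P v) = cinner (A u) (A v)) \<and>
          (\<lambda>e. cinner e (P e)) summable_on some_onb S)"

abbreviation bounded_op :: "('a::chilbert_space \<Rightarrow> 'a) \<Rightarrow> bool" where
  "bounded_op \<equiv> bounded_op_on UNIV"

abbreviation self_adjoint :: "('a::chilbert_space \<Rightarrow> 'a) \<Rightarrow> bool" where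
  "self_adjoint \<equiv> self_adjoint_on UNIV"

abbreviation positive_op :: "('a::chilbert_space \<Rightarrow> 'a) \<Rightarrow> bool" where
  "positive_op \<equiv> positive_op_on UNIV"

abbreviation trace_class :: "('a::chilbert_space \<Rightarrow> 'a) \<Rightarrow> bool" where
  "trace_class \<equiv> trace_class_on UNIV"

text \<open>Adjoint of a bounded operator, positive square root of a positive operator.\<close>

definition adj :: "('a::chilbert_space \<Rightarrow> 'a) \<Rightarrow> ('a \<Rightarrow> 'a)" where
  "adj A = (THE B. \<forall>u v. cinner (A u) v = cinner u (B v))"

definition op_sqrt :: "('a::chilbert_space \<Rightarrow> 'a) \<Rightarrow> ('a \<Rightarrow> 'a)" where
  "op_sqrt A = (THE B. positive_op B \<and> B \<circ> B = A)"

text \<open>Meaningful for trace class operators only.\<close>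

definition op_trace :: "('a::chilbert_space \<Rightarrow> 'a) \<Rightarrow> complex" where
  "op_trace A = (\<Sum>\<^sub>\<infinity>e\<in>some_onb UNIV. cinner e (A e))"

definition hilbert_schmidt :: "('a::chilbert_space \<Rightarrow> 'a) \<Rightarrow> bool" where
  "hilbert_schmidt A \<longleftrightarrow>
     bounded_op A \<and> (\<lambda>e. (norm (A e))\<^sup>2) summable_on some_onb UNIV"

definition hs_norm :: "('a::chilbert_space \<Rightarrow> 'a) \<Rightarrow> real" where
  "hs_norm A = sqrt (\<Sum>\<^sub>\<infinity>e\<in>some_onb UNIV. (norm (A e))\<^sup>2)"

definition op_span :: "('a::chilbert_space \<Rightarrow> 'a) set \<Rightarrow> ('a \<Rightarrow> 'a) set" where
  "op_span X = {(\<lambda>u. \<Sum>A\<in>F. c A *\<^sub>C A u) | F c. finite F \<and> F \<subseteq> X}"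

definition hs_closed_span :: "('a::chilbert_space \<Rightarrow> 'a) set \<Rightarrow> ('a \<Rightarrow> 'a) set" where
  "hs_closed_span X =
     {A. hilbert_schmidt A \<and> (\<forall>\<epsilon>>0. \<exists>B\<in>op_span X. hs_norm (\<lambda>u. A u - B u) < \<epsilon>)}"


section \<open>Quantum Markov semigroups\<close>

text \<open>Loewner order.\<close>

definition op_le :: "('a::chilbert_space \<Rightarrow> 'a) \<Rightarrow> ('a \<Rightarrow> 'a) \<Rightarrow> bool" where
  "op_le A B \<longleftrightarrow> positive_op (\<lambda>u. B u - A u)"

definition op_is_sup :: "('a::chilbert_space \<Rightarrow> 'a) set \<Rightarrow> ('a \<Rightarrow> 'a) \<Rightarrow> bool" where
  "op_is_sup D x \<longleftrightarrow>
     self_adjoint x \<and> (\<forall>y\<in>D. op_le y x) \<and>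
     (\<forall>z. self_adjoint z \<and> (\<forall>y\<in>D. op_le y z) \<longrightarrow> op_le x z)"

definition linear_on_ops :: "(('a::chilbert_space \<Rightarrow> 'a) \<Rightarrow> ('a \<Rightarrow> 'a)) \<Rightarrow> bool" where
  "linear_on_ops \<Phi> \<longleftrightarrow>
     (\<forall>x. bounded_op x \<longrightarrow> bounded_op (\<Phi> x)) \<and>
     (\<forall>x y. bounded_op x \<and> bounded_op y \<longrightarrow> \<Phi> (\<lambda>u. x u + y u) = (\<lambda>u. \<Phi> x u + \<Phi> y u)) \<and>
     (\<forall>c x. bounded_op x \<longrightarrow> \<Phi> (\<lambda>u. c *\<^sub>C x u) = (\<lambda>u. c *\<^sub>C \<Phi> x u))"

text \<open>
  Positivity of all matrix amplifications. An \<open>n\<close> by \<open>n\<close> matrix of bounded operators is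
  positive as an operator on the \<open>n\<close>-fold direct sum of the Hilbert space.
\<close>

definition matrix_positive :: "nat \<Rightarrow> (nat \<Rightarrow> nat \<Rightarrow> 'a::chilbert_space \<Rightarrow> 'a) \<Rightarrow> bool" where
  "matrix_positive n X \<longleftrightarrow>
     (\<forall>u. (\<Sum>i<n. \<Sum>j<n. cinner (u i) (X i j (u j))) \<in> \<real>\<^sub>\<ge>\<^sub>0)"

definition completely_positive :: "(('a::chilbert_space \<Rightarrow> 'a) \<Rightarrow> ('a \<Rightarrow> 'a)) \<Rightarrow> bool" where
  "completely_positive \<Phi> \<longleftrightarrow>
     linear_on_ops \<Phi> \<and>
     (\<forall>n X. (\<forall>i<n. \<forall>j<n. bounded_op (X i j)) \<and> matrix_positive n X \<longrightarrow>
            matrix_positive n (\<lambda>i j. \<Phi> (X i j)))"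

text \<open>Preservation of suprema of bounded increasing nets of positive operators.\<close>

definition normal_map :: "(('a::chilbert_space \<Rightarrow> 'a) \<Rightarrow> ('a \<Rightarrow> 'a)) \<Rightarrow> bool" where
  "normal_map \<Phi> \<longleftrightarrow>
     (\<forall>D x. D \<noteq> {} \<and> (\<forall>y\<in>D. positive_op y) \<and>
            (\<forall>y\<in>D. \<forall>z\<in>D. \<exists>w\<in>D. op_le y w \<and> op_le z w) \<and> op_is_sup D x \<longrightarrow>
            op_is_sup (\<Phi> ` D) (\<Phi> x))"

text \<open>
  The trace class operators form the predual of the algebra of bounded operators, so the last
  condition is weak* continuity.
\<close>

definition quantum_markov_semigroup ::
    "(real \<Rightarrow> ('a::chilbert_space \<Rightarrow> 'a) \<Rightarrow> ('a \<Rightarrow> 'a)) \<Rightarrow> bool" where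
  "quantum_markov_semigroup T \<longleftrightarrow>
     (\<forall>x. bounded_op x \<longrightarrow> T 0 x = x) \<and>
     (\<forall>s\<ge>0. \<forall>t\<ge>0. \<forall>x. bounded_op x \<longrightarrow> T (s + t) x = T s (T t x)) \<and>
     (\<forall>t\<ge>0. completely_positive (T t) \<and> normal_map (T t) \<and> T t id = id) \<and>
     (\<forall>\<sigma> x. trace_class \<sigma> \<and> bounded_op x \<longrightarrow>
            continuous_on {0..} (\<lambda>t. op_trace (\<sigma> \<circ> T t x)))"

definition norm_continuous :: "(real \<Rightarrow> ('a::chilbert_space \<Rightarrow> 'a) \<Rightarrow> ('a \<Rightarrow> 'a)) \<Rightarrow> bool" where
  "norm_continuous T \<longleftrightarrow>
     (\<forall>\<epsilon>>0. \<forall>\<^sub>F t in at_right 0. \<forall>x. bounded_op x \<longrightarrow>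
            onorm (\<lambda>u. T t x u - x u) \<le> \<epsilon> * onorm x)"

text \<open>\<^term>\<open>\<L>\<close> is the everywhere defined weak* derivative of the semigroup at time zero.\<close>

definition is_generator ::
    "(real \<Rightarrow> ('a::chilbert_space \<Rightarrow> 'a) \<Rightarrow> ('a \<Rightarrow> 'a)) \<Rightarrow> (('a \<Rightarrow> 'a) \<Rightarrow> ('a \<Rightarrow> 'a)) \<Rightarrow> bool" where
  "is_generator T \<L> \<longleftrightarrow>
     (\<forall>x. bounded_op x \<longrightarrow>
        bounded_op (\<L> x) \<and>
        (\<forall>\<sigma>. trace_class \<sigma> \<longrightarrow>
           ((\<lambda>t. op_trace (\<sigma> \<circ> (\<lambda>u. (1 / t) *\<^sub>R (T t x u - x u)))) \<longlongrightarrow> op_trace (\<sigma> \<circ> \<L> x))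
             (at_right 0)))"

definition density_operator :: "('a::chilbert_space \<Rightarrow> 'a) \<Rightarrow> bool" where
  "density_operator \<rho> \<longleftrightarrow> positive_op \<rho> \<and> trace_class \<rho> \<and> op_trace \<rho> = 1"

definition faithful_invariant_state ::
    "(real \<Rightarrow> ('a::chilbert_space \<Rightarrow> 'a) \<Rightarrow> ('a \<Rightarrow> 'a)) \<Rightarrow> ('a \<Rightarrow> 'a) \<Rightarrow> bool" where
  "faithful_invariant_state T \<rho> \<longleftrightarrow>
     density_operator \<rho> \<and> inj \<rho> \<and>
     (\<forall>t\<ge>0. \<forall>x. bounded_op x \<longrightarrow> op_trace (\<rho> \<circ> T t x) = op_trace (\<rho> \<circ> x))"

text \<open>
  The adjoint \<open>\<theta>*\<close> of an antilinear \<open>\<theta>\<close> is given by \<open>\<langle>u, \<theta>* v\<rangle> = \<langle>v, \<theta> u\<rangle>\<close>; the last condition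
  says that it equals \<open>\<theta>\<close>.
\<close>

definition time_reversal :: "('a::chilbert_space \<Rightarrow> 'a) \<Rightarrow> bool" where
  "time_reversal \<theta> \<longleftrightarrow>
     (\<forall>u v. \<theta> (u + v) = \<theta> u + \<theta> v) \<and>
     (\<forall>c u. \<theta> (c *\<^sub>C u) = cnj c *\<^sub>C \<theta> u) \<and>
     (\<forall>u v. cinner (\<theta> u) (\<theta> v) = cinner v u) \<and>
     \<theta> \<circ> \<theta> = id \<and>
     (\<forall>u v. cinner u (\<theta> v) = cinner v (\<theta> u))"

definition SQDB ::
    "('a::chilbert_space \<Rightarrow> 'a) \<Rightarrow> ('a \<Rightarrow> 'a) \<Rightarrow> (('a \<Rightarrow> 'a) \<Rightarrow> ('a \<Rightarrow> 'a)) \<Rightarrow> bool" where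
  "SQDB \<rho> \<theta> \<L> \<longleftrightarrow>
     (\<forall>x y. bounded_op x \<and> bounded_op y \<longrightarrow>
        op_trace (op_sqrt \<rho> \<circ> x \<circ> op_sqrt \<rho> \<circ> \<L> y) =
        op_trace (op_sqrt \<rho> \<circ> \<theta> \<circ> adj y \<circ> \<theta> \<circ> op_sqrt \<rho> \<circ> \<L> (\<theta> \<circ> adj x \<circ> \<theta>)))"

text \<open>
  The operators \<open>L l\<close> form a finite (possibly empty) or infinite sequence with index set
  \<^term>\<open>J\<close>. All series of operators converge strongly; the convergence of those in the last two
  conditions follows from \<open>\<Sum>L\<^sub>l* L\<^sub>l\<close> being strongly convergent.
\<close>

definition special_GKSL ::
    "('a::chilbert_space \<Rightarrow> 'a) \<Rightarrow> (('a \<Rightarrow> 'a) \<Rightarrow> ('a \<Rightarrow> 'a)) \<Rightarrow>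
     nat set \<Rightarrow> ('a \<Rightarrow> 'a) \<Rightarrow> (nat \<Rightarrow> 'a \<Rightarrow> 'a) \<Rightarrow> bool" where
  "special_GKSL \<rho> \<L> J H L \<longleftrightarrow>
     ((\<exists>d. J = {1..d}) \<or> J = {1..}) \<and>
     self_adjoint H \<and>
     (\<forall>l\<in>J. bounded_op (L l)) \<and>
     (\<forall>l\<in>J. op_trace (\<rho> \<circ> L l) = 0) \<and>
     (\<forall>u. (\<lambda>l. adj (L l) (L l u)) summable_on J) \<and>
     (\<forall>c :: nat \<Rightarrow> complex.
        (\<lambda>l. (cmod (c l))\<^sup>2) summable_on insert 0 J \<and>
        (\<forall>u. c 0 *\<^sub>C u + (\<Sum>\<^sub>\<infinity>l\<in>J. c l *\<^sub>C L l u) = 0) \<longrightarrow>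
        (\<forall>l\<in>insert 0 J. c l = 0)) \<and>
     (\<forall>x. bounded_op x \<longrightarrow>
        \<L> x = (\<lambda>u. \<i> *\<^sub>C (H (x u) - x (H u))
                 - (1 / 2) *\<^sub>R (\<Sum>\<^sub>\<infinity>l\<in>J. adj (L l) (L l (x u)) - 2 *\<^sub>R adj (L l) (x (L l u))
                                    + x (adj (L l) (L l u)))))"

definition GKSL_G ::
    "nat set \<Rightarrow> ('a::chilbert_space \<Rightarrow> 'a) \<Rightarrow> (nat \<Rightarrow> 'a \<Rightarrow> 'a) \<Rightarrow> ('a \<Rightarrow> 'a)" where
  "GKSL_G J H L = (\<lambda>u. - (1 / 2) *\<^sub>R (\<Sum>\<^sub>\<infinity>l\<in>J. adj (L l) (L l u)) - \<i> *\<^sub>C H u)"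

definition has_matrix :: "nat set \<Rightarrow> (ell2 \<Rightarrow> ell2) \<Rightarrow> (nat \<Rightarrow> nat \<Rightarrow> complex) \<Rightarrow> bool" where
  "has_matrix J A M \<longleftrightarrow> (\<forall>j\<in>J. \<forall>k\<in>J. cinner (ket j) (A (ket k)) = M j k)"

end

(*
  Write r for the square root of rho and consider the Hilbert-Schmidt operators N = G r, A_l = L_l r
  and their images M = r theta G* theta, B_l = r theta L_l* theta under the linear isometry
  X |-> theta X* theta, which fixes r. For bounded x and y,
    tr (r x r L(y)) = <N x*, y r> + <r x*, y N> + sum_l <A_l x*, y A_l>,
  and the right hand side of the balance condition is the same expression in M and B_l. Rank one x, y
  turn the condition into the operator identity
    |r><N| + |N><r| + V V* = |r><M| + |M><r| + W W*
  for the synthesis operators V f = sum_l f_l A_l and W f = sum_l f_l B_l. As tr (rho L_l) = 0,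
  V* and W* vanish on r, and <r, N> = <r, M>; evaluating at r gives N = M, hence V V* = W W*.
  Since V* V = W* W = C and V* W = R, the identity V V* = W W* gives R C = C R and R^2 = C^2, so that
  U = inverse(C) R is a self-adjoint unitary with W = V U. Conversely, R = C U gives V* (W - V U) = 0,
  hence W = V U as soon as V and W have ranges with the same closure.
*)
theory Submission
  imports Defs
begin

section \<open>Complex inner product spaces\<close>

text \<open>The Hilbert-Schmidt operators receive a type of class \<open>chilbert_space\<close>, so
  that N, M are vectors, the A_l and B_l square summable families, and everything about V, W, R, C
  takes place in abstract Hilbert spaces. Two obstacles shape the proof. The series over l are only
  assumed to converge strongly; Baire's theorem provides a uniform bound on the partial sums, which
  makes the A_l square summable and lets traces be interchanged with sums over l. Moreover C has
  dense range but in general no bounded inverse, so U is not a composition of bounded operators: U f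
  arises as the limit of R g_n for C g_n tending to f, and R^2 = C^2 makes C g |-> R g isometric.
  Injectivity of C rests on the independence of the L_l together with the density of the range of r,
  which faithfulness of the state provides. Finally X |-> theta X* theta reverses products, so it
  exchanges left and right multiplications; this is why both are needed as operators on the
  Hilbert-Schmidt space.\<close>

instance chilbert_space \<subseteq> banach ..

lemma scaleC_one [simp]: "1 *\<^sub>C (x::'a::chilbert_space) = x"
  using scaleC_of_real[of 1 x] by simp

lemma scaleC_zero_left [simp]: "0 *\<^sub>C (x::'a::chilbert_space) = 0"
  using scaleC_of_real[of 0 x] by simp

lemma scaleC_zero_right [simp]: "c *\<^sub>C (0::'a::chilbert_space) = 0"
  using scaleC_add_right[of c "0::'a" 0] by simp

lemma scaleC_minus_right [simp]: "c *\<^sub>C (- x::'a::chilbert_space) = - (c *\<^sub>C x)"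
  using scaleC_add_right[of c x "-x"] by (simp add: eq_neg_iff_add_eq_0 add.commute)

lemma scaleC_minus_left [simp]: "(- c) *\<^sub>C (x::'a::chilbert_space) = - (c *\<^sub>C x)"
  using scaleC_add_left[of c "-c" x] by (simp add: eq_neg_iff_add_eq_0 add.commute)

lemma scaleC_diff_right: "c *\<^sub>C (x - y::'a::chilbert_space) = c *\<^sub>C x - c *\<^sub>C y"
  using scaleC_add_right[of c x "-y"] by simp

lemma scaleR_scaleC: "r *\<^sub>R (x::'a::chilbert_space) = complex_of_real r *\<^sub>C x"
  by (simp add: scaleC_of_real)

lemma cinner_add_left: "cinner (x + y) (z::'a::chilbert_space) = cinner x z + cinner y z"
  using cinner_add_right[of z x y] by (metis cinner_commute complex_cnj_add)

lemma cinner_scaleC_left: "cinner (c *\<^sub>C x) (y::'a::chilbert_space) = cnj c * cinner x y"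
  using cinner_scaleC_right[of y c x] by (metis cinner_commute complex_cnj_mult)

lemma cinner_zero_right [simp]: "cinner x (0::'a::chilbert_space) = 0"
  using cinner_scaleC_right[of x 0 0] by simp

lemma cinner_zero_left [simp]: "cinner 0 (x::'a::chilbert_space) = 0"
  using cinner_scaleC_left[of 0 0 x] by simp

lemma cinner_minus_right [simp]: "cinner x (- y::'a::chilbert_space) = - cinner x y"
  using cinner_scaleC_right[of x "-1" y] by simp

lemma cinner_minus_left [simp]: "cinner (- x) (y::'a::chilbert_space) = - cinner x y"
  using cinner_scaleC_left[of "-1" x y] by simp

lemma cinner_diff_right: "cinner x (y - z::'a::chilbert_space) = cinner x y - cinner x z"
  using cinner_add_right[of x y "-z"] by simp

lemma cinner_diff_left: "cinner (x - y) (z::'a::chilbert_space) = cinner x z - cinner y z"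
  using cinner_add_left[of x "-y" z] by simp

lemma cinner_scaleR_right: "cinner x (r *\<^sub>R (y::'a::chilbert_space)) = of_real r * cinner x y"
  by (simp add: scaleR_scaleC cinner_scaleC_right)

lemma cinner_scaleR_left: "cinner (r *\<^sub>R x) (y::'a::chilbert_space) = of_real r * cinner x y"
  by (simp add: scaleR_scaleC cinner_scaleC_left)

lemma cinner_sum_right: "cinner x (\<Sum>i\<in>F. f i :: 'a::chilbert_space) = (\<Sum>i\<in>F. cinner x (f i))"
  by (induction F rule: infinite_finite_induct) (auto simp: cinner_add_right)

lemma cinner_sum_left: "cinner (\<Sum>i\<in>F. f i :: 'a::chilbert_space) x = (\<Sum>i\<in>F. cinner (f i) x)"
  by (induction F rule: infinite_finite_induct) (auto simp: cinner_add_left)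

lemmas cinner_linear = cinner_add_left cinner_add_right cinner_diff_left cinner_diff_right
  cinner_scaleC_left cinner_scaleC_right cinner_scaleR_left cinner_scaleR_right

lemma cinner_self: "cinner x x = complex_of_real ((norm (x::'a::chilbert_space))\<^sup>2)"
proof -
  have "Im (cinner x x) = 0"
    using cinner_commute[of x x] by (simp add: complex_eq_iff)
  then show ?thesis
    using inner_eq_Re_cinner[of x x] by (simp add: complex_eq_iff power2_norm_eq_inner)
qed

lemma cinner_self_eq_0 [simp]: "cinner x x = 0 \<longleftrightarrow> (x::'a::chilbert_space) = 0"
  by (simp add: cinner_self)

lemma norm_scaleC: "norm (c *\<^sub>C (x::'a::chilbert_space)) = cmod c * norm x"
proof -
  have "complex_of_real ((norm (c *\<^sub>C x))\<^sup>2) = (cnj c * c) * complex_of_real ((norm x)\<^sup>2)"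
    unfolding cinner_self[symmetric] by (simp add: cinner_linear)
  also have "cnj c * c = complex_of_real ((cmod c)\<^sup>2)"
    by (metis complex_norm_square mult.commute)
  finally have "complex_of_real ((norm (c *\<^sub>C x))\<^sup>2) = complex_of_real ((cmod c * norm x)\<^sup>2)"
    by (simp add: power_mult_distrib)
  then have "(norm (c *\<^sub>C x))\<^sup>2 = (cmod c * norm x)\<^sup>2"
    by (simp only: of_real_eq_iff)
  then show ?thesis
    by (metis norm_ge_zero power2_eq_imp_eq mult_nonneg_nonneg)
qed

text \<open>A phase \<open>c\<close> of modulus 1 makes the complex inner product real and equal to
  its modulus; then the Cauchy-Schwarz inequality of \<open>real_inner\<close> applies.\<close>

lemma cmod_cinner_le: "cmod (cinner x y) \<le> norm x * norm (y::'a::chilbert_space)"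
proof (cases "cinner x y = 0")
  case False
  define c where "c = cnj (cinner x y) / cmod (cinner x y)"
  have c: "cmod c = 1" using False by (simp add: c_def norm_divide)
  have "cinner x (c *\<^sub>C y) = c * cinner x y" by (simp add: cinner_linear)
  also have "\<dots> = complex_of_real (cmod (cinner x y))"
    using False complex_norm_square[of "cinner x y"]
    by (simp add: c_def power2_eq_square field_simps)
  finally have "cmod (cinner x y) = inner x (c *\<^sub>C y)" by (simp add: inner_eq_Re_cinner)
  also have "\<dots> \<le> norm x * norm (c *\<^sub>C y)" by (rule norm_cauchy_schwarz)
  finally show ?thesis by (simp add: norm_scaleC c)
qed simp

lemma cinner_eqI: "(\<And>v. cinner v x = cinner v y) \<Longrightarrow> x = (y::'a::chilbert_space)"
  by (metis cinner_diff_right cinner_self_eq_0 eq_iff_diff_eq_0)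

lemma cinner_eqI': "(\<And>v. cinner x v = cinner y v) \<Longrightarrow> x = (y::'a::chilbert_space)"
  by (metis cinner_commute cinner_eqI)

interpretation cinner: bounded_bilinear "cinner :: 'a \<Rightarrow> 'a::chilbert_space \<Rightarrow> complex"
proof
  show "\<exists>K. \<forall>a b. norm (cinner a (b::'a)) \<le> norm a * norm b * K"
    by (intro exI[of _ 1]) (simp add: cmod_cinner_le)
qed (auto simp: cinner_linear scaleR_conv_of_real)

interpretation scaleC: bounded_bilinear "scaleC :: complex \<Rightarrow> 'a \<Rightarrow> 'a::chilbert_space"
proof
  show "\<exists>K. \<forall>a b. norm (a *\<^sub>C (b::'a)) \<le> norm a * norm b * K"
    by (intro exI[of _ 1]) (simp add: norm_scaleC)
qed (auto simp: scaleC_add_left scaleC_add_right scaleR_scaleC scaleC_scaleC scaleR_conv_of_real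
      mult.commute)

lemmas has_sum_cinner_right = has_sum_bounded_linear[OF cinner.bounded_linear_right]
lemmas has_sum_cinner_left = has_sum_bounded_linear[OF cinner.bounded_linear_left]
lemmas has_sum_scaleC = has_sum_bounded_linear[OF scaleC.bounded_linear_right]

lemma norm_add_sq: "(norm (x + y))\<^sup>2 = (norm x)\<^sup>2 + 2 * Re (cinner x y) + (norm (y::'a::chilbert_space))\<^sup>2"
  by (simp add: power2_norm_eq_inner inner_add_left inner_add_right inner_commute
      inner_eq_Re_cinner[symmetric])

lemma norm_diff_sq: "(norm (x - y))\<^sup>2 = (norm x)\<^sup>2 - 2 * Re (cinner x y) + (norm (y::'a::chilbert_space))\<^sup>2"
  using norm_add_sq[of x "-y"] by simp


section \<open>Bounded operators\<close>

lemma bounded_opI: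
  assumes "\<And>u v. A (u + v) = A u + A v" "\<And>c u. A (c *\<^sub>C u) = c *\<^sub>C A u"
    "\<And>u. norm (A u) \<le> K * norm u"
  shows "bounded_op A"
  using assms unfolding bounded_op_on_def by blast

lemma bounded_op_add: "bounded_op A \<Longrightarrow> A (u + v) = A u + A v"
  and bounded_op_scaleC: "bounded_op A \<Longrightarrow> A (c *\<^sub>C u) = c *\<^sub>C A u"
  unfolding bounded_op_on_def by auto

lemma bounded_op_bounded_linear:
  fixes A :: "'a::chilbert_space \<Rightarrow> 'a"
  assumes "bounded_op A"
  shows "bounded_linear A"
proof -
  obtain K where K: "\<And>u. norm (A u) \<le> K * norm u"
    using assms unfolding bounded_op_on_def by auto
  show ?thesis
  proof
    show "\<exists>K. \<forall>x. norm (A x) \<le> norm x * K"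
      by (intro exI[of _ K]) (simp add: K mult.commute)
  qed (use assms in \<open>auto simp: bounded_op_add bounded_op_scaleC scaleR_scaleC\<close>)
qed

lemma bounded_op_pos_bound:
  fixes A :: "'a::chilbert_space \<Rightarrow> 'a"
  assumes "bounded_op A"
  obtains K where "K > 0" "\<And>u. norm (A u) \<le> K * norm u"
  using bounded_linear.pos_bounded[OF bounded_op_bounded_linear[OF assms]]
  by (metis mult.commute)

lemma bounded_op_iff:
  "bounded_op A \<longleftrightarrow> bounded_linear A \<and> (\<forall>c u. A (c *\<^sub>C u) = c *\<^sub>C A u)"
    (is "_ \<longleftrightarrow> ?R")
proof
  show "bounded_op A" if ?R
  proof -
    interpret bounded_linear A using that by simp
    obtain K where "\<And>u. norm (A u) \<le> norm u * K" using bounded by blast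
    then show ?thesis
      using that by (intro bounded_opI[of _ K]) (auto simp: add mult.commute)
  qed
qed (auto simp: bounded_op_bounded_linear bounded_op_scaleC)

lemma bounded_op_zero: "bounded_op A \<Longrightarrow> A 0 = 0"
  and bounded_op_minus: "bounded_op A \<Longrightarrow> A (- u) = - A u"
  and bounded_op_diff: "bounded_op A \<Longrightarrow> A (u - v) = A u - A v"
  and bounded_op_scaleR: "bounded_op A \<Longrightarrow> A (r *\<^sub>R u) = r *\<^sub>R A u"
  by (simp_all add: linear_simps[OF bounded_op_bounded_linear])

lemmas bounded_op_linear = bounded_op_add bounded_op_scaleC bounded_op_zero bounded_op_minus
  bounded_op_diff bounded_op_scaleR

lemma bounded_op_sum: "bounded_op A \<Longrightarrow> A (\<Sum>i\<in>F. f i) = (\<Sum>i\<in>F. A (f i))"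
  by (intro linear_sum bounded_linear.linear bounded_op_bounded_linear)

lemma bounded_op_comp: "bounded_op A \<Longrightarrow> bounded_op B \<Longrightarrow> bounded_op (A \<circ> B)"
  by (auto simp: bounded_op_iff intro: bounded_linear_compose simp: o_def)

lemma bounded_op_comp_fun: "bounded_op A \<Longrightarrow> bounded_op B \<Longrightarrow> bounded_op (\<lambda>u. A (B u))"
  using bounded_op_comp[of A B] by (simp add: o_def)

lemma bounded_op_id: "bounded_op (\<lambda>u. u)"
  by (auto simp: bounded_op_iff)

lemma bounded_op_zero_op: "bounded_op (\<lambda>u. 0)"
  by (auto simp: bounded_op_iff)

lemma bounded_op_plus: "bounded_op A \<Longrightarrow> bounded_op B \<Longrightarrow> bounded_op (\<lambda>u. A u + B u)"
  by (auto simp: bounded_op_iff scaleC_add_right intro: bounded_linear_add)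

lemma bounded_op_sub: "bounded_op A \<Longrightarrow> bounded_op B \<Longrightarrow> bounded_op (\<lambda>u. A u - B u)"
  by (auto simp: bounded_op_iff scaleC_diff_right intro: bounded_linear_sub)

lemma bounded_op_scale: "bounded_op A \<Longrightarrow> bounded_op (\<lambda>u. c *\<^sub>C A u)"
  by (auto simp: bounded_op_iff scaleC_scaleC mult.commute
      intro!: bounded_linear_compose[OF scaleC.bounded_linear_right])

lemma bounded_op_scaleR_op: "bounded_op A \<Longrightarrow> bounded_op (\<lambda>u. r *\<^sub>R A u)"
  unfolding scaleR_scaleC by (rule bounded_op_scale)

lemma bounded_op_rank_one: "bounded_op (\<lambda>u. cinner f u *\<^sub>C (g::'a::chilbert_space))"
proof (rule bounded_opI)
  show "norm (cinner f u *\<^sub>C g) \<le> (norm f * norm g) * norm u" for u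
    using mult_right_mono[OF cmod_cinner_le[of f u] norm_ge_zero[of g]]
    by (simp add: norm_scaleC mult.commute mult.left_commute)
qed (auto simp: cinner_linear scaleC_add_left scaleC_scaleC)

lemmas bounded_op_intros = bounded_op_comp bounded_op_id bounded_op_zero_op
  bounded_op_plus bounded_op_sub bounded_op_scale bounded_op_scaleR_op
  bounded_op_rank_one

text \<open>Pointwise convergence preserves linearity, and the common constant \<open>K\<close>
  survives the limit. Serves both the iterated square root and the completeness of
  \<open>hs\<close>.\<close>

lemma
  fixes X :: "nat \<Rightarrow> 'a::chilbert_space \<Rightarrow> 'a"
  assumes X: "\<And>n. bounded_op (X n)" and lim: "\<And>u. (\<lambda>n. X n u) \<longlonglongrightarrow> Y u"
    and le: "\<And>n u. norm (X n u) \<le> K * norm u"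
  shows norm_pointwise_limit_le: "norm (Y u) \<le> K * norm u"
    and bounded_op_pointwise_limit: "bounded_op Y"
proof -
  show *: "norm (Y u) \<le> K * norm u" for u
    by (rule LIMSEQ_le_const2[OF tendsto_norm[OF lim]]) (use le in auto)
  show "bounded_op Y"
  proof (rule bounded_opI[OF _ _ *])
    show "Y (u + v) = Y u + Y v" for u v
      using LIMSEQ_unique[OF lim[of "u + v"]] tendsto_add[OF lim[of u] lim[of v]]
      by (simp add: bounded_op_add[OF X])
    show "Y (c *\<^sub>C u) = c *\<^sub>C Y u" for c u
      using LIMSEQ_unique[OF lim[of "c *\<^sub>C u"]] scaleC.tendsto[OF tendsto_const[of c] lim[of u]]
      by (simp add: bounded_op_scaleC[OF X])
  qed
qed

text \<open>Normalisation turns a non-homogeneous estimate, such as the one by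
  \<open>x\<^sup>2 + y\<^sup>2\<close> behind \<open>norm_synth_le\<close>, into a homogeneous
  bound.\<close>

lemma norm_le_if_unit_le:
  fixes S :: "'a::chilbert_space \<Rightarrow> 'b::chilbert_space"
  assumes scale: "\<And>c u. S (c *\<^sub>C u) = c *\<^sub>C S u"
    and unit: "\<And>u. norm u = 1 \<Longrightarrow> norm (S u) \<le> K"
  shows "norm (S u) \<le> K * norm u"
proof (cases "u = 0")
  case True
  then show ?thesis using scale[of 0 0] by simp
next
  case False
  define c where "c = complex_of_real (1 / norm u)"
  have c: "cmod c = 1 / norm u" by (simp add: c_def norm_divide)
  then have "norm (c *\<^sub>C u) = 1" using False by (simp add: norm_scaleC)
  from unit[OF this] show ?thesis using False by (simp add: scale norm_scaleC c field_simps)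
qed

lemma summable_norm_sq_bounded_op:
  assumes t: "bounded_op t" and a: "(\<lambda>i. (norm (a i))\<^sup>2) summable_on I"
  shows "(\<lambda>i. (norm (t (a i)))\<^sup>2) summable_on I"
proof -
  obtain K where K: "K > 0" "\<And>u. norm (t u) \<le> K * norm u"
    using bounded_op_pos_bound[OF t] by metis
  show ?thesis
  proof (rule summable_on_comparison_test[OF summable_on_cmult_right[OF a]])
    show "(norm (t (a i)))\<^sup>2 \<le> K\<^sup>2 * (norm (a i))\<^sup>2" for i
      using power_mono[OF K(2) norm_ge_zero, of "a i" 2] by (simp add: power_mult_distrib)
  qed simp
qed

lemmas has_sum_bounded_op = has_sum_bounded_linear[OF bounded_op_bounded_linear]


section \<open>Unordered sums\<close>

lemma mult_le_sum_sq: "(x::real) * y \<le> x\<^sup>2 + y\<^sup>2"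
  using sum_squares_bound[of x y] zero_le_power2[of x] zero_le_power2[of y] by linarith

text \<open>Orthogonal series need not converge absolutely, so the Cauchy criterion is applied to
  the net of finite partial sums: blocks outside a large finite set are small because
  \<open>g\<close> has small tails.\<close>

lemma summable_on_sq_majorant:
  fixes f :: "'i \<Rightarrow> 'a::banach" and g :: "'i \<Rightarrow> real"
  assumes g: "g summable_on A" and K: "K \<ge> 0" and g0: "\<And>i. i \<in> A \<Longrightarrow> g i \<ge> 0"
    and le: "\<And>F. finite F \<Longrightarrow> F \<subseteq> A \<Longrightarrow> (norm (sum f F))\<^sup>2 \<le> K * sum g F"
  shows "f summable_on A"
proof -
  have gx: "\<exists>P. finite P \<and> P \<subseteq> A \<and> (\<forall>D. finite D \<and> D \<subseteq> A - P \<longrightarrow> sum g D < d)"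
    if "d > 0" for d
  proof -
    have "(sum g \<longlongrightarrow> infsum g A) (finite_subsets_at_top A)"
      using g by (simp add: has_sum_def[symmetric])
    then have "\<forall>\<^sub>F F in finite_subsets_at_top A. dist (sum g F) (infsum g A) < d / 2"
      by (rule tendstoD) (use that in simp)
    then obtain P where P: "finite P" "P \<subseteq> A"
      "\<forall>F. finite F \<and> P \<subseteq> F \<and> F \<subseteq> A \<longrightarrow> dist (sum g F) (infsum g A) < d / 2"
      unfolding eventually_finite_subsets_at_top by blast
    have "sum g D < d" if D: "finite D" "D \<subseteq> A - P" for D
    proof -
      have "sum g (P \<union> D) = sum g P + sum g D"
        using D P by (intro sum.union_disjoint) auto
      moreover have "dist (sum g P) (infsum g A) < d / 2" "dist (sum g (P \<union> D)) (infsum g A) < d / 2"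
        using P(1,2) D P(3)[rule_format, of P] P(3)[rule_format, of "P \<union> D"] by auto
      ultimately show ?thesis unfolding dist_real_def by linarith
    qed
    then show ?thesis using P(1,2) by blast
  qed
  have "\<exists>Q. eventually Q (finite_subsets_at_top A) \<and>
      (\<forall>F F'. Q F \<and> Q F' \<longrightarrow> dist (sum f F) (sum f F') < e)" if "e > 0" for e
  proof -
    \<comment> \<open>Dividing by \<open>K + 1\<close> instead of \<open>K\<close> covers the case
      \<open>K = 0\<close>.\<close>
    obtain P where P: "finite P" "P \<subseteq> A"
      "\<And>D. finite D \<Longrightarrow> D \<subseteq> A - P \<Longrightarrow> sum g D < (e / 2)\<^sup>2 / (K + 1)"
      using gx[of "(e / 2)\<^sup>2 / (K + 1)"] \<open>e > 0\<close> K by auto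
    have small: "norm (sum f D) < e / 2" if D: "finite D" "D \<subseteq> A - P" for D
    proof -
      have "(norm (sum f D))\<^sup>2 \<le> K * sum g D" using le[of D] D by auto
      also have "\<dots> \<le> (K + 1) * sum g D"
        using g0 D by (intro mult_right_mono sum_nonneg) auto
      also have "\<dots> < (K + 1) * ((e / 2)\<^sup>2 / (K + 1))"
        using P(3)[OF D] K by (intro mult_strict_left_mono) auto
      also have "\<dots> = (e / 2)\<^sup>2" using K by simp
      finally show ?thesis by (rule power_less_imp_less_base) (use \<open>e > 0\<close> in simp)
    qed
    have "dist (sum f F) (sum f P) < e / 2" if F: "finite F" "P \<subseteq> F" "F \<subseteq> A" for F
    proof -
      have "sum f (F - P) = sum f F - sum f P" using F by (intro sum_diff) auto
      then show ?thesis using small[of "F - P"] F by (auto simp: dist_norm)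
    qed
    then have *: "dist (sum f F) (sum f F') < e"
      if "finite F" "P \<subseteq> F" "F \<subseteq> A" "finite F'" "P \<subseteq> F'" "F' \<subseteq> A" for F F'
      using that by (meson dist_triangle_half_l)
    show ?thesis
      by (intro exI[of _ "\<lambda>F. finite F \<and> P \<subseteq> F \<and> F \<subseteq> A"] conjI)
        (use P * in \<open>auto simp: eventually_finite_subsets_at_top\<close>)
  qed
  then have "cauchy_filter (filtermap (sum f) (finite_subsets_at_top A))"
    by (simp add: cauchy_filter_metric_filtermap)
  moreover have "complete (UNIV::'a set)"
    by (meson Cauchy_convergent UNIV_I complete_def convergent_def)
  ultimately obtain l where "(sum f \<longlongrightarrow> l) (finite_subsets_at_top A)"
    using complete_uniform[where S=UNIV] by (force simp add: filterlim_def)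
  then show ?thesis unfolding summable_on_def has_sum_def by blast
qed


lemma cinner_mult_swap:
  "cinner u v * cinner v u = complex_of_real ((cmod (cinner v (u::'a::chilbert_space)))\<^sup>2)"
  unfolding complex_norm_square by (simp add: cinner_commute[of u v] mult.commute)

section \<open>Orthonormal bases\<close>

text \<open>A maximal orthonormal set, from Zorn's lemma, is total: a nonzero vector orthogonal to
  it could be normalised and adjoined. Applied to \<open>hs\<close> as well as to the underlying
  space.\<close>

lemma onb_exists: "\<exists>E. onb_on (UNIV :: 'a::chilbert_space set) E"
proof -
  define ON where "ON = {E::'a set. \<forall>e\<in>E. \<forall>f\<in>E. cinner e f = (if e = f then 1 else 0)}"
  have "\<exists>M\<in>ON. \<forall>X\<in>ON. M \<subseteq> X \<longrightarrow> X = M"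
  proof (rule subset_Zorn')
    fix C assume C: "subset.chain ON C"
    show "\<Union>C \<in> ON"
      unfolding ON_def
    proof (intro CollectI ballI)
      fix e f assume "e \<in> \<Union>C" "f \<in> \<Union>C"
      then obtain X Y where XY: "X \<in> C" "Y \<in> C" "e \<in> X" "f \<in> Y" by blast
      then have "X \<subseteq> Y \<or> Y \<subseteq> X" using C by (auto simp: subset.chain_def)
      then obtain Z where "Z \<in> C" "e \<in> Z" "f \<in> Z" using XY by blast
      moreover have "C \<subseteq> ON" using C by (auto simp: subset.chain_def)
      ultimately show "cinner e f = (if e = f then 1 else 0)" unfolding ON_def by blast
    qed
  qed
  then obtain M where M: "M \<in> ON" and max: "\<And>X. X \<in> ON \<Longrightarrow> M \<subseteq> X \<Longrightarrow> X = M" by blast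
  have "u = 0" if u: "\<forall>e\<in>M. cinner e u = 0" for u
  proof (rule ccontr)
    assume "u \<noteq> 0"
    define w where "w = (1 / norm u) *\<^sub>R u"
    have w: "cinner w w = 1"
      using \<open>u \<noteq> 0\<close> by (simp add: w_def cinner_linear cinner_self power2_eq_square)
    have e: "cinner e w = 0" "cinner w e = 0" if "e \<in> M" for e
      using u that cinner_commute[of u e] by (auto simp: w_def cinner_linear)
    have "insert w M \<in> ON" using M w e unfolding ON_def by auto
    then have "w \<in> M" using max[of "insert w M"] by blast
    then show False using e w by force
  qed
  then show ?thesis using M unfolding onb_on_def ON_def by (intro exI[of _ M]) auto
qed

lemma onb_some_onb: "onb_on UNIV (some_onb (UNIV :: 'a::chilbert_space set))"
  unfolding some_onb_def using onb_exists by (rule someI_ex)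

lemma norm_sq_orthonormal_sum:
  assumes "\<And>e f. e \<in> F \<Longrightarrow> f \<in> F \<Longrightarrow> cinner e f = (if e = f then 1 else 0)" "finite F"
  shows "(norm (\<Sum>e\<in>F. c e *\<^sub>C (e::'a::chilbert_space)))\<^sup>2 = (\<Sum>e\<in>F. (cmod (c e))\<^sup>2)"
proof -
  have "cinner (\<Sum>e\<in>F. c e *\<^sub>C e) (\<Sum>e\<in>F. c e *\<^sub>C e) =
      (\<Sum>e\<in>F. \<Sum>f\<in>F. cnj (c e) * (c f * cinner e f))"
    unfolding cinner_sum_left unfolding cinner_sum_right
    by (simp add: cinner_linear mult.left_commute)
  also have "\<dots> = (\<Sum>e\<in>F. \<Sum>f\<in>F. if f = e then cnj (c e) * c f else 0)"
    using assms(1) by (intro sum.cong) auto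
  also have "\<dots> = (\<Sum>e\<in>F. complex_of_real ((cmod (c e))\<^sup>2))"
    using assms(2) by (intro sum.cong)
      (auto simp: sum.delta complex_norm_square mult.commute simp del: of_real_power)
  finally have "complex_of_real ((norm (\<Sum>e\<in>F. c e *\<^sub>C e))\<^sup>2) =
      complex_of_real (\<Sum>e\<in>F. (cmod (c e))\<^sup>2)"
    by (simp only: cinner_self of_real_sum)
  then show ?thesis by (simp only: of_real_eq_iff)
qed

locale orthonormal_basis =
  fixes E :: "'a::chilbert_space set"
  assumes onb: "onb_on UNIV E"
begin

lemma orthonormal: "e \<in> E \<Longrightarrow> f \<in> E \<Longrightarrow> cinner e f = (if e = f then 1 else 0)"
  using onb unfolding onb_on_def by auto

lemma eq_0I: "(\<And>e. e \<in> E \<Longrightarrow> cinner e u = 0) \<Longrightarrow> u = 0"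
  using onb unfolding onb_on_def by auto

lemma bessel:
  assumes F: "finite F" "F \<subseteq> E"
  shows "(\<Sum>e\<in>F. (cmod (cinner e u))\<^sup>2) \<le> (norm u)\<^sup>2"
proof -
  \<comment> \<open>The projection of \<open>u\<close> onto the span of \<open>F\<close>; the claim
    is Pythagoras for \<open>u - p\<close> and \<open>p\<close>.\<close>
  define p where "p = (\<Sum>e\<in>F. cinner e u *\<^sub>C e)"
  have n: "(norm p)\<^sup>2 = (\<Sum>e\<in>F. (cmod (cinner e u))\<^sup>2)"
    unfolding p_def using F by (intro norm_sq_orthonormal_sum orthonormal) auto
  have "cinner u p = (\<Sum>e\<in>F. cinner e u * cinner u e)"
    by (simp add: p_def cinner_sum_right cinner_linear)
  also have "\<dots> = (\<Sum>e\<in>F. complex_of_real ((cmod (cinner e u))\<^sup>2))"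
    by (intro sum.cong refl) (metis cinner_mult_swap mult.commute)
  finally have "Re (cinner u p) = (norm p)\<^sup>2" by (simp add: n)
  then have "(norm (u - p))\<^sup>2 = (norm u)\<^sup>2 - (norm p)\<^sup>2"
    by (simp add: norm_diff_sq)
  then show ?thesis using n by (metis diff_ge_0_iff_ge zero_le_power2)
qed

lemma summable_coeff_sq: "(\<lambda>e. (cmod (cinner e u))\<^sup>2) summable_on E"
  by (rule nonneg_bdd_above_summable_on) (auto intro!: bdd_aboveI2[of _ _ "(norm u)\<^sup>2"] bessel)

lemma summable_expansion:
  assumes "(\<lambda>e. (cmod (c e))\<^sup>2) summable_on E"
  shows "(\<lambda>e. c e *\<^sub>C e) summable_on E"
proof (rule summable_on_sq_majorant[OF assms, of 1])
  show "(norm (\<Sum>e\<in>F. c e *\<^sub>C e))\<^sup>2 \<le> 1 * (\<Sum>e\<in>F. (cmod (c e))\<^sup>2)" if "finite F" "F \<subseteq> E" for F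
    using norm_sq_orthonormal_sum[of F c] that orthonormal by (simp add: subset_iff)
qed auto

text \<open>Bessel's inequality gives convergence to some \<open>v\<close>; all coefficients of
  \<open>u - v\<close> vanish, and a basis is total.\<close>

lemma expansion: "((\<lambda>e. cinner e u *\<^sub>C e) has_sum u) E"
proof -
  obtain v where v: "((\<lambda>e. cinner e u *\<^sub>C e) has_sum v) E"
    using summable_expansion[OF summable_coeff_sq] unfolding summable_on_def by blast
  have "cinner f (u - v) = 0" if f: "f \<in> E" for f
  proof -
    have "((\<lambda>e. cinner f (cinner e u *\<^sub>C e)) has_sum cinner f v) E"
      by (rule has_sum_cinner_right[OF v])
    moreover have "((\<lambda>e. cinner f (cinner e u *\<^sub>C e)) has_sum cinner f u) E"
      by (rule has_sum_finite_neutralI[of "{f}"])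
        (use f orthonormal in \<open>auto simp: cinner_linear\<close>)
    ultimately show ?thesis using has_sum_unique by (fastforce simp: cinner_diff_right)
  qed
  then have "u = v" using eq_0I by fastforce
  then show ?thesis using v by simp
qed

lemma parseval: "((\<lambda>e. cinner u e * cinner e v) has_sum cinner u v) E"
  using has_sum_cinner_right[OF expansion, of u v] by (simp add: cinner_linear mult.commute)

lemma parseval_norm: "((\<lambda>e. (cmod (cinner e u))\<^sup>2) has_sum (norm u)\<^sup>2) E"
proof -
  have "((\<lambda>e. Re (cinner u e * cinner e u)) has_sum Re (cinner u u)) E"
    by (rule has_sum_Re[OF parseval])
  then show ?thesis unfolding cinner_mult_swap cinner_self by (simp only: Re_complex_of_real)
qed

lemma op_eqI:
  assumes "bounded_op A" "bounded_op B" "\<And>e. e \<in> E \<Longrightarrow> A e = B e"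
  shows "A = B"
proof
  fix u
  have "((\<lambda>e. A (cinner e u *\<^sub>C e)) has_sum A u) E" "((\<lambda>e. B (cinner e u *\<^sub>C e)) has_sum B u) E"
    by (rule has_sum_bounded_op[OF assms(1) expansion], rule has_sum_bounded_op[OF assms(2) expansion])
  moreover have "((\<lambda>e. A (cinner e u *\<^sub>C e)) has_sum A u) E \<longleftrightarrow>
      ((\<lambda>e. B (cinner e u *\<^sub>C e)) has_sum A u) E"
    using assms by (intro has_sum_cong) (simp add: bounded_op_scaleC)
  ultimately show "A u = B u" by (metis has_sum_unique)
qed

lemma summable_coeff_sq_prod:
  assumes "(\<lambda>i. (norm (a i))\<^sup>2) summable_on I"
  shows "(\<lambda>(i, e). (cmod (cinner e (a i)))\<^sup>2) summable_on I \<times> E"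
proof -
  have "(\<lambda>p. norm ((\<lambda>(i, e). (cmod (cinner e (a i)))\<^sup>2) p)) summable_on I \<times> E"
    unfolding Infinite_Sum.abs_summable_on_Sigma_iff
    using assms infsumI[OF parseval_norm] summable_coeff_sq by simp
  then show ?thesis by (simp add: split_def)
qed

lemma summable_coeff_prod:
  assumes a: "(\<lambda>i. (norm (a i))\<^sup>2) summable_on I" and b: "(\<lambda>i. (norm (b i))\<^sup>2) summable_on I"
  shows "(\<lambda>(i, e). cinner (a i) e * cinner e (b i)) summable_on I \<times> E"
proof (rule Infinite_Sum.abs_summable_summable, rule Infinite_Sum.abs_summable_on_comparison_test')
  show "(\<lambda>p. (\<lambda>(i, e). (cmod (cinner e (a i)))\<^sup>2) p + (\<lambda>(i, e). (cmod (cinner e (b i)))\<^sup>2) p)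
      summable_on I \<times> E"
    by (intro summable_on_add summable_coeff_sq_prod a b)
  show "norm (case p of (i, e) \<Rightarrow> cinner (a i) e * cinner e (b i)) \<le>
      (\<lambda>(i, e). (cmod (cinner e (a i)))\<^sup>2) p + (\<lambda>(i, e). (cmod (cinner e (b i)))\<^sup>2) p" for p
  proof (cases p)
    case (Pair i e)
    have "cmod (cinner e (a i)) * cmod (cinner e (b i)) \<le>
        (cmod (cinner e (a i)))\<^sup>2 + (cmod (cinner e (b i)))\<^sup>2" by (rule mult_le_sum_sq)
    moreover have "cmod (cinner (a i) e) = cmod (cinner e (a i))"
      by (metis cinner_commute complex_mod_cnj)
    ultimately show ?thesis unfolding Pair by (simp add: norm_mult)
  qed
qed

text \<open>Fubini for the double sum over family and basis. It trades a sum over \<open>I\<close>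
  for one over the basis, for traces of adjoints and again for the comparison of frames.\<close>

lemma parseval_family:
  assumes a: "(\<lambda>i. (norm (a i))\<^sup>2) summable_on I" and b: "(\<lambda>i. (norm (b i))\<^sup>2) summable_on I"
  shows "(\<Sum>\<^sub>\<infinity>i\<in>I. cinner (a i) (b i)) = (\<Sum>\<^sub>\<infinity>e\<in>E. \<Sum>\<^sub>\<infinity>i\<in>I. cinner (a i) e * cinner e (b i))"
  using infsum_swap_banach[OF summable_coeff_prod[OF a b]] infsumI[OF parseval] by simp

end

lemma cinner_summable_on:
  assumes a: "(\<lambda>i. (norm (a i :: 'a::chilbert_space))\<^sup>2) summable_on I"
    and b: "(\<lambda>i. (norm (b i))\<^sup>2) summable_on I"
  shows "(\<lambda>i. cinner (a i) (b i)) summable_on I"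
proof (rule Infinite_Sum.abs_summable_summable, rule Infinite_Sum.abs_summable_on_comparison_test')
  show "(\<lambda>i. (norm (a i))\<^sup>2 + (norm (b i))\<^sup>2) summable_on I"
    by (intro summable_on_add a b)
  show "norm (cinner (a i) (b i)) \<le> (norm (a i))\<^sup>2 + (norm (b i))\<^sup>2" for i
    by (rule order_trans[OF cmod_cinner_le mult_le_sum_sq])
qed


section \<open>Adjoints\<close>

text \<open>Riesz representation by coordinates: \<open>w\<close> is the sum of the vectors
  \<open>cinner (A e) v *\<^sub>C e\<close>, and boundedness of \<open>A\<close> makes these
  coefficients square summable.\<close>

lemma adj_exists:
  fixes A :: "'a::chilbert_space \<Rightarrow> 'a"
  assumes A: "bounded_op A"
  shows "\<exists>B. \<forall>u v. cinner (A u) v = cinner u (B v)"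
proof -
  obtain E :: "'a set" where "onb_on UNIV E" using onb_exists by blast
  then interpret orthonormal_basis E by unfold_locales
  obtain K where K: "K > 0" "\<And>u. norm (A u) \<le> K * norm u" using bounded_op_pos_bound[OF A] by metis
  have "\<exists>w. \<forall>u. cinner (A u) v = cinner u w" for v
  proof -
    have "(\<lambda>e. (cmod (cinner (A e) v))\<^sup>2) summable_on E"
    proof (rule nonneg_bdd_above_summable_on)
      show "bdd_above (sum (\<lambda>e. (cmod (cinner (A e) v))\<^sup>2) ` {F. F \<subseteq> E \<and> finite F})"
      proof (rule bdd_aboveI2)
        fix F assume "F \<in> {F. F \<subseteq> E \<and> finite F}"
        then have F: "F \<subseteq> E" "finite F" by auto
        \<comment> \<open>Duality: applying \<open>A\<close> to the partial sum \<open>w\<close>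
          itself bounds the square of \<open>norm w\<close> by \<open>K * norm w * norm v\<close>,
          and one factor \<open>norm w\<close> cancels.\<close>
        define w s where "w = (\<Sum>e\<in>F. cinner (A e) v *\<^sub>C e)"
          and "s = (\<Sum>e\<in>F. (cmod (cinner (A e) v))\<^sup>2)"
        have ws: "(norm w)\<^sup>2 = s"
          unfolding w_def s_def using F by (intro norm_sq_orthonormal_sum orthonormal) auto
        have "cinner (A w) v = (\<Sum>e\<in>F. cnj (cinner (A e) v) * cinner (A e) v)"
          by (simp add: w_def bounded_op_sum[OF A] bounded_op_scaleC[OF A] cinner_sum_left cinner_linear)
        also have "\<dots> = complex_of_real s"
          unfolding s_def of_real_sum
          by (intro sum.cong refl) (metis complex_norm_square mult.commute)
        finally have "\<bar>s\<bar> = cmod (cinner (A w) v)" by simp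
        also have "\<dots> \<le> norm (A w) * norm v" by (rule cmod_cinner_le)
        also have "\<dots> \<le> (K * norm w) * norm v" by (intro mult_right_mono K) simp
        finally have "norm w * norm w \<le> norm w * (K * norm v)"
          using ws by (simp add: power2_eq_square mult.commute mult.left_commute)
        then have "norm w \<le> K * norm v" using K(1) by (cases "w = 0") auto
        then show "s \<le> (K * norm v)\<^sup>2" unfolding ws[symmetric] by (intro power_mono) auto
      qed
    qed auto
    then have "(\<lambda>e. cinner (A e) v *\<^sub>C e) summable_on E" by (rule summable_expansion)
    then obtain w where w: "((\<lambda>e. cinner (A e) v *\<^sub>C e) has_sum w) E"
      unfolding summable_on_def by blast
    have "cinner (A u) v = cinner u w" for u
    proof -
      have "((\<lambda>e. cinner (A (cinner e u *\<^sub>C e)) v) has_sum cinner (A u) v) E"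
        by (rule has_sum_cinner_left[OF has_sum_bounded_op[OF A expansion]])
      moreover have "cinner (A (cinner e u *\<^sub>C e)) v = cinner (A e) v * cinner u e" for e
        using cinner_commute[of u e] by (simp add: bounded_op_scaleC[OF A] cinner_linear mult.commute)
      moreover have "((\<lambda>e. cinner u (cinner (A e) v *\<^sub>C e)) has_sum cinner u w) E"
        by (rule has_sum_cinner_right[OF w])
      ultimately show ?thesis using has_sum_unique by (fastforce simp: cinner_linear)
    qed
    then show ?thesis by blast
  qed
  then show ?thesis by metis
qed

lemma adj_eqI:
  fixes A :: "'a::chilbert_space \<Rightarrow> 'a"
  assumes "\<And>u v. cinner (A u) v = cinner u (B v)"
  shows "adj A = B"
  unfolding adj_def
proof (rule the_equality)
  show "B' = B" if "\<forall>u v. cinner (A u) v = cinner u (B' v)" for B'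
    using assms that by (metis cinner_eqI ext)
qed (use assms in auto)

lemma cinner_adj: "bounded_op A \<Longrightarrow> cinner u (adj A v) = cinner (A u) v"
  using adj_exists[of A] adj_eqI[of A] by metis

lemma cinner_adj': "bounded_op A \<Longrightarrow> cinner (adj A u) v = cinner u (A v)"
  using cinner_adj[of A v u] by (metis cinner_commute)

lemma norm_adj_le:
  fixes A :: "'a::chilbert_space \<Rightarrow> 'a"
  assumes A: "bounded_op A" and K: "\<And>u. norm (A u) \<le> K * norm u"
  shows "norm (adj A v) \<le> K * norm v"
proof (cases "adj A v = 0")
  case True
  have "0 \<le> K * norm v" using K[of v] norm_ge_zero order_trans by blast
  then show ?thesis using True by simp
next
  case False
  have "(norm (adj A v))\<^sup>2 = cmod (cinner (adj A v) (adj A v))"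
    unfolding cinner_self by (simp only: norm_of_real abs_power2)
  also have "\<dots> = cmod (cinner (A (adj A v)) v)" by (simp add: cinner_adj[OF A])
  also have "\<dots> \<le> norm (A (adj A v)) * norm v" by (rule cmod_cinner_le)
  also have "\<dots> \<le> (K * norm (adj A v)) * norm v" by (intro mult_right_mono K) simp
  finally have "norm (adj A v) * norm (adj A v) \<le> norm (adj A v) * (K * norm v)"
    by (simp add: power2_eq_square mult.commute mult.left_commute)
  then show ?thesis using False by simp
qed

lemma bounded_op_adj:
  fixes A :: "'a::chilbert_space \<Rightarrow> 'a"
  assumes A: "bounded_op A"
  shows "bounded_op (adj A)"
proof -
  obtain K where K: "K > 0" "\<And>u. norm (A u) \<le> K * norm u" using bounded_op_pos_bound[OF A] by metis
  show ?thesis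
  proof (rule bounded_opI)
    show "adj A (u + v) = adj A u + adj A v" for u v
      by (rule cinner_eqI) (simp add: cinner_adj[OF A] cinner_linear)
    show "adj A (c *\<^sub>C u) = c *\<^sub>C adj A u" for c u
      by (rule cinner_eqI) (simp add: cinner_adj[OF A] cinner_linear)
    show "norm (adj A u) \<le> K * norm u" for u by (rule norm_adj_le[OF A K(2)])
  qed
qed

lemma adj_adj: "bounded_op A \<Longrightarrow> adj (adj A) = A"
  by (rule adj_eqI) (simp add: cinner_adj')

lemma adj_comp: "bounded_op A \<Longrightarrow> bounded_op B \<Longrightarrow> adj (A \<circ> B) = adj B \<circ> adj A"
  by (rule adj_eqI) (simp add: cinner_adj)

lemma adj_self_adjoint: "self_adjoint A \<Longrightarrow> adj A = A"
  by (rule adj_eqI) (auto simp: self_adjoint_on_def)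

text \<open>Polarisation: the real quadratic form at \<open>u + v\<close> gives the sum, and at
  \<open>u + \<i> *\<^sub>C v\<close> the difference, of the symmetry identities for the pairs
  \<open>u\<close>, \<open>v\<close> and \<open>v\<close>, \<open>u\<close>.\<close>

lemma positive_op_self_adjoint:
  fixes A :: "'a::chilbert_space \<Rightarrow> 'a"
  assumes "positive_op A"
  shows "self_adjoint A"
proof -
  have A: "bounded_op A" and real: "cinner u (A u) \<in> \<real>" for u
    using assms unfolding positive_op_on_def by (auto simp: nonneg_Reals_def Reals_def image_iff)
  have sym: "cinner (A u) u = cinner u (A u)" for u
    using real[of u] by (metis Reals_cnj_iff cinner_commute)
  have "cinner (A u) v = cinner u (A v)" for u v
  proof -
    have 1: "cinner (A u) v + cinner (A v) u = cinner u (A v) + cinner v (A u)"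
      using sym[of "u + v"] sym[of u] sym[of v]
      by (simp add: bounded_op_add[OF A] cinner_linear algebra_simps)
    have 2: "\<i> * cinner (A u) v - \<i> * cinner (A v) u = \<i> * cinner u (A v) - \<i> * cinner v (A u)"
      using sym[of "u + \<i> *\<^sub>C v"] sym[of u] sym[of v]
      by (simp add: bounded_op_add[OF A] bounded_op_scaleC[OF A] cinner_linear algebra_simps)
    have "cinner (A u) v - cinner (A v) u = cinner u (A v) - cinner v (A u)"
      using 2 by (metis (no_types, opaque_lifting) complex_i_not_zero mult_cancel_left right_diff_distrib)
    with 1 have "2 * cinner (A u) v = 2 * cinner u (A v)" by algebra
    then show ?thesis by simp
  qed
  then show ?thesis using A by (auto simp: self_adjoint_on_def)
qed


section \<open>Square roots of positive operators\<close>

lemma positive_op_iff: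
  "positive_op A \<longleftrightarrow> self_adjoint A \<and> (\<forall>u. 0 \<le> Re (cinner u (A u)))"
proof
  assume "positive_op A"
  then show "self_adjoint A \<and> (\<forall>u. 0 \<le> Re (cinner u (A u)))"
    using positive_op_self_adjoint by (auto simp: positive_op_on_def complex_nonneg_Reals_iff)
next
  assume A: "self_adjoint A \<and> (\<forall>u. 0 \<le> Re (cinner u (A u)))"
  have "Im (cinner u (A u)) = 0" for u
  proof -
    have "cinner u (A u) = cnj (cinner u (A u))"
      using A cinner_commute[of "A u" u] by (auto simp: self_adjoint_on_def)
    then show ?thesis by (simp add: complex_eq_iff)
  qed
  then show "positive_op A"
    using A by (auto simp: positive_op_on_def complex_nonneg_Reals_iff self_adjoint_on_def)
qed

lemma self_adjoint_bounded_op: "self_adjoint A \<Longrightarrow> bounded_op A"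
  and self_adjoint_cinner: "self_adjoint A \<Longrightarrow> cinner (A u) v = cinner u (A v)"
  by (auto simp: self_adjoint_on_def)

lemma positive_op_bounded_op: "positive_op A \<Longrightarrow> bounded_op A"
  and positive_op_cinner: "positive_op A \<Longrightarrow> cinner (A u) v = cinner u (A v)"
  and positive_op_Re_ge_0: "positive_op A \<Longrightarrow> 0 \<le> Re (cinner u (A u))"
  using positive_op_iff self_adjoint_bounded_op self_adjoint_cinner by blast+

lemma positive_op_cinner_eq_Re:
  "positive_op A \<Longrightarrow> cinner u (A u) = complex_of_real (Re (cinner u (A u)))"
  by (simp add: positive_op_on_def complex_nonneg_Reals_iff complex_eq_iff)

text \<open>In operator terms \<open>A\<^sup>2 \<le> K A\<close>. Positivity is tested at
  \<open>u - (1 / K) *\<^sub>R A u\<close>, where the form is at most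
  \<open>Re (cinner u (A u)) - n / K\<close>.\<close>

lemma positive_op_norm_sq_le:
  assumes A: "positive_op A" and K: "K > 0" "\<And>u. norm (A u) \<le> K * norm u"
  shows "(norm (A u))\<^sup>2 \<le> K * Re (cinner u (A u))"
proof -
  note lin = bounded_op_linear[OF positive_op_bounded_op[OF A]]
  have AA: "cinner u (A (A u)) = complex_of_real ((norm (A u))\<^sup>2)"
    unfolding cinner_self[symmetric] positive_op_cinner[OF A] ..
  define n where "n = (norm (A u))\<^sup>2"
  have "0 \<le> Re (cinner (u - (1 / K) *\<^sub>R A u) (A (u - (1 / K) *\<^sub>R A u)))"
    by (rule positive_op_Re_ge_0[OF A])
  also have "\<dots> = Re (cinner u (A u)) - 2 * (1 / K) * n + (1 / K)\<^sup>2 * Re (cinner (A u) (A (A u)))"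
    using AA by (simp add: lin cinner_linear positive_op_cinner[OF A] n_def
        power2_eq_square algebra_simps)
  also have "Re (cinner (A u) (A (A u))) \<le> K * n"
  proof -
    have "Re (cinner (A u) (A (A u))) \<le> cmod (cinner (A u) (A (A u)))" by (rule complex_Re_le_cmod)
    also have "\<dots> \<le> norm (A u) * norm (A (A u))" by (rule cmod_cinner_le)
    also have "\<dots> \<le> norm (A u) * (K * norm (A u))" by (intro mult_left_mono K) simp
    finally show ?thesis by (simp add: n_def power2_eq_square mult.left_commute)
  qed
  then have "Re (cinner u (A u)) - 2 * (1 / K) * n + (1 / K)\<^sup>2 * Re (cinner (A u) (A (A u))) \<le>
      Re (cinner u (A u)) - 2 * (1 / K) * n + (1 / K)\<^sup>2 * (K * n)"
    by (intro add_left_mono mult_left_mono) auto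
  also have "\<dots> = Re (cinner u (A u)) - n / K" using K(1) by (simp add: field_simps power2_eq_square)
  finally show ?thesis using K(1) by (simp add: field_simps n_def)
qed

lemma positive_op_eq_0I:
  assumes A: "positive_op A" and 0: "cinner u (A u) = 0"
  shows "A u = 0"
proof -
  obtain K where K: "K > 0" "\<And>u. norm (A u) \<le> K * norm u"
    using bounded_op_pos_bound[OF positive_op_bounded_op[OF A]] by metis
  show ?thesis using positive_op_norm_sq_le[OF A K, of u] 0 by simp
qed

text \<open>By \<open>positive_op_norm_sq_le\<close> with \<open>K = 1\<close>, the mixed term
  outweighs the quadratic one. This makes \<open>1 - A\<close> a contraction, as the square root
  iteration requires.\<close>

lemma positive_contraction_norm_le:
  assumes A: "positive_op A" and le: "\<And>u. norm (A u) \<le> norm u"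
  shows "norm (u - A u) \<le> norm u"
proof (rule power2_le_imp_le)
  show "(norm (u - A u))\<^sup>2 \<le> (norm u)\<^sup>2"
    using positive_op_norm_sq_le[OF A zero_less_one, of u] le positive_op_Re_ge_0[OF A, of u]
    unfolding norm_diff_sq by simp
qed simp

text \<open>
  The root of \<open>1 - T\<close> is \<open>1 - Y\<close>, where \<open>Y = (T + Y\<^sup>2) / 2\<close> is obtained by iteration. The
  increments of the iterates are dominated by those of the scalar iteration for \<open>T = 1\<close>.
\<close>

fun root_iter :: "('a::chilbert_space \<Rightarrow> 'a) \<Rightarrow> nat \<Rightarrow> 'a \<Rightarrow> 'a" where
  "root_iter T 0 = (\<lambda>u. 0)"
| "root_iter T (Suc n) = (\<lambda>u. (1 / 2) *\<^sub>R (T u + root_iter T n (root_iter T n u)))"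

fun scalar_iter :: "nat \<Rightarrow> real" where
  "scalar_iter 0 = 0"
| "scalar_iter (Suc n) = (1 + (scalar_iter n)\<^sup>2) / 2"

lemma scalar_iter_bounds: "0 \<le> scalar_iter n \<and> scalar_iter n \<le> 1"
proof (induction n)
  case (Suc n)
  then have "(scalar_iter n)\<^sup>2 \<le> 1" by (simp add: power_le_one)
  then show ?case by simp
qed simp

lemma incseq_scalar_iter: "incseq scalar_iter"
proof (rule incseq_SucI)
  show "scalar_iter n \<le> scalar_iter (Suc n)" for n
    using sum_squares_bound[of "scalar_iter n" 1] by (simp add: field_simps)
qed

context
  fixes T :: "'a::chilbert_space \<Rightarrow> 'a"
  assumes T: "self_adjoint T" and T_le: "\<And>u. norm (T u) \<le> norm u"
begin

lemma bounded_op_root_iter: "bounded_op (root_iter T n)"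
  using self_adjoint_bounded_op[OF T]
  by (induction n) (auto intro!: bounded_op_intros intro: bounded_op_comp_fun)

lemma root_iter_self_adjoint: "cinner (root_iter T n u) v = cinner u (root_iter T n v)"
  by (induction n arbitrary: u v) (auto simp: cinner_linear self_adjoint_cinner[OF T])

lemma norm_root_iter_le: "norm (root_iter T n u) \<le> scalar_iter n * norm u"
proof (induction n arbitrary: u)
  case (Suc n)
  have "norm (root_iter T n (root_iter T n u)) \<le> scalar_iter n * norm (root_iter T n u)"
    by (rule Suc.IH)
  also have "\<dots> \<le> scalar_iter n * (scalar_iter n * norm u)"
    using scalar_iter_bounds by (intro mult_left_mono Suc.IH) auto
  finally have "norm (T u + root_iter T n (root_iter T n u)) \<le>
      norm u + (scalar_iter n)\<^sup>2 * norm u"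
    using T_le[of u] by (intro norm_triangle_le) (simp add: power2_eq_square)
  then show ?case unfolding root_iter.simps norm_scaleR by (simp add: field_simps)
qed simp

text \<open>The splitting \<open>X X - Y Y = X (X - Y) + (X - Y) Y\<close> needs no commutation, and
  its norm bounds add up to the scalar
  \<open>x (x - y) + (x - y) y = x\<^sup>2 - y\<^sup>2\<close>.\<close>

lemma norm_root_iter_Suc_diff_le:
  "norm (root_iter T (Suc n) u - root_iter T n u) \<le> (scalar_iter (Suc n) - scalar_iter n) * norm u"
proof (induction n arbitrary: u)
  case 0
  then show ?case using T_le[of u] by simp
next
  case (Suc n)
  define X Y where "X = root_iter T (Suc n)" and "Y = root_iter T n"
  define x y where "x = scalar_iter (Suc n)" and "y = scalar_iter n"
  have IH: "norm (X u - Y u) \<le> (x - y) * norm u" for u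
    unfolding X_def Y_def x_def y_def by (rule Suc.IH)
  have Xle: "norm (X u) \<le> x * norm u" and Yle: "norm (Y u) \<le> y * norm u" for u
    unfolding X_def Y_def x_def y_def by (rule norm_root_iter_le)+
  have xy: "0 \<le> y" "y \<le> x"
    using scalar_iter_bounds[of n] incseqD[OF incseq_scalar_iter, of n "Suc n"]
    by (auto simp: x_def y_def)
  have "X (X u) - Y (Y u) = X (X u - Y u) + (X (Y u) - Y (Y u))"
    by (simp add: X_def bounded_op_diff[OF bounded_op_root_iter] del: root_iter.simps)
  also have "norm \<dots> \<le> x * ((x - y) * norm u) + (x - y) * (y * norm u)"
  proof (rule norm_triangle_mono)
    show "norm (X (X u - Y u)) \<le> x * ((x - y) * norm u)"
      using Xle[of "X u - Y u"] mult_left_mono[OF IH[of u], of x] xy by linarith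
    show "norm (X (Y u) - Y (Y u)) \<le> (x - y) * (y * norm u)"
      using IH[of "Y u"] mult_left_mono[OF Yle[of u], of "x - y"] xy by linarith
  qed
  finally have le: "norm (X (X u) - Y (Y u)) \<le> x * ((x - y) * norm u) + (x - y) * (y * norm u)" .
  have XS: "root_iter T (Suc (Suc n)) u = (1 / 2) *\<^sub>R (T u + X (X u))"
    by (simp only: X_def root_iter.simps)
  have YS: "X u = (1 / 2) *\<^sub>R (T u + Y (Y u))" by (simp add: X_def Y_def)
  have "root_iter T (Suc (Suc n)) u - X u =
      (1 / 2) *\<^sub>R (T u + X (X u)) - (1 / 2) *\<^sub>R (T u + Y (Y u))"
    by (rule arg_cong2[OF XS YS])
  also have "\<dots> = (1 / 2) *\<^sub>R (X (X u) - Y (Y u))" by (simp add: algebra_simps)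
  finally have "norm (root_iter T (Suc (Suc n)) u - X u) = (1 / 2) * norm (X (X u) - Y (Y u))"
    by simp
  also have "\<dots> \<le> (1 / 2) * (x * ((x - y) * norm u) + (x - y) * (y * norm u))"
    using le by simp
  also have "\<dots> = ((1 + x\<^sup>2) / 2 - (1 + y\<^sup>2) / 2) * norm u"
    by (simp add: field_simps power2_eq_square)
  also have "\<dots> = (scalar_iter (Suc (Suc n)) - scalar_iter (Suc n)) * norm u"
    by (simp add: x_def y_def)
  finally show ?case by (simp only: X_def)
qed

lemma norm_root_iter_diff_le:
  "m \<le> n \<Longrightarrow> norm (root_iter T n u - root_iter T m u) \<le> (scalar_iter n - scalar_iter m) * norm u"
proof (induction n rule: dec_induct)
  case (step n)
  have "root_iter T (Suc n) u - root_iter T m u =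
      (root_iter T (Suc n) u - root_iter T n u) + (root_iter T n u - root_iter T m u)"
    by simp
  then have "norm (root_iter T (Suc n) u - root_iter T m u) \<le>
      (scalar_iter (Suc n) - scalar_iter n) * norm u + (scalar_iter n - scalar_iter m) * norm u"
    using norm_triangle_mono[OF norm_root_iter_Suc_diff_le[of n u] step.IH] by metis
  then show ?case by (simp only: left_diff_distrib)
qed simp

text \<open>The differences are dominated by those of a bounded monotone scalar sequence.\<close>

lemma Cauchy_root_iter: "Cauchy (\<lambda>n. root_iter T n u)"
proof (rule metric_CauchyI)
  fix e :: real assume "e > 0"
  obtain l where "scalar_iter \<longlonglongrightarrow> l"
    using incseq_convergent[OF incseq_scalar_iter, of 1] scalar_iter_bounds by blast
  then have "Cauchy (\<lambda>n. scalar_iter n * norm u)"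
    by (intro LIMSEQ_imp_Cauchy[of _ "l * norm u"] tendsto_mult_right)
  then obtain M where M: "\<And>m n. m \<ge> M \<Longrightarrow> n \<ge> M \<Longrightarrow>
      dist (scalar_iter m * norm u) (scalar_iter n * norm u) < e"
    using \<open>e > 0\<close> unfolding Cauchy_def by blast
  have *: "dist (root_iter T n u) (root_iter T m u) < e" if "M \<le> m" "m \<le> n" for m n
    using norm_root_iter_diff_le[OF that(2), of u] M[of n m] that
    by (simp add: dist_norm left_diff_distrib)
  show "\<exists>M. \<forall>m\<ge>M. \<forall>n\<ge>M. dist (root_iter T m u) (root_iter T n u) < e"
    by (intro exI[of _ M]) (metis * dist_commute nle_le)
qed

text \<open>The commutation clause prepares the uniqueness of roots: each iterate is a polynomial in
  \<open>T\<close>, so it commutes with whatever commutes with \<open>T\<close>, and the limit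
  inherits this.\<close>

lemma sqrt_one_minus_exists:
  "\<exists>B. positive_op B \<and> (\<forall>u. B (B u) = u - T u) \<and>
     (\<forall>S. bounded_op S \<and> S \<circ> T = T \<circ> S \<longrightarrow> S \<circ> B = B \<circ> S)"
proof -
  obtain Y where Y: "\<And>u. (\<lambda>n. root_iter T n u) \<longlonglongrightarrow> Y u"
    using Cauchy_root_iter unfolding Cauchy_convergent_iff convergent_def by metis
  note lin = bounded_op_linear[OF bounded_op_root_iter]
  have n1: "norm (root_iter T n u) \<le> norm u" for n u
    using norm_root_iter_le[of n u] scalar_iter_bounds[of n] mult_left_le_one_le[of "norm u" "scalar_iter n"]
    by (auto intro: order_trans)
  have Y1: "norm (Y u) \<le> norm u" for u
    using norm_pointwise_limit_le[OF bounded_op_root_iter Y, of 1] n1 by simp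
  have bY: "bounded_op Y"
    using bounded_op_pointwise_limit[OF bounded_op_root_iter Y, of 1] n1 by simp
  have saY: "cinner (Y u) v = cinner u (Y v)" for u v
    using LIMSEQ_unique[OF cinner.tendsto[OF Y[of u] tendsto_const[of v]]
        cinner.tendsto[OF tendsto_const[of u] Y[of v], folded root_iter_self_adjoint]] .
  \<comment> \<open>The contraction bound \<open>n1\<close>, uniform in \<open>n\<close>, makes the
    products of the strongly convergent iterates converge.\<close>
  have YY: "(\<lambda>n. root_iter T n (root_iter T n u)) \<longlonglongrightarrow> Y (Y u)" for u
  proof -
    have "(\<lambda>n. root_iter T n (root_iter T n u - Y u)) \<longlonglongrightarrow> 0"
    proof (rule tendsto_0_le)
      show "(\<lambda>n. root_iter T n u - Y u) \<longlonglongrightarrow> 0" using Y[of u] by (simp add: LIM_zero)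
      show "\<forall>\<^sub>F n in sequentially. norm (root_iter T n (root_iter T n u - Y u)) \<le>
          norm (root_iter T n u - Y u) * 1"
        using n1 by simp
    qed
    from tendsto_add[OF this Y[of "Y u"]] show ?thesis by (simp add: lin)
  qed
  have "(\<lambda>n. root_iter T (Suc n) u) \<longlonglongrightarrow> (1 / 2) *\<^sub>R (T u + Y (Y u))" for u
    unfolding root_iter.simps by (intro tendsto_intros YY)
  then have Y_fix: "Y u = (1 / 2) *\<^sub>R (T u + Y (Y u))" for u
    using LIMSEQ_unique[OF LIMSEQ_Suc[OF Y[of u]]] by blast
  define B where "B = (\<lambda>u. u - Y u)"
  have bB: "bounded_op B" unfolding B_def by (intro bounded_op_intros bY)
  have "positive_op B"
    unfolding positive_op_iff
  proof (intro conjI allI)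
    show "self_adjoint B" using bB by (auto simp: self_adjoint_on_def B_def cinner_linear saY)
    show "0 \<le> Re (cinner u (B u))" for u
    proof -
      have "Re (cinner u (Y u)) \<le> cmod (cinner u (Y u))" by (rule complex_Re_le_cmod)
      also have "\<dots> \<le> norm u * norm (Y u)" by (rule cmod_cinner_le)
      also have "\<dots> \<le> norm u * norm u" by (intro mult_left_mono Y1) simp
      finally show ?thesis by (simp add: B_def cinner_linear cinner_self power2_eq_square)
    qed
  qed
  moreover have "B (B u) = u - T u" for u
  proof -
    \<comment> \<open>The fixed point equation reads \<open>2 Y = T + Y\<^sup>2\<close>, which
      amounts to \<open>(1 - Y)\<^sup>2 = 1 - T\<close>.\<close>
    have "Y u + Y u = T u + Y (Y u)"
      using arg_cong[OF Y_fix[of u], of "\<lambda>z. 2 *\<^sub>R z"] by (simp add: scaleR_2)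
    moreover have "B (B u) = u - (Y u + Y u) + Y (Y u)"
      by (simp add: B_def bounded_op_diff[OF bY])
    ultimately show ?thesis by simp
  qed
  moreover have "S \<circ> B = B \<circ> S" if S: "bounded_op S" and "S \<circ> T = T \<circ> S" for S
  proof -
    have ST: "S (T u) = T (S u)" for u using that(2) by (metis comp_apply)
    have "S (root_iter T n u) = root_iter T n (S u)" for n u
      by (induction n arbitrary: u) (auto simp: bounded_op_linear[OF S] ST)
    then have "(\<lambda>n. root_iter T n (S u)) \<longlonglongrightarrow> S (Y u)" for u
      using bounded_linear.tendsto[OF bounded_op_bounded_linear[OF S] Y[of u]] by simp
    then have "S (Y u) = Y (S u)" for u by (rule LIMSEQ_unique[OF _ Y])
    then show ?thesis by (auto simp: B_def bounded_op_diff[OF S])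
  qed
  ultimately show ?thesis by blast
qed

end

text \<open>Division by a bound \<open>K\<close> turns \<open>A\<close> into a positive contraction
  \<open>A' = 1 - T\<close>; its root is multiplied by \<open>sqrt K\<close>.\<close>

lemma sqrt_exists:
  fixes A :: "'a::chilbert_space \<Rightarrow> 'a"
  assumes A: "positive_op A"
  shows "\<exists>B. positive_op B \<and> B \<circ> B = A \<and> (\<forall>S. bounded_op S \<and> S \<circ> A = A \<circ> S \<longrightarrow> S \<circ> B = B \<circ> S)"
proof -
  obtain K where K: "K > 0" "\<And>u. norm (A u) \<le> K * norm u"
    using bounded_op_pos_bound[OF positive_op_bounded_op[OF A]] by metis
  define A' where "A' = (\<lambda>u. (1 / K) *\<^sub>R A u)"
  have bA': "bounded_op A'"
    unfolding A'_def by (intro bounded_op_intros positive_op_bounded_op A)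
  have A': "positive_op A'"
    unfolding positive_op_iff self_adjoint_on_def using K(1) bA' positive_op_Re_ge_0[OF A]
    by (auto simp: A'_def cinner_linear positive_op_cinner[OF A])
  have A'1: "norm (A' u) \<le> norm u" for u
    using K(2)[of u] K(1) by (simp add: A'_def field_simps)
  define T where "T = (\<lambda>u. u - A' u)"
  have T: "self_adjoint T" "norm (T u) \<le> norm u" for u
    using bA' positive_contraction_norm_le[OF A' A'1] unfolding self_adjoint_on_def T_def
    by (auto simp: cinner_linear positive_op_cinner[OF A'] intro!: bounded_op_intros)
  obtain B' where B': "positive_op B'" "\<And>u. B' (B' u) = u - T u"
    "\<And>S. bounded_op S \<Longrightarrow> S \<circ> T = T \<circ> S \<Longrightarrow> S \<circ> B' = B' \<circ> S"
    using sqrt_one_minus_exists[OF T] by blast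
  note lin = bounded_op_linear[OF positive_op_bounded_op[OF B'(1)]]
  define B where "B = (\<lambda>u. sqrt K *\<^sub>R B' u)"
  have bB: "bounded_op B" unfolding B_def by (intro bounded_op_intros positive_op_bounded_op B')
  have "positive_op B"
    unfolding positive_op_iff self_adjoint_on_def using K(1) bB positive_op_Re_ge_0[OF B'(1)]
    by (auto simp: B_def cinner_linear positive_op_cinner[OF B'(1)])
  moreover have "B \<circ> B = A"
    using K(1) by (auto simp: B_def lin B' T_def A'_def)
  moreover have "S \<circ> B = B \<circ> S" if S: "bounded_op S" and "S \<circ> A = A \<circ> S" for S
  proof -
    have "S (A u) = A (S u)" for u using that(2) by (metis comp_apply)
    then have "S \<circ> T = T \<circ> S" by (auto simp: T_def A'_def bounded_op_linear[OF S])
    then have "S (B' u) = B' (S u)" for u using B'(3)[OF S] by (metis comp_apply)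
    then show ?thesis by (auto simp: B_def bounded_op_linear[OF S])
  qed
  ultimately show ?thesis by blast
qed

text \<open>Commuting roots satisfy \<open>(B + C) (B - C) u = 0\<close>. By positivity each of
  \<open>B\<close> and \<open>C\<close> annihilates \<open>w = B u - C u\<close>, and then
  \<open>cinner w w = cinner u (B w - C w)\<close> vanishes.\<close>

lemma sqrt_unique_aux:
  assumes B: "positive_op B" and C: "positive_op C" and eq: "B \<circ> B = C \<circ> C"
    and comm: "B \<circ> C = C \<circ> B"
  shows "B = C"
proof
  fix u
  note linB = bounded_op_linear[OF positive_op_bounded_op[OF B]]
  note linC = bounded_op_linear[OF positive_op_bounded_op[OF C]]
  define w where "w = B u - C u"
  have eq': "B (B u) = C (C u)" for u using eq by (metis comp_apply)
  have comm': "B (C u) = C (B u)" for u using comm by (metis comp_apply)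
  have "B w + C w = 0" by (simp add: w_def linB linC eq' comm')
  then have "cinner w (B w) + cinner w (C w) = 0" by (simp add: cinner_linear[symmetric])
  then have "Re (cinner w (B w)) + Re (cinner w (C w)) = 0"
    by (metis plus_complex.sel(1) zero_complex.sel(1))
  then have "Re (cinner w (B w)) = 0" "Re (cinner w (C w)) = 0"
    using positive_op_Re_ge_0[OF B, of w] positive_op_Re_ge_0[OF C, of w] by auto
  then have "B w = 0" "C w = 0"
    using positive_op_eq_0I[OF B, of w] positive_op_eq_0I[OF C, of w]
      positive_op_cinner_eq_Re[OF B, of w] positive_op_cinner_eq_Re[OF C, of w] by auto
  then have "cinner w w = 0"
    by (subst w_def) (simp add: cinner_linear positive_op_cinner[OF B] positive_op_cinner[OF C])
  then show "B u = C u" by (simp add: w_def)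
qed

text \<open>The constructed root \<open>D\<close> commutes with everything that commutes with
  \<open>B \<circ> B\<close>, in particular with \<open>B\<close> and with \<open>C\<close>, so both
  coincide with \<open>D\<close>.\<close>

lemma sqrt_unique:
  assumes B: "positive_op B" and C: "positive_op C" and eq: "B \<circ> B = C \<circ> C"
  shows "B = C"
proof -
  have "positive_op (B \<circ> B)"
    unfolding positive_op_iff self_adjoint_on_def
    using positive_op_bounded_op[OF B] positive_op_cinner[OF B]
    by (auto intro: bounded_op_comp simp flip: positive_op_cinner[OF B] simp: cinner_self)
  from sqrt_exists[OF this] obtain D where D: "positive_op D" "D \<circ> D = B \<circ> B"
    "\<And>S. bounded_op S \<Longrightarrow> S \<circ> (B \<circ> B) = (B \<circ> B) \<circ> S \<Longrightarrow> S \<circ> D = D \<circ> S" by blast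
  have "B \<circ> D = D \<circ> B" using D(3)[OF positive_op_bounded_op[OF B]] by (simp add: comp_assoc)
  then have "B = D" using sqrt_unique_aux[OF B D(1)] D(2) by simp
  have "C \<circ> D = D \<circ> C" using D(3)[OF positive_op_bounded_op[OF C]] eq by (simp add: comp_assoc)
  then have "C = D" using sqrt_unique_aux[OF C D(1)] D(2) eq by simp
  show ?thesis using \<open>B = D\<close> \<open>C = D\<close> by simp
qed

lemma op_sqrt_eqI: "positive_op B \<Longrightarrow> B \<circ> B = A \<Longrightarrow> op_sqrt A = B"
  unfolding op_sqrt_def by (rule the_equality) (auto intro: sqrt_unique)

lemma
  assumes "positive_op A"
  shows positive_op_sqrt: "positive_op (op_sqrt A)" and op_sqrt_sq: "op_sqrt A \<circ> op_sqrt A = A"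
  using sqrt_exists[OF assms] op_sqrt_eqI by metis+


section \<open>The Hilbert space of Hilbert-Schmidt operators\<close>

interpretation some_onb: orthonormal_basis "some_onb (UNIV :: 'a::chilbert_space set)"
  by unfold_locales (rule onb_some_onb)

lemma hilbert_schmidt_bounded_op: "hilbert_schmidt A \<Longrightarrow> bounded_op A"
  and hilbert_schmidt_summable: "hilbert_schmidt A \<Longrightarrow> (\<lambda>e. (norm (A e))\<^sup>2) summable_on some_onb UNIV"
  by (auto simp: hilbert_schmidt_def)

text \<open>Both sums collect the squared moduli of the matrix entries
  \<open>cinner f (A e)\<close>, by columns and by rows. Two separate bases make this the source of
  basis independence as well.\<close>

lemma has_sum_norm_adj_sq:
  assumes A: "bounded_op A" and E: "onb_on UNIV E" and F: "onb_on UNIV F"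
    and sum: "(\<lambda>e. (norm (A e))\<^sup>2) summable_on E"
  shows "((\<lambda>f. (norm (adj A f))\<^sup>2) has_sum (\<Sum>\<^sub>\<infinity>e\<in>E. (norm (A e))\<^sup>2)) F"
proof -
  interpret E: orthonormal_basis E by unfold_locales (rule E)
  interpret F: orthonormal_basis F by unfold_locales (rule F)
  have s: "(\<lambda>(e, f). (cmod (cinner f (A e)))\<^sup>2) summable_on E \<times> F"
    by (rule F.summable_coeff_sq_prod[OF sum])
  have col: "((\<lambda>e. (cmod (cinner f (A e)))\<^sup>2) has_sum (norm (adj A f))\<^sup>2) E" for f
  proof -
    have "cmod (cinner f (A e)) = cmod (cinner e (adj A f))" for e
      by (metis A cinner_adj cinner_commute complex_mod_cnj)
    then show ?thesis using E.parseval_norm[of "adj A f"] by simp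
  qed
  have "((\<lambda>(e, f). (cmod (cinner f (A e)))\<^sup>2) has_sum (\<Sum>\<^sub>\<infinity>e\<in>E. (norm (A e))\<^sup>2)) (E \<times> F)"
    by (rule has_sum_SigmaI[OF _ has_sum_infsum[OF sum] s]) (simp add: F.parseval_norm)
  then have "((\<lambda>(f, e). (cmod (cinner f (A e)))\<^sup>2) has_sum (\<Sum>\<^sub>\<infinity>e\<in>E. (norm (A e))\<^sup>2)) (F \<times> E)"
    by (subst (asm) has_sum_swap) (simp add: split_def)
  then show ?thesis by (rule has_sum_Sigma') (simp add: col)
qed

text \<open>Passing to the adjoint twice changes the basis from \<open>some_onb UNIV\<close> to
  \<open>F\<close>. Needed because a time reversal moves the chosen basis.\<close>

lemma hilbert_schmidt_onb:
  assumes A: "hilbert_schmidt A" and F: "onb_on UNIV F"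
  shows "(\<lambda>f. (norm (A f))\<^sup>2) summable_on F"
proof -
  have b: "bounded_op A" by (rule hilbert_schmidt_bounded_op[OF A])
  have "(\<lambda>f. (norm (adj A f))\<^sup>2) summable_on F"
    using has_sum_norm_adj_sq[OF b onb_some_onb F hilbert_schmidt_summable[OF A]]
    by (rule has_sum_imp_summable)
  from has_sum_norm_adj_sq[OF bounded_op_adj[OF b] F F this] show ?thesis
    unfolding adj_adj[OF b] by (rule has_sum_imp_summable)
qed

lemma hilbert_schmidt_adj: "hilbert_schmidt A \<Longrightarrow> hilbert_schmidt (adj A)"
  using has_sum_norm_adj_sq[OF _ onb_some_onb onb_some_onb, of A]
  by (auto simp: hilbert_schmidt_def bounded_op_adj summable_on_def)

text \<open>Adjoints swap the arguments of the inner product while \<open>F\<close> is free, so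
  cyclicity of the trace and its independence of the basis are obtained together.\<close>

lemma infsum_cinner_adj:
  assumes A: "hilbert_schmidt A" and B: "hilbert_schmidt B" and F: "onb_on UNIV F"
  shows "(\<Sum>\<^sub>\<infinity>f\<in>F. cinner (adj B f) (adj A f)) = (\<Sum>\<^sub>\<infinity>e\<in>some_onb UNIV. cinner (A e) (B e))"
proof -
  interpret F: orthonormal_basis F by unfold_locales (rule F)
  have "(\<Sum>\<^sub>\<infinity>e\<in>some_onb UNIV. cinner (A e) (B e)) =
      (\<Sum>\<^sub>\<infinity>f\<in>F. \<Sum>\<^sub>\<infinity>e\<in>some_onb UNIV. cinner (A e) f * cinner f (B e))"
    by (rule F.parseval_family) (rule hilbert_schmidt_summable[OF A] hilbert_schmidt_summable[OF B])+
  also have "\<dots> = (\<Sum>\<^sub>\<infinity>f\<in>F. cinner (adj B f) (adj A f))"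
  proof (rule infsum_cong)
    fix f
    have "cinner (A e) f * cinner f (B e) = cinner (adj B f) e * cinner e (adj A f)" for e
      by (simp add: cinner_adj[OF hilbert_schmidt_bounded_op[OF A]]
          cinner_adj'[OF hilbert_schmidt_bounded_op[OF B]] mult.commute)
    then show "(\<Sum>\<^sub>\<infinity>e\<in>some_onb UNIV. cinner (A e) f * cinner f (B e)) = cinner (adj B f) (adj A f)"
      by (simp only: infsumI[OF some_onb.parseval])
  qed
  finally show ?thesis ..
qed

text \<open>Parseval for \<open>A u\<close>, whose coefficients \<open>cinner (adj A f) u\<close>
  obey Cauchy-Schwarz. It yields definiteness of the inner product on \<open>hs\<close> and
  continuity of evaluation at \<open>u\<close>.\<close>

lemma hilbert_schmidt_norm_le:
  assumes A: "hilbert_schmidt A"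
  shows "(norm (A u))\<^sup>2 \<le> (\<Sum>\<^sub>\<infinity>e\<in>some_onb UNIV. (norm (A e))\<^sup>2) * (norm u)\<^sup>2"
proof -
  have b: "bounded_op A" by (rule hilbert_schmidt_bounded_op[OF A])
  have "((\<lambda>f. (norm (adj A f))\<^sup>2 * (norm u)\<^sup>2) has_sum
      (\<Sum>\<^sub>\<infinity>e\<in>some_onb UNIV. (norm (A e))\<^sup>2) * (norm u)\<^sup>2) (some_onb UNIV)"
    by (rule has_sum_cmult_left[OF has_sum_norm_adj_sq[OF b onb_some_onb onb_some_onb
            hilbert_schmidt_summable[OF A]]])
  moreover have "(cmod (cinner f (A u)))\<^sup>2 \<le> (norm (adj A f))\<^sup>2 * (norm u)\<^sup>2" for f
    using power_mono[OF cmod_cinner_le[of "adj A f" u] norm_ge_zero, of 2]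
    by (simp add: cinner_adj'[OF b] power_mult_distrib)
  ultimately show ?thesis by (rule has_sum_mono[OF some_onb.parseval_norm])
qed

lemma hilbert_schmidt_add:
  assumes "hilbert_schmidt A" "hilbert_schmidt B"
  shows "hilbert_schmidt (\<lambda>u. A u + B u)"
  unfolding hilbert_schmidt_def
proof
  show "bounded_op (\<lambda>u. A u + B u)"
    using assms by (intro bounded_op_plus hilbert_schmidt_bounded_op)
  show "(\<lambda>e. (norm (A e + B e))\<^sup>2) summable_on some_onb UNIV"
  proof (rule summable_on_comparison_test)
    show "(\<lambda>e. 2 * (norm (A e))\<^sup>2 + 2 * (norm (B e))\<^sup>2) summable_on some_onb UNIV"
      using assms by (intro summable_on_add summable_on_cmult_right hilbert_schmidt_summable)
    show "(norm (A e + B e))\<^sup>2 \<le> 2 * (norm (A e))\<^sup>2 + 2 * (norm (B e))\<^sup>2" for e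
      using zero_le_power2[of "norm (A e - B e)"] unfolding norm_add_sq norm_diff_sq by linarith
  qed simp
qed

lemma hilbert_schmidt_comp_left:
  assumes "bounded_op x" "hilbert_schmidt A"
  shows "hilbert_schmidt (x \<circ> A)"
  unfolding hilbert_schmidt_def
proof
  show "bounded_op (x \<circ> A)"
    by (rule bounded_op_comp[OF assms(1) hilbert_schmidt_bounded_op[OF assms(2)]])
  show "(\<lambda>e. (norm ((x \<circ> A) e))\<^sup>2) summable_on some_onb UNIV"
    using summable_norm_sq_bounded_op[OF assms(1) hilbert_schmidt_summable[OF assms(2)]] by simp
qed

text \<open>Adjoints turn right multiplication into left multiplication.\<close>

lemma hilbert_schmidt_comp_right:
  assumes "hilbert_schmidt A" "bounded_op x"
  shows "hilbert_schmidt (A \<circ> x)"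
proof -
  have b: "bounded_op A" by (rule hilbert_schmidt_bounded_op[OF assms(1)])
  have "hilbert_schmidt (adj (adj x \<circ> adj A))"
    using assms by (intro hilbert_schmidt_adj hilbert_schmidt_comp_left bounded_op_adj)
  moreover have "adj (adj x \<circ> adj A) = A \<circ> x"
    using assms b by (simp add: adj_comp bounded_op_adj adj_adj)
  ultimately show ?thesis by simp
qed

lemma hilbert_schmidt_zero: "hilbert_schmidt (\<lambda>u. 0)"
  by (simp add: hilbert_schmidt_def bounded_op_zero_op)

lemma hilbert_schmidt_scaleC: "hilbert_schmidt A \<Longrightarrow> hilbert_schmidt (\<lambda>u. c *\<^sub>C A u)"
  using hilbert_schmidt_comp_left[OF bounded_op_scale[OF bounded_op_id]] by (simp add: o_def)

lemma hilbert_schmidt_scaleR: "hilbert_schmidt A \<Longrightarrow> hilbert_schmidt (\<lambda>u. r *\<^sub>R A u)"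
  unfolding scaleR_scaleC by (rule hilbert_schmidt_scaleC)

lemma hilbert_schmidt_minus: "hilbert_schmidt A \<Longrightarrow> hilbert_schmidt (\<lambda>u. - A u)"
  using hilbert_schmidt_scaleC[of A "-1"] by simp

lemma hilbert_schmidt_diff:
  "hilbert_schmidt A \<Longrightarrow> hilbert_schmidt B \<Longrightarrow> hilbert_schmidt (\<lambda>u. A u - B u)"
  using hilbert_schmidt_add[of A "\<lambda>u. - B u"] hilbert_schmidt_minus[of B] by simp

text \<open>A type rather than a predicate, so that bases, closures, sums and square summable
  families become available for operators regarded as vectors.\<close>

typedef (overloaded) 'a hs = "{A :: 'a::chilbert_space \<Rightarrow> 'a. hilbert_schmidt A}"
  morphisms hs_op Abs_hs
  by (rule exI[of _ "\<lambda>_. 0"]) (simp add: hilbert_schmidt_zero)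

setup_lifting type_definition_hs

lemma hilbert_schmidt_hs_op [simp, intro]: "hilbert_schmidt (hs_op A)"
  using hs_op[of A] by simp

lemma hs_op_Abs_hs: "hilbert_schmidt A \<Longrightarrow> hs_op (Abs_hs A) = A"
  by (rule Abs_hs_inverse) simp

lemma bounded_op_hs_op [simp, intro]: "bounded_op (hs_op A)"
  by (rule hilbert_schmidt_bounded_op) simp

instantiation hs :: (chilbert_space) real_inner
begin

lift_definition zero_hs :: "'a hs" is "\<lambda>_. 0" by (rule hilbert_schmidt_zero)
lift_definition plus_hs :: "'a hs \<Rightarrow> 'a hs \<Rightarrow> 'a hs" is "\<lambda>A B u. A u + B u"
  by (rule hilbert_schmidt_add)
lift_definition uminus_hs :: "'a hs \<Rightarrow> 'a hs" is "\<lambda>A u. - A u" by (rule hilbert_schmidt_minus)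
lift_definition minus_hs :: "'a hs \<Rightarrow> 'a hs \<Rightarrow> 'a hs" is "\<lambda>A B u. A u - B u"
  by (rule hilbert_schmidt_diff)
lift_definition scaleR_hs :: "real \<Rightarrow> 'a hs \<Rightarrow> 'a hs" is "\<lambda>r A u. r *\<^sub>R A u"
  by (rule hilbert_schmidt_scaleR)

definition inner_hs :: "'a hs \<Rightarrow> 'a hs \<Rightarrow> real" where
  "inner_hs A B = Re (\<Sum>\<^sub>\<infinity>e\<in>some_onb UNIV. cinner (hs_op A e) (hs_op B e))"
definition norm_hs :: "'a hs \<Rightarrow> real" where
  "norm_hs f = sqrt (inner f f)"
definition sgn_hs :: "'a hs \<Rightarrow> 'a hs" where
  "sgn_hs f = inverse (norm f) *\<^sub>R f"
definition dist_hs :: "'a hs \<Rightarrow> 'a hs \<Rightarrow> real" where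
  "dist_hs f g = norm (f - g)"
definition uniformity_hs :: "('a hs \<times> 'a hs) filter" where
  "uniformity_hs = (INF e\<in>{0<..}. principal {(x, y). dist x y < e})"
definition open_hs :: "'a hs set \<Rightarrow> bool" where
  "open_hs U \<longleftrightarrow> (\<forall>x\<in>U. \<forall>\<^sub>F (x', y) in uniformity. x' = x \<longrightarrow> y \<in> U)"

lemma hs_op_cinner_summable: "(\<lambda>e. cinner (hs_op A e) (hs_op B e)) summable_on some_onb UNIV"
  by (intro cinner_summable_on hilbert_schmidt_summable) auto

lemma hs_inner_self: "inner A A = (\<Sum>\<^sub>\<infinity>e\<in>some_onb UNIV. (norm (hs_op A e))\<^sup>2)" for A :: "'a hs"
proof -
  have "((\<lambda>e. complex_of_real ((norm (hs_op A e))\<^sup>2)) has_sum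
      complex_of_real (\<Sum>\<^sub>\<infinity>e\<in>some_onb UNIV. (norm (hs_op A e))\<^sup>2)) (some_onb UNIV)"
    by (intro has_sum_of_real has_sum_infsum hilbert_schmidt_summable) auto
  from infsumI[OF this] show ?thesis
    unfolding inner_hs_def cinner_self by simp
qed

instance
proof
  fix x y z :: "'a hs" and a b r :: real
  show "x + y + z = x + (y + z)" by transfer (simp add: add.assoc)
  show "x + y = y + x" by transfer (simp add: add.commute)
  show "0 + x = x" by transfer simp
  show "- x + x = 0" by transfer simp
  show "x - y = x + - y" by transfer simp
  show "a *\<^sub>R (x + y) = a *\<^sub>R x + a *\<^sub>R y" by transfer (simp add: scaleR_add_right)
  show "(a + b) *\<^sub>R x = a *\<^sub>R x + b *\<^sub>R x" by transfer (simp add: scaleR_add_left)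
  show "a *\<^sub>R b *\<^sub>R x = (a * b) *\<^sub>R x" by transfer simp
  show "1 *\<^sub>R x = x" by transfer simp
  show "dist x y = norm (x - y)" by (rule dist_hs_def)
  show "sgn x = inverse (norm x) *\<^sub>R x" by (rule sgn_hs_def)
  show "uniformity = (INF e\<in>{0<..}. principal {(x, y). dist (x :: 'a hs) y < e})"
    by (rule uniformity_hs_def)
  show "open U \<longleftrightarrow> (\<forall>x\<in>U. \<forall>\<^sub>F (x', y) in uniformity. x' = x \<longrightarrow> y \<in> U)" for U :: "'a hs set"
    by (rule open_hs_def)
  show "inner x y = inner y x"
  proof -
    have "(\<Sum>\<^sub>\<infinity>e\<in>some_onb UNIV. cinner (hs_op x e) (hs_op y e)) =
        (\<Sum>\<^sub>\<infinity>e\<in>some_onb UNIV. cnj (cinner (hs_op y e) (hs_op x e)))"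
      by (intro infsum_cong cinner_commute)
    then show ?thesis by (simp add: inner_hs_def)
  qed
  show "inner (x + y) z = inner x z + inner y z"
    unfolding inner_hs_def plus_hs.rep_eq cinner_linear
    by (simp add: infsum_add[OF hs_op_cinner_summable hs_op_cinner_summable])
  show "inner (r *\<^sub>R x) y = r * inner x y"
    unfolding inner_hs_def scaleR_hs.rep_eq cinner_linear
    by (simp add: infsum_cmult_right[OF hs_op_cinner_summable])
  show "0 \<le> inner x x"
    unfolding hs_inner_self by (intro infsum_nonneg) simp
  show "inner x x = 0 \<longleftrightarrow> x = 0"
  proof
    assume "inner x x = 0"
    then have "(norm (hs_op x u))\<^sup>2 \<le> 0" for u
      using hilbert_schmidt_norm_le[of "hs_op x" u] by (simp add: hs_inner_self)
    then have "hs_op x = hs_op 0" by (auto simp: zero_hs.rep_eq)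
    then show "x = 0" by (simp only: hs_op_inject)
  qed (simp add: hs_inner_self zero_hs.rep_eq)
  show "norm x = sqrt (inner x x)" by (rule norm_hs_def)
qed

end

lemma norm_hs_sq: "(norm A)\<^sup>2 = (\<Sum>\<^sub>\<infinity>e\<in>some_onb UNIV. (norm (hs_op A e))\<^sup>2)"
  by (metis hs_inner_self power2_norm_eq_inner)

lemma norm_hs_op_le: "norm (hs_op A u) \<le> norm A * norm u"
proof (rule power2_le_imp_le)
  show "(norm (hs_op A u))\<^sup>2 \<le> (norm A * norm u)\<^sup>2"
    using hilbert_schmidt_norm_le[of "hs_op A" u] by (simp add: power_mult_distrib norm_hs_sq)
qed simp

lemma bounded_linear_hs_op: "bounded_linear (\<lambda>A. hs_op A u)"
  by (rule bounded_linear_intro[of _ "norm u"])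
    (auto simp: plus_hs.rep_eq scaleR_hs.rep_eq norm_hs_op_le)

lemma hs_norm_hs_op: "hs_norm (hs_op A) = norm A"
  by (simp add: hs_norm_def norm_hs_sq[symmetric])

instance hs :: (chilbert_space) complete_space
proof
  fix X :: "nat \<Rightarrow> 'a hs"
  assume X: "Cauchy X"
  obtain B where B: "\<And>n. norm (X n) \<le> B"
    using Cauchy_Bseq[OF X] unfolding Bseq_def by blast
  have "Cauchy (\<lambda>m. hs_op (X m) u)" for u
    by (rule bounded_linear.Cauchy[OF bounded_linear_hs_op X])
  then obtain Y where Y: "\<And>u. (\<lambda>m. hs_op (X m) u) \<longlonglongrightarrow> Y u"
    unfolding Cauchy_convergent_iff convergent_def by metis
  have "norm (hs_op (X n) u) \<le> B * norm u" for n u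
    using norm_hs_op_le[of "X n" u] mult_right_mono[OF B norm_ge_zero[of u]] order_trans by blast
  then have bY: "bounded_op Y" by (rule bounded_op_pointwise_limit[OF bounded_op_hs_op Y])
  \<comment> \<open>Pointwise limits are taken in finite partial sums only; a bound uniform in
    \<open>F\<close> then controls the Hilbert-Schmidt norm.\<close>
  have part: "(\<Sum>e\<in>F. (norm (hs_op (X m) e - Y e))\<^sup>2) \<le> d\<^sup>2"
    if F: "finite F" "F \<subseteq> some_onb UNIV" and d: "\<And>n. n \<ge> m \<Longrightarrow> norm (X m - X n) \<le> d" for F m d
  proof (rule LIMSEQ_le_const2)
    show "(\<lambda>n. \<Sum>e\<in>F. (norm (hs_op (X m) e - hs_op (X n) e))\<^sup>2)
        \<longlonglongrightarrow> (\<Sum>e\<in>F. (norm (hs_op (X m) e - Y e))\<^sup>2)"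
      by (intro tendsto_intros Y)
    have "(\<Sum>e\<in>F. (norm (hs_op (X m) e - hs_op (X n) e))\<^sup>2) \<le> d\<^sup>2" if "n \<ge> m" for n
    proof -
      have "(\<Sum>e\<in>F. (norm (hs_op (X m - X n) e))\<^sup>2) \<le> (norm (X m - X n))\<^sup>2"
        unfolding norm_hs_sq
        by (rule finite_sum_le_infsum) (use F hilbert_schmidt_summable in auto)
      also have "\<dots> \<le> d\<^sup>2" using d[OF that] by (intro power_mono) auto
      finally show ?thesis by (simp add: minus_hs.rep_eq)
    qed
    then show "\<exists>N. \<forall>n\<ge>N. (\<Sum>e\<in>F. (norm (hs_op (X m) e - hs_op (X n) e))\<^sup>2) \<le> d\<^sup>2"
      by blast
  qed
  have diff: "hilbert_schmidt (\<lambda>u. hs_op (X m) u - Y u)"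
    if "\<And>n. n \<ge> m \<Longrightarrow> norm (X m - X n) \<le> d" for m d
    unfolding hilbert_schmidt_def
  proof
    show "bounded_op (\<lambda>u. hs_op (X m) u - Y u)" by (intro bounded_op_sub bY bounded_op_hs_op)
    show "(\<lambda>e. (norm (hs_op (X m) e - Y e))\<^sup>2) summable_on some_onb UNIV"
      by (rule nonneg_bdd_above_summable_on)
        (auto intro!: bdd_aboveI2[of _ _ "d\<^sup>2"] part that)
  qed
  have ev: "\<exists>M. \<forall>m\<ge>M. \<forall>n\<ge>m. norm (X m - X n) \<le> d" if "d > 0" for d
  proof -
    obtain M where "\<And>m n. m \<ge> M \<Longrightarrow> n \<ge> M \<Longrightarrow> dist (X m) (X n) < d"
      using X \<open>d > 0\<close> unfolding Cauchy_def by blast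
    then show ?thesis
      by (intro exI[of _ M]) (metis dist_norm less_imp_le order_trans)
  qed
  \<comment> \<open>\<open>Y\<close> is recovered as \<open>X M0\<close> minus the Hilbert-Schmidt
    operator \<open>X M0 - Y\<close>.\<close>
  obtain M0 where "\<forall>n\<ge>M0. norm (X M0 - X n) \<le> 1" using ev[of 1] by auto
  then have "hilbert_schmidt (\<lambda>u. hs_op (X M0) u - Y u)" by (intro diff[of _ 1]) auto
  from hilbert_schmidt_diff[OF hilbert_schmidt_hs_op[of "X M0"] this] have "hilbert_schmidt Y" by simp
  then have YY: "hs_op (Abs_hs Y) = Y" by (rule hs_op_Abs_hs)
  have "X \<longlonglongrightarrow> Abs_hs Y"
  proof (rule metric_LIMSEQ_I)
    fix r :: real assume "r > 0"
    then obtain M where M: "\<And>m n. m \<ge> M \<Longrightarrow> n \<ge> m \<Longrightarrow> norm (X m - X n) \<le> r / 2"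
      using ev[of "r / 2"] by auto
    have "dist (X m) (Abs_hs Y) < r" if "m \<ge> M" for m
    proof -
      have "(norm (X m - Abs_hs Y))\<^sup>2 = (\<Sum>\<^sub>\<infinity>e\<in>some_onb UNIV. (norm (hs_op (X m) e - Y e))\<^sup>2)"
        by (simp add: norm_hs_sq minus_hs.rep_eq YY)
      also have "\<dots> \<le> (r / 2)\<^sup>2"
        using M[OF that] diff[of m "r / 2"]
        by (intro infsum_le_finite_sums part hilbert_schmidt_summable) auto
      finally have "norm (X m - Abs_hs Y) \<le> r / 2"
        by (rule power2_le_imp_le) (use \<open>r > 0\<close> in simp)
      then show ?thesis using \<open>r > 0\<close> by (simp add: dist_norm)
    qed
    then show "\<exists>M. \<forall>m\<ge>M. dist (X m) (Abs_hs Y) < r" by blast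
  qed
  then show "convergent X" by (rule convergentI)
qed

instantiation hs :: (chilbert_space) chilbert_space
begin

lift_definition scaleC_hs :: "complex \<Rightarrow> 'a hs \<Rightarrow> 'a hs" is "\<lambda>c A u. c *\<^sub>C A u"
  by (rule hilbert_schmidt_scaleC)

definition cinner_hs :: "'a hs \<Rightarrow> 'a hs \<Rightarrow> complex" where
  "cinner_hs A B = (\<Sum>\<^sub>\<infinity>e\<in>some_onb UNIV. cinner (hs_op A e) (hs_op B e))"

instance
proof
  fix x y z :: "'a hs" and c d :: complex and r :: real
  show "c *\<^sub>C (x + y) = c *\<^sub>C x + c *\<^sub>C y" by transfer (simp add: scaleC_add_right)
  show "(c + d) *\<^sub>C x = c *\<^sub>C x + d *\<^sub>C x" by transfer (simp add: scaleC_add_left)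
  show "c *\<^sub>C d *\<^sub>C x = (c * d) *\<^sub>C x" by transfer (simp add: scaleC_scaleC)
  show "complex_of_real r *\<^sub>C x = r *\<^sub>R x" by transfer (simp add: scaleC_of_real)
  show "cinner x y = cnj (cinner y x)"
  proof -
    have "(\<Sum>\<^sub>\<infinity>e\<in>some_onb UNIV. cinner (hs_op x e) (hs_op y e)) =
        (\<Sum>\<^sub>\<infinity>e\<in>some_onb UNIV. cnj (cinner (hs_op y e) (hs_op x e)))"
      by (intro infsum_cong cinner_commute)
    then show ?thesis by (simp add: cinner_hs_def)
  qed
  show "cinner x (y + z) = cinner x y + cinner x z"
    unfolding cinner_hs_def plus_hs.rep_eq cinner_linear
    by (simp add: infsum_add[OF hs_op_cinner_summable hs_op_cinner_summable])
  show "cinner x (c *\<^sub>C y) = c * cinner x y"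
    unfolding cinner_hs_def scaleC_hs.rep_eq cinner_linear
    by (simp add: infsum_cmult_right[OF hs_op_cinner_summable])
  show "inner x y = Re (cinner x y)"
    by (simp add: inner_hs_def cinner_hs_def)
qed

end


lemma hs_eqI: "(\<And>u. hs_op A u = hs_op B u) \<Longrightarrow> A = B"
  using hs_op_inject by blast

section \<open>Traces, adjoints and multiplications on the Hilbert-Schmidt space\<close>

lemma cinner_Abs_hs:
  "hilbert_schmidt A \<Longrightarrow> hilbert_schmidt B \<Longrightarrow>
    cinner (Abs_hs A) (Abs_hs B) = (\<Sum>\<^sub>\<infinity>e\<in>some_onb UNIV. cinner (A e) (B e))"
  by (simp add: cinner_hs_def hs_op_Abs_hs)

text \<open>\<open>op_trace\<close> is a bare sum over the chosen basis. A factorisation into two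
  Hilbert-Schmidt operators identifies it with an inner product, for which rearrangements are
  justified.\<close>

lemma op_trace_eq_cinner:
  assumes "hilbert_schmidt A" "hilbert_schmidt B"
  shows "op_trace (A \<circ> B) = cinner (Abs_hs (adj A)) (Abs_hs B)"
  using assms
  by (simp add: op_trace_def cinner_Abs_hs hilbert_schmidt_adj cinner_adj' hilbert_schmidt_bounded_op)

definition hs_adj :: "'a::chilbert_space hs \<Rightarrow> 'a hs" where
  "hs_adj A = Abs_hs (adj (hs_op A))"

lemma hs_op_hs_adj: "hs_op (hs_adj A) = adj (hs_op A)"
  by (simp add: hs_adj_def hs_op_Abs_hs hilbert_schmidt_adj)

lemma cinner_hs_adj: "cinner (hs_adj A) (hs_adj B) = cinner B A"
  unfolding cinner_hs_def hs_op_hs_adj by (rule infsum_cinner_adj[OF _ _ onb_some_onb]) auto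

text \<open>Meaningful for bounded \<open>x\<close>; otherwise \<open>x \<circ> hs_op A\<close> may
  fail to be Hilbert-Schmidt and \<open>Abs_hs\<close> is unspecified.\<close>

definition hs_lmul :: "('a::chilbert_space \<Rightarrow> 'a) \<Rightarrow> 'a hs \<Rightarrow> 'a hs" where
  "hs_lmul x A = Abs_hs (x \<circ> hs_op A)"

definition hs_rmul :: "('a::chilbert_space \<Rightarrow> 'a) \<Rightarrow> 'a hs \<Rightarrow> 'a hs" where
  "hs_rmul x A = Abs_hs (hs_op A \<circ> x)"

lemma hs_op_hs_lmul: "bounded_op x \<Longrightarrow> hs_op (hs_lmul x A) = x \<circ> hs_op A"
  by (simp add: hs_lmul_def hs_op_Abs_hs hilbert_schmidt_comp_left)

lemma hs_op_hs_rmul: "bounded_op x \<Longrightarrow> hs_op (hs_rmul x A) = hs_op A \<circ> x"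
  by (simp add: hs_rmul_def hs_op_Abs_hs hilbert_schmidt_comp_right)

lemma cinner_hs_lmul: "bounded_op x \<Longrightarrow> cinner (hs_lmul x A) B = cinner A (hs_lmul (adj x) B)"
  by (simp add: cinner_hs_def hs_op_hs_lmul bounded_op_adj cinner_adj)

lemma hs_adj_hs_rmul: "bounded_op x \<Longrightarrow> hs_adj (hs_rmul x A) = hs_lmul (adj x) (hs_adj A)"
  by (rule hs_eqI) (simp add: hs_op_hs_adj hs_op_hs_rmul hs_op_hs_lmul adj_comp bounded_op_adj)

text \<open>Right multiplication is left multiplication conjugated by the antilinear isometry
  \<open>hs_adj\<close>. Cyclicity of the trace enters through \<open>cinner_hs_adj\<close>.\<close>

lemma cinner_hs_rmul:
  assumes "bounded_op x"
  shows "cinner (hs_rmul x A) B = cinner A (hs_rmul (adj x) B)"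
proof -
  have "cinner (hs_rmul x A) B = cinner (hs_adj B) (hs_lmul (adj x) (hs_adj A))"
    by (simp add: cinner_hs_adj[symmetric, of "hs_rmul x A"] hs_adj_hs_rmul assms)
  also have "\<dots> = cinner (hs_lmul x (hs_adj B)) (hs_adj A)"
    by (simp add: cinner_hs_lmul assms)
  also have "hs_lmul x (hs_adj B) = hs_adj (hs_rmul (adj x) B)"
    by (simp add: hs_adj_hs_rmul bounded_op_adj adj_adj assms)
  also have "cinner \<dots> (hs_adj A) = cinner A (hs_rmul (adj x) B)"
    by (rule cinner_hs_adj)
  finally show ?thesis .
qed

lemma hs_lmul_hs_rmul:
  "bounded_op x \<Longrightarrow> bounded_op y \<Longrightarrow> hs_lmul x (hs_rmul y A) = hs_rmul y (hs_lmul x A)"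
  by (rule hs_eqI) (simp add: hs_op_hs_rmul hs_op_hs_lmul)

lemma norm_hs_adj: "norm (hs_adj A) = norm A"
  using cinner_hs_adj[of A A] unfolding cinner_self of_real_eq_iff by simp

lemma bounded_op_hs_lmul:
  assumes x: "bounded_op x"
  shows "bounded_op (hs_lmul x)"
proof -
  obtain K where K: "K > 0" "\<And>u. norm (x u) \<le> K * norm u" using bounded_op_pos_bound[OF x] by metis
  have "norm (hs_lmul x A) \<le> K * norm A" for A
  proof (rule power2_le_imp_le)
    have "(norm (hs_lmul x A))\<^sup>2 \<le> (\<Sum>\<^sub>\<infinity>e\<in>some_onb UNIV. K\<^sup>2 * (norm (hs_op A e))\<^sup>2)"
      unfolding norm_hs_sq
    proof (rule infsum_mono)
      show "(norm (hs_op (hs_lmul x A) e))\<^sup>2 \<le> K\<^sup>2 * (norm (hs_op A e))\<^sup>2" for e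
        using power_mono[OF K(2) norm_ge_zero, of "hs_op A e" 2]
        by (simp add: hs_op_hs_lmul x power_mult_distrib)
    qed (simp_all add: hilbert_schmidt_summable summable_on_cmult_right)
    then show "(norm (hs_lmul x A))\<^sup>2 \<le> (K * norm A)\<^sup>2"
      by (simp add: infsum_cmult_right' norm_hs_sq power_mult_distrib)
  qed (use K in simp)
  then show ?thesis
    by (intro bounded_opI[of _ K])
      (auto intro!: hs_eqI simp: hs_op_hs_lmul x plus_hs.rep_eq scaleC_hs.rep_eq bounded_op_linear[OF x])
qed

lemma bounded_op_hs_rmul:
  assumes x: "bounded_op x"
  shows "bounded_op (hs_rmul x)"
proof -
  obtain K where K: "\<And>A. norm (hs_lmul (adj x) A) \<le> K * norm A"
    using bounded_op_pos_bound[OF bounded_op_hs_lmul[OF bounded_op_adj[OF x]]] by metis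
  have "norm (hs_rmul x A) \<le> K * norm A" for A
    using K[of "hs_adj A"] by (metis norm_hs_adj hs_adj_hs_rmul x)
  then show ?thesis
    by (intro bounded_opI[of _ K])
      (auto intro!: hs_eqI simp: hs_op_hs_rmul x plus_hs.rep_eq scaleC_hs.rep_eq)
qed

section \<open>Rank one operators, written |g><f| in Dirac notation\<close>

definition hs_rank1 :: "'a::chilbert_space \<Rightarrow> 'a \<Rightarrow> 'a hs" where
  "hs_rank1 g f = Abs_hs (\<lambda>u. cinner f u *\<^sub>C g)"

lemma hilbert_schmidt_rank1: "hilbert_schmidt (\<lambda>u. cinner f u *\<^sub>C (g::'a::chilbert_space))"
  unfolding hilbert_schmidt_def
proof
  have "cmod (cinner f e) = cmod (cinner e f)" for e by (metis cinner_commute complex_mod_cnj)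
  then show "(\<lambda>e. (norm (cinner f e *\<^sub>C g))\<^sup>2) summable_on some_onb UNIV"
    using summable_on_cmult_left[OF some_onb.summable_coeff_sq[of f], of "(norm g)\<^sup>2"]
    by (simp add: norm_scaleC power_mult_distrib)
qed (rule bounded_op_rank_one)

lemma hs_op_hs_rank1: "hs_op (hs_rank1 g f) = (\<lambda>u. cinner f u *\<^sub>C g)"
  by (simp add: hs_rank1_def hs_op_Abs_hs hilbert_schmidt_rank1)

lemma cinner_hs_rank1: "cinner (hs_rank1 g f) A = cinner g (hs_op A f)"
proof -
  have "cinner (cinner f e *\<^sub>C g) (hs_op A e) = cinner (adj (hs_op A) g) e * cinner e f" for e
    using cinner_commute[of e f] by (simp add: cinner_linear cinner_adj' mult.commute)
  then have "cinner (hs_rank1 g f) A = cinner (adj (hs_op A) g) f"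
    unfolding cinner_hs_def hs_op_hs_rank1 by (simp only: infsumI[OF some_onb.parseval])
  then show ?thesis by (simp add: cinner_adj')
qed

lemma cinner_hs_rank1': "cinner A (hs_rank1 g f) = cinner (hs_op A f) g"
  by (metis cinner_commute cinner_hs_rank1)

lemma hs_rmul_rank1: "hs_rmul (\<lambda>u. cinner e u *\<^sub>C f) A = hs_rank1 (hs_op A f) e"
  by (rule hs_eqI) (simp add: hs_op_hs_rmul bounded_op_rank_one hs_op_hs_rank1 bounded_op_scaleC)

lemma hs_lmul_rank1: "hs_lmul (\<lambda>u. cinner h u *\<^sub>C g) A = hs_rank1 g (adj (hs_op A) h)"
  by (rule hs_eqI) (simp add: hs_op_hs_lmul bounded_op_rank_one hs_op_hs_rank1 cinner_adj')

lemma norm_sq_orthogonal_sum: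
  fixes a :: "'i \<Rightarrow> 'a::chilbert_space"
  assumes "finite F" "\<And>i j. i \<in> F \<Longrightarrow> j \<in> F \<Longrightarrow> i \<noteq> j \<Longrightarrow> cinner (a i) (a j) = 0"
  shows "(norm (\<Sum>i\<in>F. a i))\<^sup>2 = (\<Sum>i\<in>F. (norm (a i))\<^sup>2)"
  using assms
proof (induction F rule: finite_induct)
  case (insert i F)
  then have "cinner (a i) (\<Sum>i\<in>F. a i) = 0"
    unfolding cinner_sum_right by (intro sum.neutral) auto
  then show ?case using insert by (simp add: norm_add_sq)
qed simp

text \<open>The summands are mutually orthogonal with norms \<open>norm (hs_op A e)\<close>, so the
  series converges in Hilbert-Schmidt norm; its sum agrees with \<open>A\<close> on the
  basis.\<close>

lemma hs_rank1_expansion: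
  "((\<lambda>e. hs_rank1 (hs_op A e) e) has_sum A) (some_onb UNIV)"
proof -
  have orth: "cinner (hs_rank1 (hs_op A e) e) (hs_rank1 (hs_op A f) f) =
      (if e = f then of_real ((norm (hs_op A e))\<^sup>2) else 0)"
    if "e \<in> some_onb UNIV" "f \<in> some_onb UNIV" for e f
    using some_onb.orthonormal[OF that(2,1)]
    by (auto simp: cinner_hs_rank1 hs_op_hs_rank1 cinner_linear cinner_self)
  then have n: "(norm (hs_rank1 (hs_op A e) e))\<^sup>2 = (norm (hs_op A e))\<^sup>2" if "e \<in> some_onb UNIV" for e
    using that orth[OF that that] unfolding cinner_self by (simp only: if_True refl of_real_eq_iff)
  have "(\<lambda>e. hs_rank1 (hs_op A e) e) summable_on some_onb UNIV"
  proof (rule summable_on_sq_majorant[where K = 1])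
    show "(\<lambda>e. (norm (hs_op A e))\<^sup>2) summable_on some_onb UNIV"
      by (rule hilbert_schmidt_summable) simp
    show "(norm (\<Sum>e\<in>F. hs_rank1 (hs_op A e) e))\<^sup>2 \<le> 1 * (\<Sum>e\<in>F. (norm (hs_op A e))\<^sup>2)"
      if F: "finite F" "F \<subseteq> some_onb UNIV" for F
    proof -
      have "(norm (\<Sum>e\<in>F. hs_rank1 (hs_op A e) e))\<^sup>2 = (\<Sum>e\<in>F. (norm (hs_rank1 (hs_op A e) e))\<^sup>2)"
        by (rule norm_sq_orthogonal_sum[OF F(1)]) (use F orth in \<open>simp add: subset_iff\<close>)
      also have "\<dots> = (\<Sum>e\<in>F. (norm (hs_op A e))\<^sup>2)"
        using F n by (intro sum.cong) auto
      finally show ?thesis by simp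
    qed
  qed auto
  then obtain S where S: "((\<lambda>e. hs_rank1 (hs_op A e) e) has_sum S) (some_onb UNIV)"
    unfolding summable_on_def by blast
  have "hs_op S f = hs_op A f" if f: "f \<in> some_onb UNIV" for f
  proof -
    have "((\<lambda>e. hs_op (hs_rank1 (hs_op A e) e) f) has_sum hs_op S f) (some_onb UNIV)"
      by (rule has_sum_bounded_linear[OF bounded_linear_hs_op S])
    moreover have "((\<lambda>e. hs_op (hs_rank1 (hs_op A e) e) f) has_sum hs_op A f) (some_onb UNIV)"
      by (rule has_sum_finite_neutralI[of "{f}"])
        (auto simp: f hs_op_hs_rank1 some_onb.orthonormal)
    ultimately show ?thesis by (rule has_sum_unique)
  qed
  then have "hs_op S = hs_op A" by (intro some_onb.op_eqI) auto
  then show ?thesis using S by (simp add: hs_op_inject)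
qed

text \<open>Rank one operators are total in \<open>hs\<close>. Since \<open>bounded_linear\<close>
  refers to real scalars, the antilinear slot of \<open>cinner\<close> is covered too.\<close>

lemma bounded_linear_eq_on_rank1:
  fixes \<phi> \<psi> :: "'a::chilbert_space hs \<Rightarrow> 'b::real_normed_vector"
  assumes "bounded_linear \<phi>" "bounded_linear \<psi>" "\<And>g f. \<phi> (hs_rank1 g f) = \<psi> (hs_rank1 g f)"
  shows "\<phi> A = \<psi> A"
  using has_sum_bounded_linear[OF assms(1) hs_rank1_expansion[of A]]
    has_sum_bounded_linear[OF assms(2) hs_rank1_expansion[of A]]
  unfolding assms(3) by (rule has_sum_unique)


section \<open>Time reversals\<close>

locale time_reversal_op =
  fixes \<theta> :: "'a::chilbert_space \<Rightarrow> 'a"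
  assumes time_reversal: "time_reversal \<theta>"
begin

lemma add: "\<theta> (u + v) = \<theta> u + \<theta> v"
  and scaleC: "\<theta> (c *\<^sub>C u) = cnj c *\<^sub>C \<theta> u"
  and cinner_rev: "cinner (\<theta> u) (\<theta> v) = cinner v u"
  and involution [simp]: "\<theta> (\<theta> u) = u"
  and cinner_right: "cinner u (\<theta> v) = cinner v (\<theta> u)"
  using time_reversal unfolding time_reversal_def
  by (simp_all add: fun_eq_iff)

lemma cinner_left: "cinner (\<theta> u) v = cinner (\<theta> v) u"
  by (metis cinner_commute cinner_right)

lemma norm_theta: "norm (\<theta> u) = norm u"
proof -
  have "complex_of_real ((norm (\<theta> u))\<^sup>2) = complex_of_real ((norm u)\<^sup>2)"
    unfolding cinner_self[symmetric] by (rule cinner_rev)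
  then show ?thesis unfolding of_real_eq_iff by simp
qed

lemma bounded_op_conj:
  assumes A: "bounded_op A"
  shows "bounded_op (\<theta> \<circ> A \<circ> \<theta>)"
proof -
  obtain K where K: "K > 0" "\<And>u. norm (A u) \<le> K * norm u" using bounded_op_pos_bound[OF A] by metis
  show ?thesis
  proof (rule bounded_opI)
    show "norm ((\<theta> \<circ> A \<circ> \<theta>) u) \<le> K * norm u" for u
      using K(2)[of "\<theta> u"] by (simp add: norm_theta)
  qed (auto simp: add scaleC bounded_op_add[OF A] bounded_op_scaleC[OF A])
qed

lemma adj_conj:
  assumes A: "bounded_op A"
  shows "adj (\<theta> \<circ> A \<circ> \<theta>) = \<theta> \<circ> adj A \<circ> \<theta>"
proof (rule adj_eqI)
  fix u v
  have "cinner (\<theta> (A (\<theta> u))) v = cinner (\<theta> v) (A (\<theta> u))" by (rule cinner_left[THEN trans]) simp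
  also have "\<dots> = cinner (adj A (\<theta> v)) (\<theta> u)" by (simp add: cinner_adj'[OF A])
  also have "\<dots> = cinner u (\<theta> (adj A (\<theta> v)))" by (rule cinner_right)
  finally show "cinner ((\<theta> \<circ> A \<circ> \<theta>) u) v = cinner u ((\<theta> \<circ> adj A \<circ> \<theta>) v)" by simp
qed

lemma inj: "inj_on \<theta> E"
  by (metis inj_onI involution)

lemma onb_image:
  assumes E: "onb_on UNIV E"
  shows "onb_on UNIV (\<theta> ` E)"
proof -
  interpret orthonormal_basis E by unfold_locales (rule E)
  have "u = 0" if "\<forall>e\<in>E. cinner (\<theta> e) u = 0" for u
  proof -
    have "cinner e (\<theta> u) = 0" if "e \<in> E" for e
      using that \<open>\<forall>e\<in>E. _\<close> cinner_rev[of "\<theta> u" e] cinner_commute[of u "\<theta> e"] by simp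
    then have "\<theta> u = 0" by (rule eq_0I)
    then show ?thesis using norm_theta[of u] by simp
  qed
  moreover have "cinner (\<theta> e) (\<theta> f) = (if \<theta> e = \<theta> f then 1 else 0)" if "e \<in> E" "f \<in> E" for e f
    using orthonormal[OF that(2,1)] inj_on_eq_iff[OF inj that] by (auto simp: cinner_rev)
  ultimately show ?thesis unfolding onb_on_def by auto
qed

text \<open>Transposition relative to \<open>\<theta>\<close>: \<open>adj\<close> and conjugation by
  \<open>\<theta>\<close> are both antilinear, so the combination is linear, and it reverses
  products.\<close>

definition tilde :: "('a \<Rightarrow> 'a) \<Rightarrow> 'a \<Rightarrow> 'a" where
  "tilde A = \<theta> \<circ> adj A \<circ> \<theta>"

lemma bounded_op_tilde: "bounded_op A \<Longrightarrow> bounded_op (tilde A)"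
  unfolding tilde_def by (intro bounded_op_conj bounded_op_adj)

lemma tilde_comp: "bounded_op A \<Longrightarrow> bounded_op B \<Longrightarrow> tilde (A \<circ> B) = tilde B \<circ> tilde A"
  by (auto simp: tilde_def adj_comp)

lemma adj_tilde: "bounded_op A \<Longrightarrow> adj (tilde A) = tilde (adj A)"
  by (simp add: tilde_def adj_conj bounded_op_adj)

lemma tilde_tilde: "bounded_op A \<Longrightarrow> tilde (tilde A) = A"
  by (auto simp: tilde_def adj_conj bounded_op_adj adj_adj)

lemma hilbert_schmidt_tilde:
  assumes A: "hilbert_schmidt A"
  shows "hilbert_schmidt (tilde A)"
proof -
  have "(\<lambda>f. (norm (adj A f))\<^sup>2) summable_on \<theta> ` some_onb UNIV"
    by (rule hilbert_schmidt_onb[OF hilbert_schmidt_adj[OF A] onb_image[OF onb_some_onb]])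
  then have "(\<lambda>e. (norm (tilde A e))\<^sup>2) summable_on some_onb UNIV"
    by (subst (asm) summable_on_reindex[OF inj]) (simp add: o_def tilde_def norm_theta)
  then show ?thesis
    by (simp add: hilbert_schmidt_def bounded_op_tilde hilbert_schmidt_bounded_op[OF A])
qed

definition hs_tilde :: "'a hs \<Rightarrow> 'a hs" where
  "hs_tilde A = Abs_hs (tilde (hs_op A))"

lemma hs_op_hs_tilde: "hs_op (hs_tilde A) = tilde (hs_op A)"
  by (simp add: hs_tilde_def hs_op_Abs_hs hilbert_schmidt_tilde)

text \<open>Antiunitarity of \<open>\<theta>\<close> swaps the arguments and passing to adjoints
  swaps them back. The sum then runs over the image of the basis under \<open>\<theta>\<close>,
  which basis independence permits.\<close>

lemma cinner_hs_tilde: "cinner (hs_tilde A) (hs_tilde B) = cinner A B"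
proof -
  have "cinner (hs_tilde A) (hs_tilde B) =
      (\<Sum>\<^sub>\<infinity>e\<in>some_onb UNIV. cinner (adj (hs_op B) (\<theta> e)) (adj (hs_op A) (\<theta> e)))"
    by (simp add: cinner_hs_def hs_op_hs_tilde tilde_def cinner_rev)
  also have "\<dots> = (\<Sum>\<^sub>\<infinity>f\<in>\<theta> ` some_onb UNIV. cinner (adj (hs_op B) f) (adj (hs_op A) f))"
    by (simp add: infsum_reindex[OF inj] o_def)
  also have "\<dots> = cinner A B"
    unfolding cinner_hs_def by (rule infsum_cinner_adj[OF _ _ onb_image[OF onb_some_onb]]) auto
  finally show ?thesis .
qed

lemma hs_tilde_hs_lmul: "bounded_op x \<Longrightarrow> hs_tilde (hs_lmul x A) = hs_rmul (tilde x) (hs_tilde A)"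
  by (rule hs_eqI) (simp add: hs_op_hs_tilde hs_op_hs_lmul hs_op_hs_rmul bounded_op_tilde tilde_comp)

lemma hs_tilde_hs_rmul: "bounded_op x \<Longrightarrow> hs_tilde (hs_rmul x A) = hs_lmul (tilde x) (hs_tilde A)"
  by (rule hs_eqI) (simp add: hs_op_hs_tilde hs_op_hs_lmul hs_op_hs_rmul bounded_op_tilde tilde_comp)

text \<open>Transposition exchanges left and right multiplication. The operands are placed as in the
  right hand side of the balance condition, where \<open>tilde y\<close> and \<open>tilde x\<close>
  take the roles of \<open>x\<close> and \<open>y\<close>.\<close>

lemma cinner_hs_tilde_mul:
  assumes x: "bounded_op x" and y: "bounded_op y"
  shows "cinner (hs_rmul (adj (tilde y)) A) (hs_lmul (tilde x) B) =
    cinner (hs_rmul (adj x) (hs_tilde A)) (hs_lmul y (hs_tilde B))"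
proof -
  have "cinner (hs_rmul (adj (tilde y)) A) (hs_lmul (tilde x) B) =
      cinner (hs_tilde (hs_rmul (adj (tilde y)) A)) (hs_tilde (hs_lmul (tilde x) B))"
    by (simp add: cinner_hs_tilde)
  also have "\<dots> = cinner (hs_lmul (adj y) (hs_tilde A)) (hs_rmul x (hs_tilde B))"
    using x y by (simp add: hs_tilde_hs_lmul hs_tilde_hs_rmul bounded_op_tilde bounded_op_adj
        adj_tilde tilde_tilde)
  also have "\<dots> = cinner (hs_tilde A) (hs_rmul x (hs_lmul y (hs_tilde B)))"
    using x y by (simp add: cinner_hs_lmul bounded_op_adj adj_adj hs_lmul_hs_rmul)
  also have "\<dots> = cinner (hs_rmul (adj x) (hs_tilde A)) (hs_lmul y (hs_tilde B))"
    using x by (simp add: cinner_hs_rmul bounded_op_adj adj_adj)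
  finally show ?thesis .
qed

end


section \<open>Dense subspaces\<close>

lemma parallelogram:
  fixes x y :: "'a::real_inner"
  shows "(norm (x - y))\<^sup>2 = 2 * (norm x)\<^sup>2 + 2 * (norm y)\<^sup>2 - (norm (x + y))\<^sup>2"
  by (simp add: power2_norm_eq_inner inner_add_left inner_add_right inner_diff_left inner_diff_right
      inner_commute)

text \<open>Nearest point argument for a subspace that may fail to be closed: a minimising sequence
  converges to some \<open>p\<close> in the closure, and \<open>u - p\<close> is orthogonal to
  \<open>S\<close>, hence zero.\<close>

lemma in_closure_if_orthogonal_trivial:
  fixes S :: "'a::chilbert_space set"
  assumes ne: "0 \<in> S" and add: "\<And>x y. x \<in> S \<Longrightarrow> y \<in> S \<Longrightarrow> x + y \<in> S"
    and scale: "\<And>c x. x \<in> S \<Longrightarrow> c *\<^sub>C x \<in> S"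
    and trivial: "\<And>u. (\<And>s. s \<in> S \<Longrightarrow> cinner s u = 0) \<Longrightarrow> u = 0"
  shows "u \<in> closure S"
proof -
  define d where "d = (INF s\<in>S. norm (u - s))"
  have bdd: "bdd_below ((\<lambda>s. norm (u - s)) ` S)" by (intro bdd_belowI2[of _ 0]) simp
  have d_le: "d \<le> norm (u - s)" if "s \<in> S" for s
    unfolding d_def by (rule cINF_lower[OF bdd that])
  have d0: "0 \<le> d" unfolding d_def by (rule cINF_greatest) (use ne in auto)
  have "\<exists>s\<in>S. norm (u - s) < d + 1 / real (Suc n)" for n
    using cINF_less_iff[OF _ bdd, of "d + 1 / real (Suc n)"] ne by (auto simp: d_def[symmetric])
  then obtain s where s: "\<And>n. s n \<in> S" "\<And>n. norm (u - s n) < d + 1 / real (Suc n)" by metis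
  have lim: "(\<lambda>n. norm (u - s n)) \<longlonglongrightarrow> d"
  proof (rule tendsto_sandwich[of "\<lambda>_. d" _ _ "\<lambda>n. d + 1 / real (Suc n)"])
    show "(\<lambda>n. d + 1 / real (Suc n)) \<longlonglongrightarrow> d"
      using tendsto_add[OF tendsto_const[of d] lim_inverse_n'[THEN LIMSEQ_Suc]] by simp
  qed (use s d_le in \<open>auto intro!: always_eventually less_imp_le\<close>)
  have dist_le: "(norm (s m - s n))\<^sup>2 \<le> 2 * (norm (u - s m))\<^sup>2 + 2 * (norm (u - s n))\<^sup>2 - 4 * d\<^sup>2" for m n
  proof -
    \<comment> \<open>The midpoint has distance at least \<open>d\<close> from \<open>u\<close>, so
      the parallelogram identity forces a minimising sequence to be Cauchy.\<close>
    have "(1 / 2) *\<^sub>R (s m + s n) \<in> S"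
      unfolding scaleR_scaleC by (intro scale add s)
    then have "d \<le> norm (u - (1 / 2) *\<^sub>R (s m + s n))" by (rule d_le)
    then have "2 * d \<le> norm (2 *\<^sub>R (u - (1 / 2) *\<^sub>R (s m + s n)))" by simp
    also have "2 *\<^sub>R (u - (1 / 2) *\<^sub>R (s m + s n)) = (u - s m) + (u - s n)"
      by (simp add: algebra_simps scaleR_2)
    finally have "(2 * d)\<^sup>2 \<le> (norm ((u - s m) + (u - s n)))\<^sup>2" using d0 by (intro power_mono) auto
    moreover have "(norm (s m - s n))\<^sup>2 = (norm ((u - s m) - (u - s n)))\<^sup>2"
      by (simp add: norm_minus_commute)
    ultimately show ?thesis unfolding parallelogram by simp
  qed
  have "Cauchy s"
  proof (rule metric_CauchyI)
    fix e :: real assume "e > 0"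
    have "(\<lambda>n. (norm (u - s n))\<^sup>2) \<longlonglongrightarrow> d\<^sup>2" by (intro tendsto_intros lim)
    from order_tendstoD(2)[OF this, of "d\<^sup>2 + e\<^sup>2 / 4"] \<open>e > 0\<close>
    obtain N where N: "\<And>n. n \<ge> N \<Longrightarrow> (norm (u - s n))\<^sup>2 < d\<^sup>2 + e\<^sup>2 / 4"
      by (auto simp: eventually_sequentially)
    have "dist (s m) (s n) < e" if "m \<ge> N" "n \<ge> N" for m n
    proof -
      have "(norm (s m - s n))\<^sup>2 < e\<^sup>2"
        using dist_le[of m n] N[OF that(1)] N[OF that(2)] by simp
      then show ?thesis unfolding dist_norm by (rule power_less_imp_less_base) (use \<open>e > 0\<close> in simp)
    qed
    then show "\<exists>M. \<forall>m\<ge>M. \<forall>n\<ge>M. dist (s m) (s n) < e" by blast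
  qed
  then obtain p where p: "s \<longlonglongrightarrow> p" unfolding Cauchy_convergent_iff convergent_def by blast
  have np: "norm (u - p) = d"
    using LIMSEQ_unique[OF lim tendsto_norm[OF tendsto_diff[OF tendsto_const[of u] p]]] by simp
  have min: "d \<le> norm (u - p - x)" if "x \<in> S" for x
  proof -
    have "(\<lambda>n. norm (u - (s n + x))) \<longlonglongrightarrow> norm (u - (p + x))" by (intro tendsto_intros p)
    then have "d \<le> norm (u - (p + x))"
      by (rule LIMSEQ_le_const) (use d_le add s that in blast)
    then show ?thesis by (simp add: diff_diff_eq)
  qed
  have "cinner x (u - p) = 0" if "x \<in> S" for x
  proof (cases "x = 0")
    case False
    \<comment> \<open>The coefficient of the projection of \<open>u - p\<close> onto
      \<open>x\<close>: moving \<open>p\<close> by \<open>c *\<^sub>C x\<close> would lower the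
      squared distance by \<open>(cmod c)\<^sup>2 * (norm x)\<^sup>2\<close>.\<close>
    define c where "c = cinner x (u - p) / of_real ((norm x)\<^sup>2)"
    have nx: "(norm x)\<^sup>2 > 0" using False by simp
    have c: "cinner x (u - p) = c * of_real ((norm x)\<^sup>2)" using nx by (simp add: c_def)
    have "cinner (u - p) (c *\<^sub>C x) = c * cnj (cinner x (u - p))"
      by (simp only: cinner_scaleC_right cinner_commute[of "u - p" x])
    also have "\<dots> = of_real ((cmod c)\<^sup>2 * (norm x)\<^sup>2)"
      unfolding c using complex_norm_square[of c] by (simp add: mult.assoc[symmetric])
    finally have "(norm (u - p - c *\<^sub>C x))\<^sup>2 = d\<^sup>2 - (cmod c)\<^sup>2 * (norm x)\<^sup>2"
      unfolding norm_diff_sq np by (simp add: norm_scaleC power_mult_distrib)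
    moreover have "d\<^sup>2 \<le> (norm (u - p - c *\<^sub>C x))\<^sup>2"
      using min[OF scale[OF that]] d0 by (intro power_mono) auto
    ultimately have "(cmod c)\<^sup>2 * (norm x)\<^sup>2 \<le> 0" by simp
    then have "c = 0" using nx by (simp add: mult_le_0_iff)
    then show ?thesis using c by simp
  qed simp
  then have "u - p = 0" by (rule trivial)
  then show ?thesis using p s(1) closure_sequential by (metis eq_iff_diff_eq_0)
qed


section \<open>Closed linear spans\<close>

text \<open>Complex span in the shape of \<open>op_span\<close>, so that \<open>hs_op\<close>
  carries one to the other.\<close>

definition lin_span :: "'a::chilbert_space set \<Rightarrow> 'a set" where
  "lin_span X = {\<Sum>x\<in>F. c x *\<^sub>C x | F c. finite F \<and> F \<subseteq> X}"

text \<open>Since \<open>a\<close> may repeat vectors, one index is chosen for each vector that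
  occurs.\<close>

lemma lin_span_imageE:
  assumes "x \<in> lin_span (a ` J)"
  obtains F c where "finite F" "F \<subseteq> J" "x = (\<Sum>l\<in>F. c l *\<^sub>C a l)"
proof -
  obtain F c where F: "finite F" "F \<subseteq> a ` J" and x: "x = (\<Sum>x\<in>F. c x *\<^sub>C x)"
    using assms by (auto simp: lin_span_def)
  obtain F' where F': "F' \<subseteq> J" "inj_on a F'" "F = a ` F'"
    using F(2) by (auto simp: subset_image_inj)
  have "x = (\<Sum>l\<in>F'. c (a l) *\<^sub>C a l)"
    unfolding x F'(3) by (rule sum.reindex_cong[OF F'(2)]) auto
  moreover have "finite F'" using F(1) F'(2,3) finite_imageD by blast
  ultimately show ?thesis using F'(1) that[of F' "\<lambda>l. c (a l)"] by blast
qed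

lemma lin_span_sum:
  assumes "finite F" "F \<subseteq> J"
  shows "(\<Sum>l\<in>F. c l *\<^sub>C a l) \<in> lin_span (a ` J)"
proof -
  have "(\<Sum>l\<in>F. c l *\<^sub>C a l) = (\<Sum>x\<in>a ` F. \<Sum>l\<in>{l \<in> F. a l = x}. c l *\<^sub>C a l)"
    by (rule sum.image_gen[OF assms(1)])
  also have "\<dots> = (\<Sum>x\<in>a ` F. (\<Sum>l\<in>{l \<in> F. a l = x}. c l) *\<^sub>C x)"
    by (simp add: scaleC.sum_left)
  finally show ?thesis
    using assms unfolding lin_span_def
    by (intro CollectI exI[of _ "a ` F"] exI[of _ "\<lambda>x. \<Sum>l\<in>{l \<in> F. a l = x}. c l"]) auto
qed

lemma cinner_closure_lin_span_eq_0:
  assumes "x \<in> closure (lin_span X)" "\<And>y. y \<in> X \<Longrightarrow> cinner p y = 0"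
  shows "cinner p x = 0"
proof -
  have "closed {x. cinner p x = 0}"
    by (intro closed_Collect_eq continuous_intros bounded_linear.continuous_on[OF cinner.bounded_linear_right])
  moreover have "lin_span X \<subseteq> {x. cinner p x = 0}"
    using assms(2) by (auto simp: lin_span_def cinner_sum_right cinner_linear subset_iff)
  ultimately show ?thesis using assms(1) closure_minimal by blast
qed

lemma has_sum_in_closure_lin_span:
  assumes "((\<lambda>l. c l *\<^sub>C a l) has_sum x) J"
  shows "x \<in> closure (lin_span (a ` J))"
  unfolding closure_approachable
proof (intro allI impI)
  fix e :: real assume "e > 0"
  then obtain F where "finite F" "F \<subseteq> J" "dist (\<Sum>l\<in>F. c l *\<^sub>C a l) x \<le> e / 2"
    using has_sum_finite_approximation[OF assms, of "e / 2"] by auto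
  then show "\<exists>y\<in>lin_span (a ` J). dist y x < e"
    using lin_span_sum[of F J c a] \<open>e > 0\<close> by (intro bexI[of _ "\<Sum>l\<in>F. c l *\<^sub>C a l"]) auto
qed


section \<open>Square summable families\<close>

lemma ell2_nth_ket: "ell2_nth (ket n) i = (if i = n then 1 else 0)"
  by transfer simp

lemma ell2_eqI: "(\<And>n. ell2_nth f n = ell2_nth g n) \<Longrightarrow> f = g"
  by (simp add: ext flip: ell2_nth_inject)

lemma cinner_ket: "cinner (ket n) f = ell2_nth f n"
proof -
  have "(\<lambda>i. cnj (ell2_nth (ket n) i) * ell2_nth f i) = (\<lambda>i. if i = n then ell2_nth f i else 0)"
    by (auto simp: ell2_nth_ket)
  then show ?thesis
    unfolding cinner_ell2_def using sums_unique[OF sums_single[of n "ell2_nth f"]] by simp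
qed

lemma onb_ket: "onb_on UNIV (range ket)"
  unfolding onb_on_def
proof (intro conjI ballI impI)
  fix e f assume "e \<in> range ket" "f \<in> range ket"
  then obtain m n where [simp]: "e = ket m" "f = ket n" by blast
  have "ket m = ket n \<longleftrightarrow> m = n" by (metis ell2_nth_ket zero_neq_one)
  then show "cinner e f = (if e = f then 1 else 0)" by (simp add: cinner_ket ell2_nth_ket)
next
  show "u = 0" if "\<forall>e\<in>range ket. cinner e u = 0" for u
    using that by (intro ell2_eqI) (auto simp: cinner_ket zero_ell2.rep_eq)
qed simp

interpretation ket: orthonormal_basis "range ket"
  by unfold_locales (rule onb_ket)

lemma inj_ket: "inj ket"
  by (rule injI) (metis ell2_nth_ket zero_neq_one)

lemma ket_in_ell2_on: "j \<in> J \<Longrightarrow> ket j \<in> ell2_on J"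
  by (auto simp: ell2_on_def ell2_nth_ket)

lemma ell2_on_linear:
  "0 \<in> ell2_on J" "f \<in> ell2_on J \<Longrightarrow> g \<in> ell2_on J \<Longrightarrow> f + g \<in> ell2_on J"
  "f \<in> ell2_on J \<Longrightarrow> g \<in> ell2_on J \<Longrightarrow> f - g \<in> ell2_on J"
  "f \<in> ell2_on J \<Longrightarrow> c *\<^sub>C f \<in> ell2_on J"
  by (auto simp: ell2_on_def zero_ell2.rep_eq plus_ell2.rep_eq minus_ell2.rep_eq scaleC_ell2.rep_eq)

lemma
  assumes f: "f \<in> ell2_on J"
  shows has_sum_ket: "((\<lambda>l. ell2_nth f l *\<^sub>C ket l) has_sum f) J"
    and has_sum_cmod_nth_sq: "((\<lambda>l. (cmod (ell2_nth f l))\<^sup>2) has_sum (norm f)\<^sup>2) J"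
    and has_sum_cinner_nth: "((\<lambda>l. cnj (ell2_nth g l) * ell2_nth f l) has_sum cinner g f) J"
proof -
  have 0: "ell2_nth f n = 0" if "n \<notin> J" for n using that f by (auto simp: ell2_on_def)
  have "((\<lambda>l. ell2_nth f l *\<^sub>C ket l) has_sum f) UNIV"
    using ket.expansion[of f] has_sum_reindex[OF inj_ket, of "\<lambda>e. cinner e f *\<^sub>C e" f]
    by (simp add: o_def cinner_ket)
  then show "((\<lambda>l. ell2_nth f l *\<^sub>C ket l) has_sum f) J"
    by (rule has_sum_cong_neutral[THEN iffD1, rotated -1]) (auto simp: 0)
  have "((\<lambda>l. (cmod (ell2_nth f l))\<^sup>2) has_sum (norm f)\<^sup>2) UNIV"
    using ket.parseval_norm[of f] has_sum_reindex[OF inj_ket, of "\<lambda>e. (cmod (cinner e f))\<^sup>2"]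
    by (simp add: o_def cinner_ket)
  then show "((\<lambda>l. (cmod (ell2_nth f l))\<^sup>2) has_sum (norm f)\<^sup>2) J"
    by (rule has_sum_cong_neutral[THEN iffD1, rotated -1]) (auto simp: 0)
  have "cinner g (ket l) = cnj (ell2_nth g l)" for l
    using cinner_commute[of g "ket l"] by (simp add: cinner_ket)
  then have "((\<lambda>l. cnj (ell2_nth g l) * ell2_nth f l) has_sum cinner g f) UNIV"
    using ket.parseval[of g f] has_sum_reindex[OF inj_ket, of "\<lambda>e. cinner g e * cinner e f"]
    by (simp add: o_def cinner_ket)
  then show "((\<lambda>l. cnj (ell2_nth g l) * ell2_nth f l) has_sum cinner g f) J"
    by (rule has_sum_cong_neutral[THEN iffD1, rotated -1]) (auto simp: 0)
qed

text \<open>Here \<open>synth\<close> is the operator called V or W in the overview and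
  \<open>ana\<close> is its adjoint, with values extended by zero outside \<open>J\<close>.\<close>

locale sq_summable_family =
  fixes J :: "nat set" and a :: "nat \<Rightarrow> 'a::chilbert_space"
  assumes sq_summable: "(\<lambda>l. (norm (a l))\<^sup>2) summable_on J"
begin

definition synth :: "ell2 \<Rightarrow> 'a" where
  "synth f = (\<Sum>\<^sub>\<infinity>l\<in>J. ell2_nth f l *\<^sub>C a l)"

definition ana :: "'a \<Rightarrow> ell2" where
  "ana p = Abs_ell2 (\<lambda>l. if l \<in> J then cinner (a l) p else 0)"

lemma norm_term_le: "norm (ell2_nth f l *\<^sub>C a l) \<le> (cmod (ell2_nth f l))\<^sup>2 + (norm (a l))\<^sup>2"
  unfolding norm_scaleC by (rule mult_le_sum_sq)

lemma nth_sq_summable: "(\<lambda>l. (cmod (ell2_nth f l))\<^sup>2) summable_on J"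
proof -
  have "(\<lambda>l. (cmod (ell2_nth f l))\<^sup>2) summable_on UNIV"
    using has_sum_cmod_nth_sq[of f UNIV] by (auto simp: ell2_on_def summable_on_def)
  then show ?thesis by (rule summable_on_subset) simp
qed

lemma has_sum_synth: "((\<lambda>l. ell2_nth f l *\<^sub>C a l) has_sum synth f) J"
  unfolding synth_def
  by (rule has_sum_infsum, rule Infinite_Sum.abs_summable_summable,
      rule Infinite_Sum.abs_summable_on_comparison_test'[OF summable_on_add[OF nth_sq_summable sq_summable]],
      rule norm_term_le)

lemma synth_add: "synth (f + g) = synth f + synth g"
  using has_sum_unique[OF has_sum_synth[of "f + g"]] has_sum_add[OF has_sum_synth[of f] has_sum_synth[of g]]
  by (simp add: plus_ell2.rep_eq scaleC_add_left)

lemma synth_scaleC: "synth (c *\<^sub>C f) = c *\<^sub>C synth f"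
  using has_sum_unique[OF has_sum_synth[of "c *\<^sub>C f"]] has_sum_scaleC[OF has_sum_synth[of f], of c]
  by (simp add: scaleC_ell2.rep_eq scaleC_scaleC)

lemma synth_ket: "j \<in> J \<Longrightarrow> synth (ket j) = a j"
  by (rule has_sum_unique[OF has_sum_synth], rule has_sum_finite_neutralI[of "{j}"])
    (auto simp: ell2_nth_ket)

text \<open>Only boundedness matters, so a crude constant is enough: at norm 1 each term is at most
  the sum of the two squares, and homogeneity does the rest.\<close>

lemma norm_synth_le: "norm (synth f) \<le> (1 + (\<Sum>\<^sub>\<infinity>l\<in>J. (norm (a l))\<^sup>2)) * norm f"
proof (rule norm_le_if_unit_le[OF synth_scaleC])
  fix g :: ell2 assume "norm g = 1"
  then have g1: "((\<lambda>l. (cmod (ell2_nth g l))\<^sup>2) has_sum 1) UNIV"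
    using has_sum_cmod_nth_sq[of g UNIV] by (simp add: ell2_on_def)
  have gJ: "((\<lambda>l. (cmod (ell2_nth g l))\<^sup>2) has_sum (\<Sum>\<^sub>\<infinity>l\<in>J. (cmod (ell2_nth g l))\<^sup>2)) J"
    by (rule has_sum_infsum[OF nth_sq_summable])
  have "norm (synth g) \<le> (\<Sum>\<^sub>\<infinity>l\<in>J. (cmod (ell2_nth g l))\<^sup>2) + (\<Sum>\<^sub>\<infinity>l\<in>J. (norm (a l))\<^sup>2)"
    by (rule norm_infsum_le[OF has_sum_synth has_sum_add[OF gJ has_sum_infsum[OF sq_summable]]])
      (rule norm_term_le)
  also have "(\<Sum>\<^sub>\<infinity>l\<in>J. (cmod (ell2_nth g l))\<^sup>2) \<le> 1"
    by (rule has_sum_mono_neutral[OF gJ g1]) auto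
  finally show "norm (synth g) \<le> 1 + (\<Sum>\<^sub>\<infinity>l\<in>J. (norm (a l))\<^sup>2)" by simp
qed

lemma bounded_linear_synth: "bounded_linear synth"
  by (rule bounded_linear_intro[of _ "1 + (\<Sum>\<^sub>\<infinity>l\<in>J. (norm (a l))\<^sup>2)"])
    (use norm_synth_le in \<open>auto simp: synth_add synth_scaleC scaleR_scaleC mult.commute\<close>)

lemma ell2_nth_ana: "ell2_nth (ana p) = (\<lambda>l. if l \<in> J then cinner (a l) p else 0)"
proof -
  have "(\<lambda>l. (cmod (cinner (a l) p))\<^sup>2) summable_on J"
  proof (rule summable_on_comparison_test)
    show "(\<lambda>l. (norm (a l))\<^sup>2 * (norm p)\<^sup>2) summable_on J"
      by (rule summable_on_cmult_left[OF sq_summable])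
    show "(cmod (cinner (a l) p))\<^sup>2 \<le> (norm (a l))\<^sup>2 * (norm p)\<^sup>2" for l
      using power_mono[OF cmod_cinner_le[of "a l" p] norm_ge_zero, of 2]
      by (simp add: power_mult_distrib)
  qed simp
  then have "(\<lambda>l. (cmod (if l \<in> J then cinner (a l) p else 0))\<^sup>2) summable_on UNIV"
    by (rule summable_on_cong_neutral[THEN iffD1, rotated -1]) auto
  then have "summable (\<lambda>l. (cmod (if l \<in> J then cinner (a l) p else 0))\<^sup>2)"
    by (rule summable_on_imp_summable)
  then show ?thesis unfolding ana_def by (intro Abs_ell2_inverse) simp
qed

lemma ana_in_ell2_on: "ana p \<in> ell2_on J"
  by (simp add: ell2_on_def ell2_nth_ana)

lemma cinner_ana:
  assumes "f \<in> ell2_on J"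
  shows "cinner (ana p) f = cinner p (synth f)"
proof (rule has_sum_unique)
  show "((\<lambda>l. cnj (ell2_nth (ana p) l) * ell2_nth f l) has_sum cinner (ana p) f) J"
    by (rule has_sum_cinner_nth[OF assms])
  have "((\<lambda>l. cinner p (ell2_nth f l *\<^sub>C a l)) has_sum cinner p (synth f)) J"
    by (rule has_sum_cinner_right[OF has_sum_synth])
  moreover have "cinner p (ell2_nth f l *\<^sub>C a l) = cnj (ell2_nth (ana p) l) * ell2_nth f l"
    if "l \<in> J" for l
    using that cinner_commute[of p "a l"] by (simp add: ell2_nth_ana cinner_linear)
  ultimately show "((\<lambda>l. cnj (ell2_nth (ana p) l) * ell2_nth f l) has_sum cinner p (synth f)) J"
    by (simp cong: has_sum_cong)
qed

lemma synth_in_closure: "synth f \<in> closure (lin_span (a ` J))"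
  by (rule has_sum_in_closure_lin_span[OF has_sum_synth])

end

lemma bounded_op_on_diff:
  assumes A: "bounded_op_on (ell2_on J) A" and f: "f \<in> ell2_on J" and g: "g \<in> ell2_on J"
  shows "A (f - g) = A f - A g"
proof -
  have "(-1) *\<^sub>C g \<in> ell2_on J" using g by (rule ell2_on_linear)
  then have "A (f + (-1) *\<^sub>C g) = A f + (-1) *\<^sub>C A g"
    using A f g unfolding bounded_op_on_def by metis
  then show ?thesis by simp
qed

text \<open>Nothing is known of \<open>A\<close> off \<open>ell2_on J\<close>, so continuity is
  available only along filters that stay in this subspace.\<close>

lemma tendsto_bounded_op_on:
  assumes A: "bounded_op_on (ell2_on J) A" and x: "\<forall>\<^sub>F i in F. x i \<in> ell2_on J"
    and lim: "(x \<longlongrightarrow> f) F" and f: "f \<in> ell2_on J"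
  shows "((\<lambda>i. A (x i)) \<longlongrightarrow> A f) F"
proof -
  obtain K where K: "\<And>u. u \<in> ell2_on J \<Longrightarrow> norm (A u) \<le> K * norm u"
    using A unfolding bounded_op_on_def by blast
  have "((\<lambda>i. A (x i) - A f) \<longlongrightarrow> 0) F"
  proof (rule tendsto_0_le)
    show "((\<lambda>i. x i - f) \<longlongrightarrow> 0) F" using lim by (simp add: LIM_zero)
    show "\<forall>\<^sub>F i in F. norm (A (x i) - A f) \<le> norm (x i - f) * K"
    proof (rule eventually_mono[OF x])
      show "norm (A (x i) - A f) \<le> norm (x i - f) * K" if "x i \<in> ell2_on J" for i
        using K[of "x i - f"] bounded_op_on_diff[OF A that f] f that
        by (simp add: ell2_on_linear mult.commute)
    qed
  qed
  then show ?thesis by (simp add: LIM_zero_iff)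
qed

lemma bounded_op_on_has_sum_ket:
  assumes B: "bounded_op_on (ell2_on J) B" and f: "f \<in> ell2_on J"
  shows "((\<lambda>l. ell2_nth f l *\<^sub>C B (ket l)) has_sum B f) J"
proof -
  let ?s = "\<lambda>F. \<Sum>l\<in>F. ell2_nth f l *\<^sub>C ket l"
  have add: "B (u + v) = B u + B v" and scale: "B (c *\<^sub>C u) = c *\<^sub>C B u"
    if "u \<in> ell2_on J" "v \<in> ell2_on J" for u v c
    using B that unfolding bounded_op_on_def by auto
  have B0: "B 0 = 0" using scale[of 0 0 0] by (simp add: ell2_on_linear)
  have fin: "?s F \<in> ell2_on J \<and> B (?s F) = (\<Sum>l\<in>F. ell2_nth f l *\<^sub>C B (ket l))"
    if "finite F" "F \<subseteq> J" for F
    using that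
  proof (induction F rule: finite_induct)
    case (insert l F)
    then have "ell2_nth f l *\<^sub>C ket l \<in> ell2_on J" by (intro ell2_on_linear ket_in_ell2_on) auto
    then show ?case using insert by (auto simp: add scale ket_in_ell2_on ell2_on_linear)
  qed (simp add: B0 ell2_on_linear)
  have "((\<lambda>F. B (?s F)) \<longlongrightarrow> B f) (finite_subsets_at_top J)"
    using fin has_sum_ket[OF f] unfolding has_sum_def
    by (intro tendsto_bounded_op_on[OF B _ _ f] eventually_finite_subsets_at_top_weakI) auto
  moreover have "\<forall>\<^sub>F F in finite_subsets_at_top J. B (?s F) = (\<Sum>l\<in>F. ell2_nth f l *\<^sub>C B (ket l))"
    using fin by (intro eventually_finite_subsets_at_top_weakI) auto
  ultimately show ?thesis unfolding has_sum_def by (rule Lim_transform_eventually)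
qed

text \<open>A bounded operator on \<open>ell2_on J\<close> is determined by its matrix, and the
  mixed Gram matrix of \<open>a\<close> and \<open>b\<close> is that of V* W for their synthesis
  operators V and W.\<close>

lemma cinner_matrix_eq:
  assumes B: "bounded_op_on (ell2_on J) B"
    and a: "sq_summable_family J a" and b: "sq_summable_family J b"
    and mat: "\<And>j k. j \<in> J \<Longrightarrow> k \<in> J \<Longrightarrow> cinner (ket j) (B (ket k)) = cinner (a j) (b k)"
    and f: "f \<in> ell2_on J" and g: "g \<in> ell2_on J"
  shows "cinner f (B g) = cinner (sq_summable_family.synth J a f) (sq_summable_family.synth J b g)"
proof -
  interpret a: sq_summable_family J a by (rule a)
  interpret b: sq_summable_family J b by (rule b)
  have 1: "cinner (ket j) (B g) = cinner (a j) (b.synth g)" if j: "j \<in> J" for j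
  proof (rule has_sum_unique)
    show "((\<lambda>l. cinner (ket j) (ell2_nth g l *\<^sub>C B (ket l))) has_sum cinner (ket j) (B g)) J"
      by (rule has_sum_cinner_right[OF bounded_op_on_has_sum_ket[OF B g]])
    have "((\<lambda>l. cinner (a j) (ell2_nth g l *\<^sub>C b l)) has_sum cinner (a j) (b.synth g)) J"
      by (rule has_sum_cinner_right[OF b.has_sum_synth])
    then show "((\<lambda>l. cinner (ket j) (ell2_nth g l *\<^sub>C B (ket l))) has_sum cinner (a j) (b.synth g)) J"
      by (rule has_sum_cong[THEN iffD1, rotated]) (simp add: cinner_linear mat j)
  qed
  show ?thesis
  proof (rule has_sum_unique)
    show "((\<lambda>l. cinner (ell2_nth f l *\<^sub>C ket l) (B g)) has_sum cinner f (B g)) J"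
      by (rule has_sum_cinner_left[OF has_sum_ket[OF f]])
    have "((\<lambda>l. cinner (ell2_nth f l *\<^sub>C a l) (b.synth g)) has_sum cinner (a.synth f) (b.synth g)) J"
      by (rule has_sum_cinner_left[OF a.has_sum_synth])
    then show "((\<lambda>l. cinner (ell2_nth f l *\<^sub>C ket l) (B g)) has_sum cinner (a.synth f) (b.synth g)) J"
      by (rule has_sum_cong[THEN iffD1, rotated]) (simp add: cinner_linear 1)
  qed
qed


section \<open>Families with equal Gram matrices\<close>

text \<open>The identity V V* = W W* in weak form, as an equality of sesquilinear forms.\<close>

definition same_frame ::
    "nat set \<Rightarrow> (nat \<Rightarrow> 'a::chilbert_space) \<Rightarrow> (nat \<Rightarrow> 'a) \<Rightarrow> bool" where
  "same_frame J a b \<longleftrightarrow> (\<forall>p q. (\<Sum>\<^sub>\<infinity>l\<in>J. cinner p (a l) * cinner (a l) q) =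
     (\<Sum>\<^sub>\<infinity>l\<in>J. cinner p (b l) * cinner (b l) q))"

lemma same_frameD:
  "same_frame J a b \<Longrightarrow> (\<Sum>\<^sub>\<infinity>l\<in>J. cinner p (a l) * cinner (a l) q) =
     (\<Sum>\<^sub>\<infinity>l\<in>J. cinner p (b l) * cinner (b l) q)"
  by (simp add: same_frame_def)

text \<open>In operator terms: V* V = W* W by \<open>gram\<close>, V is injective by
  \<open>independent\<close>, and the matrix assumptions say C = V* V and R = V* W.\<close>

locale gram_pair = a: sq_summable_family J a + b: sq_summable_family J b
  for J :: "nat set" and a b :: "nat \<Rightarrow> 'k::chilbert_space" and R C :: "ell2 \<Rightarrow> ell2" +
  assumes gram: "\<And>j k. j \<in> J \<Longrightarrow> k \<in> J \<Longrightarrow> cinner (b j) (b k) = cinner (a j) (a k)"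
    and independent: "\<And>f. f \<in> ell2_on J \<Longrightarrow> a.synth f = 0 \<Longrightarrow> f = 0"
    and R: "self_adjoint_on (ell2_on J) R"
    and R_matrix: "\<And>j k. j \<in> J \<Longrightarrow> k \<in> J \<Longrightarrow> cinner (ket j) (R (ket k)) = cinner (a j) (b k)"
    and C: "self_adjoint_on (ell2_on J) C"
    and C_matrix: "\<And>j k. j \<in> J \<Longrightarrow> k \<in> J \<Longrightarrow> cinner (ket j) (C (ket k)) = cinner (a j) (a k)"
begin

abbreviation "S \<equiv> ell2_on J"
abbreviation "V \<equiv> a.synth"
abbreviation "W \<equiv> b.synth"

section \<open>R and C as products of synthesis operators and their adjoints\<close>

lemma bR: "bounded_op_on S R" and bC: "bounded_op_on S C"
  using R C by (auto simp: self_adjoint_on_def)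

lemma R_in: "f \<in> S \<Longrightarrow> R f \<in> S" and C_in: "f \<in> S \<Longrightarrow> C f \<in> S"
  using bR bC by (auto simp: bounded_op_on_def)

lemma R_sym: "f \<in> S \<Longrightarrow> g \<in> S \<Longrightarrow> cinner (R f) g = cinner f (R g)"
  and C_sym: "f \<in> S \<Longrightarrow> g \<in> S \<Longrightarrow> cinner (C f) g = cinner f (C g)"
  using R C by (auto simp: self_adjoint_on_def)

lemma cinner_R: "f \<in> S \<Longrightarrow> g \<in> S \<Longrightarrow> cinner f (R g) = cinner (V f) (W g)"
  by (rule cinner_matrix_eq[OF bR a.sq_summable_family_axioms b.sq_summable_family_axioms R_matrix])

lemma cinner_C: "f \<in> S \<Longrightarrow> g \<in> S \<Longrightarrow> cinner f (C g) = cinner (V f) (V g)"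
  by (rule cinner_matrix_eq[OF bC a.sq_summable_family_axioms a.sq_summable_family_axioms C_matrix])

lemma cinner_C': "f \<in> S \<Longrightarrow> g \<in> S \<Longrightarrow> cinner f (C g) = cinner (W f) (W g)"
  by (rule cinner_matrix_eq[OF bC b.sq_summable_family_axioms b.sq_summable_family_axioms])
    (simp add: C_matrix gram)

text \<open>Self-adjointness of \<open>R\<close> supplies the second factorisation R = W* V.\<close>

lemma cinner_R': "f \<in> S \<Longrightarrow> g \<in> S \<Longrightarrow> cinner f (R g) = cinner (W f) (V g)"
  by (metis R_sym cinner_R cinner_commute)

lemma parseval_ket:
  assumes "f \<in> S" "g \<in> S"
  shows "(\<Sum>\<^sub>\<infinity>l\<in>J. cinner f (ket l) * cinner (ket l) g) = cinner f g"
proof -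
  have "cinner f (ket l) * cinner (ket l) g = cnj (ell2_nth f l) * ell2_nth g l" for l
    using cinner_commute[of f "ket l"] by (simp add: cinner_ket)
  then show ?thesis using infsumI[OF has_sum_cinner_nth[OF assms(2), of f]] by simp
qed

lemma S_eqI: "x \<in> S \<Longrightarrow> y \<in> S \<Longrightarrow> (\<And>f. f \<in> S \<Longrightarrow> cinner f x = cinner f y) \<Longrightarrow> x = y"
  by (metis cinner_diff_right cinner_self_eq_0 ell2_on_linear(3) right_minus_eq)

lemma C_eq_0D: "f \<in> S \<Longrightarrow> C f = 0 \<Longrightarrow> f = 0"
  using cinner_C[of f f] independent by simp

lemma inj_C: "inj_on C S"
proof (rule inj_onI)
  fix f g assume fg: "f \<in> S" "g \<in> S" "C f = C g"
  then have "C (f - g) = 0" by (simp add: bounded_op_on_diff[OF bC])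
  then show "f = g" using C_eq_0D[of "f - g"] fg by (simp add: ell2_on_linear)
qed

text \<open>\<open>inv_into\<close> takes arbitrary values off the range of \<open>C\<close>, hence
  the separate requirement that the range of \<open>R\<close> lie in that of
  \<open>C\<close>.\<close>

abbreviation U :: "ell2 \<Rightarrow> ell2" where
  "U \<equiv> inv_into S C \<circ> R"

text \<open>A vector of \<open>S\<close> orthogonal to the range of the self-adjoint
  \<open>C\<close> lies in its kernel, which is trivial. The density criterion concerns the whole
  space, so the complement of \<open>S\<close> is added to the range and projected away
  again.\<close>

lemma C_range_dense:
  assumes f: "f \<in> S"
  shows "\<exists>g. (\<forall>n::nat. g n \<in> S) \<and> (\<lambda>n. C (g n)) \<longlonglongrightarrow> f"
proof -
  define X where "X = {C g + h | g h. g \<in> S \<and> h \<in> ell2_on (- J)}"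
  have add: "C (g + g') = C g + C g'" and scale: "C (c *\<^sub>C g) = c *\<^sub>C C g"
    if "g \<in> S" "g' \<in> S" for g g' c
    using bC that unfolding bounded_op_on_def by auto
  have orth: "cinner u h = 0" if "u \<in> S" "h \<in> ell2_on (- J)" for u h
  proof -
    have "((\<lambda>l. cnj (ell2_nth u l) * ell2_nth h l) has_sum cinner u h) (- J)"
      by (rule has_sum_cinner_nth[OF that(2)])
    then have "((\<lambda>l. 0::complex) has_sum cinner u h) (- J)"
      by (rule has_sum_cong[THEN iffD1, rotated]) (use that(1) in \<open>simp add: ell2_on_def\<close>)
    then show ?thesis by (rule has_sum_unique) simp
  qed
  have "f \<in> closure X"
  proof (rule in_closure_if_orthogonal_trivial)
    have "C 0 = 0" using scale[of 0 0 0] by (simp add: ell2_on_linear)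
    then show "0 \<in> X" unfolding X_def using ell2_on_linear(1) by force
    show "x + y \<in> X" if "x \<in> X" "y \<in> X" for x y
    proof -
      obtain g h g' h' where "g \<in> S" "h \<in> ell2_on (- J)" "g' \<in> S" "h' \<in> ell2_on (- J)"
        "x = C g + h" "y = C g' + h'" using \<open>x \<in> X\<close> \<open>y \<in> X\<close> unfolding X_def by blast
      then have "x + y = C (g + g') + (h + h')" "g + g' \<in> S" "h + h' \<in> ell2_on (- J)"
        by (auto simp: add ell2_on_linear)
      then show ?thesis unfolding X_def by blast
    qed
    show "c *\<^sub>C x \<in> X" if "x \<in> X" for c x
    proof -
      obtain g h where "g \<in> S" "h \<in> ell2_on (- J)" "x = C g + h"
        using \<open>x \<in> X\<close> unfolding X_def by blast
      then have "c *\<^sub>C x = C (c *\<^sub>C g) + c *\<^sub>C h" "c *\<^sub>C g \<in> S" "c *\<^sub>C h \<in> ell2_on (- J)"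
        by (auto simp: scale scaleC_add_right ell2_on_linear)
      then show ?thesis unfolding X_def by blast
    qed
    show "u = 0" if u: "\<And>s. s \<in> X \<Longrightarrow> cinner s u = 0" for u
    proof -
      have "ell2_nth u l = 0" if "l \<notin> J" for l
      proof -
        have "C 0 + ket l \<in> X"
          unfolding X_def using that ket_in_ell2_on[of l "- J"] ell2_on_linear(1) by blast
        then show ?thesis using u[of "ket l"] \<open>C 0 = 0\<close> by (simp add: cinner_ket)
      qed
      then have uS: "u \<in> S" by (simp add: ell2_on_def)
      \<comment> \<open>Self-adjointness moves one \<open>C\<close> across, so this test vector
        produces the norm of \<open>C u\<close>.\<close>
      have "C (C u) + 0 \<in> X" unfolding X_def using uS C_in ell2_on_linear(1) by blast
      then have "cinner (C (C u)) u = 0" using u by force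
      then have "cinner (C u) (C u) = 0" using C_sym[OF C_in[OF uS] uS] by simp
      then have "C u = 0" by simp
      then show ?thesis by (rule C_eq_0D[OF uS])
    qed
  qed
  then obtain x where x: "\<And>n::nat. x n \<in> X" "x \<longlonglongrightarrow> f" unfolding closure_sequential by blast
  then have "\<exists>g h. g \<in> S \<and> h \<in> ell2_on (- J) \<and> x n = C g + h" for n unfolding X_def by blast
  then obtain g h where gh: "\<And>n. g n \<in> S" "\<And>n. h n \<in> ell2_on (- J)" "\<And>n. x n = C (g n) + h n"
    by metis
  have "(\<lambda>n. C (g n) - f) \<longlonglongrightarrow> 0"
  proof (rule tendsto_0_le)
    show "(\<lambda>n. x n - f) \<longlonglongrightarrow> 0" using x(2) by (simp add: LIM_zero)
    have "norm (C (g n) - f) \<le> norm (x n - f) * 1" for n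
    proof -
      \<comment> \<open>\<open>h n\<close> is orthogonal to \<open>S\<close>, so dropping it can
        only reduce the distance to \<open>f\<close>.\<close>
      have "cinner (C (g n) - f) (h n) = 0"
        by (intro orth gh ell2_on_linear C_in f)
      then have "(norm (C (g n) - f + h n))\<^sup>2 = (norm (C (g n) - f))\<^sup>2 + (norm (h n))\<^sup>2"
        unfolding norm_add_sq by simp
      moreover have "C (g n) - f + h n = x n - f" unfolding gh(3) by simp
      ultimately have "(norm (C (g n) - f))\<^sup>2 \<le> (norm (x n - f))\<^sup>2" by simp
      then have "norm (C (g n) - f) \<le> norm (x n - f)" by (rule power2_le_imp_le) simp
      then show ?thesis by simp
    qed
    then show "\<forall>\<^sub>F n in sequentially. norm (C (g n) - f) \<le> norm (x n - f) * 1" by simp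
  qed
  then have "(\<lambda>n. C (g n)) \<longlonglongrightarrow> f" by (simp add: LIM_zero_iff)
  then show ?thesis using gh(1) by blast
qed

lemma closed_S: "closed S"
proof -
  have "S = (\<Inter>n\<in>- J. {f. cinner (ket n) f = 0})" by (auto simp: ell2_on_def cinner_ket)
  moreover have "closed {f. cinner (ket n) f = 0}" for n
    by (intro closed_Collect_eq continuous_intros bounded_linear.continuous_on[OF cinner.bounded_linear_right])
  ultimately show ?thesis by auto
qed

lemma tendsto_op_on:
  assumes "bounded_op_on S A" "\<And>n::nat. x n \<in> S" "x \<longlonglongrightarrow> f" "f \<in> S"
  shows "(\<lambda>n. A (x n)) \<longlonglongrightarrow> A f"
  by (rule tendsto_bounded_op_on[OF assms(1) _ assms(3,4)]) (simp add: assms(2))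

text \<open>
  If \<open>R\<close> and \<open>C\<close> commute and \<open>R\<^sup>2 = C\<^sup>2\<close>, then \<open>R f = C h\<close>, where \<open>h\<close> is the limit of
  \<open>R g\<^sub>n\<close> for any sequence with \<open>C g\<^sub>n\<close> tending to \<open>f\<close>.
\<close>

lemma polar_exists:
  assumes comm: "\<And>f. f \<in> S \<Longrightarrow> R (C f) = C (R f)"
    and sq: "\<And>f g. f \<in> S \<Longrightarrow> g \<in> S \<Longrightarrow> cinner (R f) (R g) = cinner (C f) (C g)"
    and f: "f \<in> S"
  shows "\<exists>h\<in>S. R f = C h \<and> norm h = norm f"
proof -
  obtain g where g: "\<And>n::nat. g n \<in> S" "(\<lambda>n. C (g n)) \<longlonglongrightarrow> f"
    using C_range_dense[OF f] by blast
  have norm_RC: "norm (R u) = norm (C u)" if "u \<in> S" for u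
  proof -
    have "complex_of_real ((norm (R u))\<^sup>2) = complex_of_real ((norm (C u))\<^sup>2)"
      unfolding cinner_self[symmetric] using sq that by blast
    then show ?thesis unfolding of_real_eq_iff by simp
  qed
  have "Cauchy (\<lambda>n. R (g n))"
  proof (rule metric_CauchyI)
    fix e :: real assume "e > 0"
    have "dist (R (g m)) (R (g n)) = dist (C (g m)) (C (g n))" for m n
      unfolding dist_norm using norm_RC[of "g m - g n"] g(1)
      by (simp add: bounded_op_on_diff[OF bR] bounded_op_on_diff[OF bC] ell2_on_linear)
    then show "\<exists>M. \<forall>m\<ge>M. \<forall>n\<ge>M. dist (R (g m)) (R (g n)) < e"
      using LIMSEQ_imp_Cauchy[OF g(2)] \<open>e > 0\<close> unfolding Cauchy_def by simp
  qed
  then obtain h where h: "(\<lambda>n. R (g n)) \<longlonglongrightarrow> h"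
    unfolding Cauchy_convergent_iff convergent_def by blast
  have hS: "h \<in> S"
    by (rule closed_sequentially[OF closed_S R_in[OF g(1)] h])
  have "(\<lambda>n. R (C (g n))) \<longlonglongrightarrow> R f" by (rule tendsto_op_on[OF bR C_in[OF g(1)] g(2) f])
  moreover have "(\<lambda>n. C (R (g n))) \<longlonglongrightarrow> C h" by (rule tendsto_op_on[OF bC R_in[OF g(1)] h hS])
  ultimately have "R f = C h" using comm[OF g(1)] LIMSEQ_unique by simp
  moreover have "norm h = norm f"
    using LIMSEQ_unique[OF tendsto_norm[OF h]] tendsto_norm[OF g(2)] norm_RC[OF g(1)] by simp
  ultimately show ?thesis using hS by blast
qed

text \<open>R C = W* V V* V and C R = W* W W* V, and the frame identity exchanges the inner V V* for
  W W*.\<close>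

lemma same_frame_imp_commute:
  assumes sf: "same_frame J a b" and f: "f \<in> S"
  shows "R (C f) = C (R f)"
proof (rule S_eqI)
  fix g assume g: "g \<in> S"
  have "cinner g (R (C f)) = cinner (R g) (C f)" using g f by (simp add: R_sym C_in)
  also have "\<dots> = (\<Sum>\<^sub>\<infinity>l\<in>J. cinner (R g) (ket l) * cinner (ket l) (C f))"
    using g f by (simp add: parseval_ket R_in C_in)
  also have "\<dots> = (\<Sum>\<^sub>\<infinity>l\<in>J. cinner (W g) (a l) * cinner (a l) (V f))"
    using f g by (intro infsum_cong)
      (simp add: R_sym cinner_R' cinner_C ket_in_ell2_on a.synth_ket b.synth_ket)
  also have "\<dots> = (\<Sum>\<^sub>\<infinity>l\<in>J. cinner (W g) (b l) * cinner (b l) (V f))"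
    by (rule same_frameD[OF sf])
  also have "\<dots> = (\<Sum>\<^sub>\<infinity>l\<in>J. cinner (C g) (ket l) * cinner (ket l) (R f))"
    using f g by (intro infsum_cong)
      (simp add: C_sym cinner_R' cinner_C' ket_in_ell2_on a.synth_ket b.synth_ket)
  also have "\<dots> = cinner (C g) (R f)"
    using g f by (simp add: parseval_ket R_in C_in)
  also have "\<dots> = cinner g (C (R f))" using g f by (simp add: C_sym R_in)
  finally show "cinner g (R (C f)) = cinner g (C (R f))" .
qed (use f R_in C_in in auto)

text \<open>The same exchange turns R^2 = W* V V* W into W* W W* W = C^2.\<close>

lemma same_frame_imp_sq:
  assumes sf: "same_frame J a b" and f: "f \<in> S" and g: "g \<in> S"
  shows "cinner (R f) (R g) = cinner (C f) (C g)"
proof -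
  have "cinner (R f) (R g) = (\<Sum>\<^sub>\<infinity>l\<in>J. cinner (R f) (ket l) * cinner (ket l) (R g))"
    using g f by (simp add: parseval_ket R_in)
  also have "\<dots> = (\<Sum>\<^sub>\<infinity>l\<in>J. cinner (W f) (a l) * cinner (a l) (W g))"
  proof (rule infsum_cong)
    fix l assume l: "l \<in> J"
    have "cinner (R f) (ket l) = cinner (W f) (a l)"
      using f l by (simp add: R_sym cinner_R' ket_in_ell2_on a.synth_ket)
    moreover have "cinner (ket l) (R g) = cinner (a l) (W g)"
      using g l by (simp add: cinner_R ket_in_ell2_on a.synth_ket)
    ultimately show "cinner (R f) (ket l) * cinner (ket l) (R g) = cinner (W f) (a l) * cinner (a l) (W g)"
      by simp
  qed
  also have "\<dots> = (\<Sum>\<^sub>\<infinity>l\<in>J. cinner (W f) (b l) * cinner (b l) (W g))"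
    by (rule same_frameD[OF sf])
  also have "\<dots> = (\<Sum>\<^sub>\<infinity>l\<in>J. cinner (C f) (ket l) * cinner (ket l) (C g))"
    using f g by (intro infsum_cong) (simp add: C_sym cinner_C' ket_in_ell2_on b.synth_ket)
  also have "\<dots> = cinner (C f) (C g)"
    using g f by (simp add: parseval_ket C_in)
  finally show ?thesis .
qed

section \<open>The unitary U and the relation W = V U\<close>

lemma U_in: "R ` S \<subseteq> C ` S \<Longrightarrow> f \<in> S \<Longrightarrow> U f \<in> S"
  using inv_into_into[of "R f" C S] by auto

lemma C_U: "R ` S \<subseteq> C ` S \<Longrightarrow> f \<in> S \<Longrightarrow> C (U f) = R f"
  using f_inv_into_f[of "R f" C S] by auto

text \<open>V* W f = R f = C (U f) = V* V (U f), so the difference \<open>d\<close> is orthogonal to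
  every \<open>a l\<close>. Both of its terms lie in the closed span of the \<open>a l\<close>,
  hence \<open>d\<close> is orthogonal to itself.\<close>

lemma synth_U:
  assumes sub: "R ` S \<subseteq> C ` S" and f: "f \<in> S" and W: "W f \<in> closure (lin_span (a ` J))"
  shows "W f = V (U f)"
proof -
  define d where "d = W f - V (U f)"
  have "cinner d y = 0" if y: "y \<in> a ` J" for y
  proof -
    obtain l where l: "l \<in> J" "y = a l" using y by blast
    have "cinner (a l) d = cinner (ket l) (R f) - cinner (ket l) (C (U f))"
      using l f by (simp add: d_def cinner_linear cinner_R cinner_C U_in[OF sub] ket_in_ell2_on
          a.synth_ket del: comp_apply)
    then have "cinner (a l) d = 0" using C_U[OF sub f] by simp
    then show ?thesis using l cinner_commute[of d "a l"] by simp
  qed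
  then have "cinner d x = 0" if "x \<in> closure (lin_span (a ` J))" for x
    using that by (rule cinner_closure_lin_span_eq_0[rotated])
  then have "cinner d (W f) = 0" "cinner d (V (U f)) = 0"
    using W a.synth_in_closure by blast+
  then have "cinner d d = 0" unfolding d_def by (simp add: cinner_diff_right)
  then show ?thesis by (simp add: d_def)
qed

theorem same_frame_imp:
  assumes sf: "same_frame J a b"
  shows "R ` S \<subseteq> C ` S" "unitary_on S U" "self_adjoint_on S U"
    "closure (lin_span (a ` J)) = closure (lin_span (b ` J))"
proof -
  note comm = same_frame_imp_commute[OF sf] and sq = same_frame_imp_sq[OF sf]
  have ex: "\<exists>h\<in>S. R f = C h \<and> norm h = norm f" if "f \<in> S" for f
    by (rule polar_exists[OF comm sq that])
  show sub: "R ` S \<subseteq> C ` S" using ex by blast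
  \<comment> \<open>Injectivity of \<open>C\<close> reduces each equation for \<open>U\<close> to
    one free of the inverse.\<close>
  have UI: "U f = h" if "f \<in> S" "h \<in> S" "R f = C h" for f h
    using that inv_into_f_f[OF inj_C] by simp
  have U_S: "U f \<in> S" if "f \<in> S" for f by (rule U_in[OF sub that])
  have CU: "C (U f) = R f" if "f \<in> S" for f by (rule C_U[OF sub that])
  have norm_U: "norm (U f) = norm f" if f: "f \<in> S" for f
    using ex[OF f] UI[OF f] by auto
  have addR: "R (u + v) = R u + R v" and scaleR: "R (c *\<^sub>C u) = c *\<^sub>C R u"
    and addC: "C (u + v) = C u + C v" and scaleC: "C (c *\<^sub>C u) = c *\<^sub>C C u"
    if "u \<in> S" "v \<in> S" for u v c
    using bR bC that unfolding bounded_op_on_def by auto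
  have bU: "bounded_op_on S U"
    unfolding bounded_op_on_def
  proof (intro conjI ballI allI)
    show "U (u + v) = U u + U v" if "u \<in> S" "v \<in> S" for u v
      using that U_S by (intro UI) (simp_all add: ell2_on_linear addR addC CU del: comp_apply)
    show "U (c *\<^sub>C u) = c *\<^sub>C U u" if "u \<in> S" for c u
      using that U_S[OF that]
      by (intro UI) (simp_all add: ell2_on_linear scaleR[OF that that] scaleC[of "U u" "U u"] CU del: comp_apply)
    show "\<exists>K. \<forall>u\<in>S. norm (U u) \<le> K * norm u" using norm_U by (intro exI[of _ 1]) simp
  qed (use U_S in auto)
  have UC: "U (C f) = R f" if "f \<in> S" for f
    by (rule UI) (use that comm C_in R_in in auto)
  \<comment> \<open>After applying the injective \<open>C\<close>, the claim
    \<open>R (U f) = C f\<close> follows from commutation and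
    \<open>R\<^sup>2 = C\<^sup>2\<close>.\<close>
  have UU: "U (U f) = f" if f: "f \<in> S" for f
  proof (rule UI)
    have "C (R (U f)) = R (R f)"
      using comm[OF U_S[OF f]] CU[OF f] by (simp del: comp_apply)
    also have "\<dots> = C (C f)"
    proof (rule S_eqI)
      fix g assume g: "g \<in> S"
      then show "cinner g (R (R f)) = cinner g (C (C f))"
        using sq[OF g f] f by (simp add: R_sym C_sym R_in C_in)
    qed (use f R_in C_in in auto)
    finally show "R (U f) = C f"
      using inj_onD[OF inj_C] R_in[OF U_S[OF f]] C_in[OF f] by blast
  qed (use f U_S in auto)
  \<comment> \<open>Against the range of \<open>C\<close> this is the symmetry of \<open>R\<close>;
    density of that range and continuity extend it to all of \<open>S\<close>.\<close>
  have symUC: "cinner (U f) (C g) = cinner f (U (C g))" if f: "f \<in> S" and g: "g \<in> S" for f g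
  proof -
    have "cinner (U f) (C g) = cinner (C (U f)) g" using f g U_S by (simp add: C_sym del: comp_apply)
    also have "\<dots> = cinner f (R g)" using f g by (simp only: CU R_sym)
    finally show ?thesis using g by (simp only: UC)
  qed
  have symU: "cinner (U f) g = cinner f (U g)" if f: "f \<in> S" and g: "g \<in> S" for f g
  proof -
    obtain h where h: "\<And>n::nat. h n \<in> S" "(\<lambda>n. C (h n)) \<longlonglongrightarrow> g"
      using C_range_dense[OF g] by blast
    have "(\<lambda>n. cinner (U f) (C (h n))) \<longlonglongrightarrow> cinner (U f) g"
      by (rule cinner.tendsto[OF tendsto_const h(2)])
    moreover have "(\<lambda>n. cinner f (U (C (h n)))) \<longlonglongrightarrow> cinner f (U g)"
      by (rule cinner.tendsto[OF tendsto_const tendsto_op_on[OF bU C_in[OF h(1)] h(2) g]])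
    ultimately show ?thesis using symUC[OF f h(1)] LIMSEQ_unique by simp
  qed
  show "self_adjoint_on S U" unfolding self_adjoint_on_def using bU symU by blast
  have "U ` S = S"
  proof
    show "U ` S \<subseteq> S" using U_S by blast
    show "S \<subseteq> U ` S"
    proof
      show "x \<in> U ` S" if "x \<in> S" for x
        by (rule image_eqI[of _ U "U x"]) (simp_all only: UU U_S that)
    qed
  qed
  moreover have "cinner (U u) (U v) = cinner u v" if "u \<in> S" "v \<in> S" for u v
    using symU[OF that(1) U_S[OF that(2)]] UU[OF that(2)] by simp
  ultimately show "unitary_on S U" unfolding unitary_on_def using bU by blast
  have WV: "W f = V (U f)" if f: "f \<in> S" for f
  proof -
    define h where "h = U f"
    have h: "h \<in> S" "C h = R f" "R h = C f"
      using U_S[OF f] CU[OF f] CU[OF U_S[OF f]] UU[OF f] by (auto simp: h_def)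
    have "cinner (W f - V h) (W f - V h) = cinner f (C f) - cinner f (R h) - (cinner h (R f) - cinner h (C h))"
      using f h(1) by (simp add: cinner_linear cinner_C' cinner_R' cinner_C cinner_R)
        (simp add: cinner_C[symmetric] cinner_C'[symmetric] cinner_R[symmetric] cinner_R'[symmetric])
    also have "\<dots> = 0" by (simp add: h)
    finally show ?thesis by (simp add: h_def)
  qed
  \<comment> \<open>Stated for two abstract families because it is used in both directions, the
    second time with W (U f) = V (U (U f)) = V f.\<close>
  have span: "lin_span (x ` J) \<subseteq> closure (lin_span (y ` J))"
    if x: "sq_summable_family J x" and y: "sq_summable_family J y"
      and xy: "\<And>f. f \<in> S \<Longrightarrow> sq_summable_family.synth J x f = sq_summable_family.synth J y (U f)" for x y
  proof
    interpret x: sq_summable_family J x by (rule x)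
    interpret y: sq_summable_family J y by (rule y)
    fix p assume "p \<in> lin_span (x ` J)"
    then obtain F c where F: "finite F" "F \<subseteq> J" and p: "p = (\<Sum>l\<in>F. c l *\<^sub>C x l)"
      by (rule lin_span_imageE)
    define f where "f = (\<Sum>l\<in>F. c l *\<^sub>C ket l)"
    have "f \<in> S" unfolding f_def using F
      by (induction F rule: finite_induct) (auto intro!: ell2_on_linear ket_in_ell2_on)
    have "x.synth f = (\<Sum>l\<in>F. x.synth (c l *\<^sub>C ket l))"
      unfolding f_def by (rule linear_sum[OF bounded_linear.linear[OF x.bounded_linear_synth]])
    also have "\<dots> = p"
      unfolding p using F by (intro sum.cong) (auto simp: x.synth_scaleC x.synth_ket)
    finally have "p = y.synth (U f)" using xy[OF \<open>f \<in> S\<close>] by simp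
    then show "p \<in> closure (lin_span (y ` J))" using y.synth_in_closure by simp
  qed
  have "lin_span (b ` J) \<subseteq> closure (lin_span (a ` J))"
    by (rule span[OF b.sq_summable_family_axioms a.sq_summable_family_axioms WV])
  moreover have "lin_span (a ` J) \<subseteq> closure (lin_span (b ` J))"
    by (rule span[OF a.sq_summable_family_axioms b.sq_summable_family_axioms])
      (use WV[OF U_S] UU in \<open>simp del: comp_apply\<close>)
  ultimately show "closure (lin_span (a ` J)) = closure (lin_span (b ` J))"
    by (intro subset_antisym closure_minimal) auto
qed

text \<open>By \<open>synth_U\<close>, W = V U and so W* = U V* by self-adjointness. The two frame
  forms are inner products of analysed vectors, before and after \<open>U\<close>, which preserves
  them.\<close>

theorem same_frameI:
  assumes sub: "R ` S \<subseteq> C ` S" and uU: "unitary_on S U" and sU: "self_adjoint_on S U"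
    and span: "closure (lin_span (a ` J)) = closure (lin_span (b ` J))"
  shows "same_frame J a b"
  unfolding same_frame_def
proof (intro allI)
  fix p q
  have U_S: "U f \<in> S" if "f \<in> S" for f by (rule U_in[OF sub that])
  have sym: "cinner (U f) g = cinner f (U g)" if "f \<in> S" "g \<in> S" for f g
    using sU that by (simp add: self_adjoint_on_def del: comp_apply)
  have iso: "cinner (U f) (U g) = cinner f g" if "f \<in> S" "g \<in> S" for f g
    using uU that by (simp add: unitary_on_def del: comp_apply)
  have b_eq: "cinner x (b l) = cinner (U (a.ana x)) (ket l)" if l: "l \<in> J" for x l
  proof -
    have "b l = V (U (ket l))"
      using synth_U[OF sub ket_in_ell2_on[OF l]] b.synth_in_closure[of "ket l"] span b.synth_ket[OF l] by simp
    then show ?thesis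
      using l by (simp add: a.cinner_ana[symmetric] sym U_S a.ana_in_ell2_on ket_in_ell2_on del: comp_apply)
  qed
  have b_eq': "cinner (b l) x = cinner (ket l) (U (a.ana x))" if l: "l \<in> J" for x l
    using b_eq[OF l] cinner_commute by metis
  have a_eq: "cinner x (a l) = cinner (a.ana x) (ket l)" if l: "l \<in> J" for x l
    using l by (simp add: a.cinner_ana ket_in_ell2_on a.synth_ket)
  have a_eq': "cinner (a l) x = cinner (ket l) (a.ana x)" if l: "l \<in> J" for x l
    using a_eq[OF l] cinner_commute by metis
  have "(\<Sum>\<^sub>\<infinity>l\<in>J. cinner p (b l) * cinner (b l) q) =
      (\<Sum>\<^sub>\<infinity>l\<in>J. cinner (U (a.ana p)) (ket l) * cinner (ket l) (U (a.ana q)))"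
    by (rule infsum_cong) (simp only: b_eq b_eq')
  also have "\<dots> = cinner (U (a.ana p)) (U (a.ana q))"
    by (intro parseval_ket U_S a.ana_in_ell2_on)
  also have "\<dots> = cinner (a.ana p) (a.ana q)"
    by (intro iso a.ana_in_ell2_on)
  also have "\<dots> = (\<Sum>\<^sub>\<infinity>l\<in>J. cinner (a.ana p) (ket l) * cinner (ket l) (a.ana q))"
    by (intro parseval_ket[symmetric] a.ana_in_ell2_on)
  also have "\<dots> = (\<Sum>\<^sub>\<infinity>l\<in>J. cinner p (a l) * cinner (a l) q)"
    by (rule infsum_cong) (simp only: a_eq a_eq')
  finally show "(\<Sum>\<^sub>\<infinity>l\<in>J. cinner p (a l) * cinner (a l) q) =
      (\<Sum>\<^sub>\<infinity>l\<in>J. cinner p (b l) * cinner (b l) q)" ..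
qed

end


section \<open>Families with strongly convergent sum of squares\<close>

locale kraus_family =
  fixes J :: "nat set" and L :: "nat \<Rightarrow> 'a::chilbert_space \<Rightarrow> 'a"
  assumes bounded_L: "\<And>l. l \<in> J \<Longrightarrow> bounded_op (L l)"
    and strongly_summable: "\<And>u. (\<lambda>l. adj (L l) (L l u)) summable_on J"
begin

section \<open>Uniform bounds and the completely positive part of the generator\<close>

lemma summable_norm_sq: "(\<lambda>l. (norm (L l u))\<^sup>2) summable_on J"
proof -
  have "(\<lambda>l. Re (cinner u (adj (L l) (L l u)))) summable_on J"
    by (rule summable_on_Re[OF summable_on_bounded_linear[OF cinner.bounded_linear_right
            strongly_summable]])
  moreover have "Re (cinner u (adj (L l) (L l u))) = (norm (L l u))\<^sup>2" if "l \<in> J" for l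
    by (simp add: cinner_adj[OF bounded_L[OF that]] cinner_self)
  ultimately show ?thesis by (simp cong: summable_on_cong)
qed

text \<open>Uniform boundedness by Baire's theorem: pointwise convergence makes the closed sets
  \<open>D n\<close> cover the space, so one of them contains a ball.\<close>

lemma finite_sum_bound: "\<exists>M>0. \<forall>F u. finite F \<and> F \<subseteq> J \<longrightarrow> (\<Sum>l\<in>F. (norm (L l u))\<^sup>2) \<le> M * (norm u)\<^sup>2"
proof -
  define D where "D n = {u. \<forall>F. finite F \<and> F \<subseteq> J \<longrightarrow> (\<Sum>l\<in>F. (norm (L l u))\<^sup>2) \<le> real n}" for n
  have clD: "closed (D n)" for n
  proof -
    have "D n = (\<Inter>F\<in>{F. finite F \<and> F \<subseteq> J}. {u. (\<Sum>l\<in>F. (norm (L l u))\<^sup>2) \<le> real n})"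
      by (auto simp: D_def)
    moreover have "closed {u. (\<Sum>l\<in>F. (norm (L l u))\<^sup>2) \<le> real n}" if "F \<subseteq> J" for F
      using that bounded_op_bounded_linear[OF bounded_L]
      by (intro closed_Collect_le continuous_intros bounded_linear.continuous_on[of "L _"]) auto
    ultimately show ?thesis by auto
  qed
  have "\<exists>n. u \<in> D n" for u
  proof -
    obtain n where "(\<Sum>\<^sub>\<infinity>l\<in>J. (norm (L l u))\<^sup>2) \<le> real n" using real_arch_simple by blast
    then have "(\<Sum>l\<in>F. (norm (L l u))\<^sup>2) \<le> real n" if "finite F" "F \<subseteq> J" for F
      using finite_sum_le_infsum[OF summable_norm_sq that, of u] by (simp add: order_trans)
    then show ?thesis unfolding D_def by blast
  qed
  then have "(\<Union>n. D n) = UNIV" by blast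
  moreover have "interior (\<Union>(range D)) = {}" if "\<And>n. interior (D n) = {}"
  proof -
    have "Met_TC.mtopology interior_of (\<Union>(range D)) = {}"
      by (rule Met_TC.metric_Baire_category_alt) (use that clD in \<open>auto simp: complete_UNIV\<close>)
    then show ?thesis by simp
  qed
  ultimately obtain n where "interior (D n) \<noteq> {}" by fastforce
  then obtain c e where e: "e > 0" "ball c e \<subseteq> D n" by (meson all_not_in_conv mem_interior)
  \<comment> \<open>The ball is centred at \<open>c\<close>; adding the values at
    \<open>c + v\<close> and \<open>c - v\<close> transfers the bound to the origin by the
    parallelogram identity.\<close>
  have small: "(\<Sum>l\<in>F. (norm (L l v))\<^sup>2) \<le> real n" if F: "finite F" "F \<subseteq> J" and v: "norm v < e" for F v
  proof -
    have "c + v \<in> D n" "c - v \<in> D n" using e v by (auto simp: dist_norm subset_iff)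
    then have "(\<Sum>l\<in>F. (norm (L l (c + v)))\<^sup>2) \<le> real n" "(\<Sum>l\<in>F. (norm (L l (c - v)))\<^sup>2) \<le> real n"
      using F by (auto simp: D_def)
    then have "(\<Sum>l\<in>F. (norm (L l (c + v)))\<^sup>2 + (norm (L l (c - v)))\<^sup>2) \<le> 2 * real n"
      by (simp add: sum.distrib)
    moreover have "(\<Sum>l\<in>F. 2 * (norm (L l v))\<^sup>2) \<le> (\<Sum>l\<in>F. (norm (L l (c + v)))\<^sup>2 + (norm (L l (c - v)))\<^sup>2)"
    proof (rule sum_mono)
      fix l assume "l \<in> F"
      then have b: "bounded_op (L l)" using F bounded_L by blast
      show "2 * (norm (L l v))\<^sup>2 \<le> (norm (L l (c + v)))\<^sup>2 + (norm (L l (c - v)))\<^sup>2"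
        unfolding bounded_op_add[OF b] bounded_op_diff[OF b] norm_add_sq norm_diff_sq by simp
    qed
    ultimately have "2 * (\<Sum>l\<in>F. (norm (L l v))\<^sup>2) \<le> 2 * real n" by (simp add: sum_distrib_left)
    then show ?thesis by simp
  qed
  \<comment> \<open>Rescaling \<open>u\<close> to norm \<open>e / 2\<close> produces the factor
    \<open>4 / e\<^sup>2\<close>; the summand 1 makes \<open>M\<close> positive even for
    \<open>n = 0\<close>.\<close>
  define M where "M = 4 * real n / e\<^sup>2 + 1"
  have "(\<Sum>l\<in>F. (norm (L l u))\<^sup>2) \<le> M * (norm u)\<^sup>2" if F: "finite F" "F \<subseteq> J" for F u
  proof (cases "u = 0")
    case True
    have "L l 0 = 0" if "l \<in> F" for l using bounded_op_zero[OF bounded_L] F that by blast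
    then show ?thesis using True by simp
  next
    case False
    define t where "t = e / (2 * norm u)"
    have t: "t > 0" "norm (t *\<^sub>R u) < e" using False e(1) by (auto simp: t_def)
    have "t\<^sup>2 * (\<Sum>l\<in>F. (norm (L l u))\<^sup>2) = (\<Sum>l\<in>F. (norm (L l (t *\<^sub>R u)))\<^sup>2)"
      unfolding sum_distrib_left using F bounded_op_scaleR[OF bounded_L]
      by (intro sum.cong) (auto simp: power_mult_distrib)
    also have "\<dots> \<le> real n" by (rule small[OF F t(2)])
    finally have "(\<Sum>l\<in>F. (norm (L l u))\<^sup>2) \<le> real n / t\<^sup>2" using t(1) by (simp add: field_simps)
    also have "\<dots> = (4 * real n / e\<^sup>2) * (norm u)\<^sup>2"
      using False e(1) by (simp add: t_def power_divide power_mult_distrib)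
    also have "\<dots> \<le> M * (norm u)\<^sup>2" unfolding M_def by (intro mult_right_mono) auto
    finally show ?thesis .
  qed
  moreover have "M > 0" unfolding M_def by (simp add: add_nonneg_pos)
  ultimately show ?thesis by blast
qed

lemma norm_sq_bound: "\<exists>M>0. \<forall>u. (\<Sum>\<^sub>\<infinity>l\<in>J. (norm (L l u))\<^sup>2) \<le> M * (norm u)\<^sup>2"
proof -
  obtain M where M: "M > 0"
    "\<forall>F u. finite F \<and> F \<subseteq> J \<longrightarrow> (\<Sum>l\<in>F. (norm (L l u))\<^sup>2) \<le> M * (norm u)\<^sup>2"
    using finite_sum_bound by blast
  have "(\<Sum>\<^sub>\<infinity>l\<in>J. (norm (L l u))\<^sup>2) \<le> M * (norm u)\<^sup>2" for u
    by (rule infsum_le_finite_sums[OF summable_norm_sq]) (use M in blast)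
  then show ?thesis using M by blast
qed

text \<open>Pairing the sum \<open>w\<close> with itself and applying Cauchy-Schwarz bounds the
  fourth power of its norm by a product with factor \<open>M * (norm w)\<^sup>2\<close>; cancel
  \<open>(norm w)\<^sup>2\<close>. The sum over \<open>F\<close> stays on the right to suit
  \<open>summable_on_sq_majorant\<close>.\<close>

lemma finite_kraus_bound:
  assumes y: "\<And>v. norm (y v) \<le> k * norm v" and k: "k \<ge> 0"
    and M: "\<And>F u. finite F \<and> F \<subseteq> J \<longrightarrow> (\<Sum>l\<in>F. (norm (L l u))\<^sup>2) \<le> M * (norm u)\<^sup>2" "M > 0"
    and F: "finite F" "F \<subseteq> J"
  shows "(norm (\<Sum>l\<in>F. adj (L l) (y (L l u))))\<^sup>2 \<le> (k\<^sup>2 * M) * (\<Sum>l\<in>F. (norm (L l u))\<^sup>2)"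
proof -
  define w where "w = (\<Sum>l\<in>F. adj (L l) (y (L l u)))"
  have "(norm w)\<^sup>2 = cmod (cinner w w)" unfolding cinner_self by (simp only: norm_of_real abs_power2)
  also have "cinner w w = (\<Sum>l\<in>F. cinner (L l w) (y (L l u)))"
    by (subst (2) w_def, unfold cinner_sum_right, rule sum.cong)
      (use F bounded_L in \<open>auto simp: cinner_adj subset_iff\<close>)
  also have "cmod \<dots> \<le> (\<Sum>l\<in>F. norm (L l w) * (k * norm (L l u)))"
  proof (rule sum_norm_le)
    show "cmod (cinner (L l w) (y (L l u))) \<le> norm (L l w) * (k * norm (L l u))" for l
      using cmod_cinner_le[of "L l w" "y (L l u)"] mult_left_mono[OF y[of "L l u"] norm_ge_zero[of "L l w"]]
      by linarith
  qed
  finally have "((norm w)\<^sup>2)\<^sup>2 \<le> (\<Sum>l\<in>F. norm (L l w) * (k * norm (L l u)))\<^sup>2"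
    by (intro power_mono) auto
  also have "\<dots> \<le> (\<Sum>l\<in>F. (norm (L l w))\<^sup>2) * (\<Sum>l\<in>F. (k * norm (L l u))\<^sup>2)"
    by (rule Cauchy_Schwarz_ineq_sum)
  also have "\<dots> \<le> (M * (norm w)\<^sup>2) * (\<Sum>l\<in>F. (k * norm (L l u))\<^sup>2)"
    using M(1)[of F w] F by (intro mult_right_mono sum_nonneg) auto
  also have "\<dots> = (norm w)\<^sup>2 * ((k\<^sup>2 * M) * (\<Sum>l\<in>F. (norm (L l u))\<^sup>2))"
    by (simp add: power_mult_distrib sum_distrib_left[symmetric])
  finally have *: "(norm w)\<^sup>2 * (norm w)\<^sup>2 \<le> (norm w)\<^sup>2 * ((k\<^sup>2 * M) * (\<Sum>l\<in>F. (norm (L l u))\<^sup>2))"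
    by (simp add: power2_eq_square)
  show ?thesis
  proof (cases "w = 0")
    case True
    then show ?thesis using M(2) unfolding w_def by (simp add: sum_nonneg)
  next
    case False
    then have "(norm w)\<^sup>2 > 0" by simp
    then show ?thesis using * unfolding w_def[symmetric] by (simp only: mult_le_cancel_left_pos)
  qed
qed

definition Phi :: "('a \<Rightarrow> 'a) \<Rightarrow> 'a \<Rightarrow> 'a" where
  "Phi y u = (\<Sum>\<^sub>\<infinity>l\<in>J. adj (L l) (y (L l u)))"

text \<open>The locale assumes convergence for the identity only; for general \<open>y\<close> the
  majorant is the series of \<open>(norm (L l u))\<^sup>2\<close>.\<close>

lemma has_sum_Phi:
  assumes y: "bounded_op y"
  shows "((\<lambda>l. adj (L l) (y (L l u))) has_sum Phi y u) J"
proof -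
  obtain M where M: "M > 0"
    "\<And>F u. finite F \<and> F \<subseteq> J \<longrightarrow> (\<Sum>l\<in>F. (norm (L l u))\<^sup>2) \<le> M * (norm u)\<^sup>2"
    using finite_sum_bound by blast
  obtain k where k: "k > 0" "\<And>u. norm (y u) \<le> k * norm u" using bounded_op_pos_bound[OF y] by metis
  have "(\<lambda>l. adj (L l) (y (L l u))) summable_on J"
  proof (rule summable_on_sq_majorant[OF summable_norm_sq[of u]])
    show "0 \<le> k\<^sup>2 * M" using M by simp
  qed (use finite_kraus_bound[OF k(2) less_imp_le[OF k(1)] M(2) M(1)] in auto)
  then show ?thesis unfolding Phi_def by (rule has_sum_infsum)
qed

lemma bounded_op_Phi:
  assumes y: "bounded_op y"
  shows "bounded_op (Phi y)"
proof -
  obtain M where M: "M > 0"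
    "\<And>F u. finite F \<and> F \<subseteq> J \<longrightarrow> (\<Sum>l\<in>F. (norm (L l u))\<^sup>2) \<le> M * (norm u)\<^sup>2"
    using finite_sum_bound by blast
  obtain k where k: "k > 0" "\<And>u. norm (y u) \<le> k * norm u" using bounded_op_pos_bound[OF y] by metis
  show ?thesis
  proof (rule bounded_opI)
    have term_add: "adj (L l) (y (L l (u + v))) = adj (L l) (y (L l u)) + adj (L l) (y (L l v))"
      and term_scale: "adj (L l) (y (L l (c *\<^sub>C u))) = c *\<^sub>C adj (L l) (y (L l u))" if "l \<in> J" for l u v c
      using bounded_L[OF that] bounded_op_adj[OF bounded_L[OF that]] y
      by (simp_all add: bounded_op_linear)
    show "Phi y (u + v) = Phi y u + Phi y v" for u v
    proof (rule has_sum_unique[OF has_sum_Phi[OF y]])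
      show "((\<lambda>l. adj (L l) (y (L l (u + v)))) has_sum (Phi y u + Phi y v)) J"
        using has_sum_add[OF has_sum_Phi[OF y, of u] has_sum_Phi[OF y, of v]]
        by (simp add: term_add cong: has_sum_cong)
    qed
    show "Phi y (c *\<^sub>C u) = c *\<^sub>C Phi y u" for c u
    proof (rule has_sum_unique[OF has_sum_Phi[OF y]])
      show "((\<lambda>l. adj (L l) (y (L l (c *\<^sub>C u)))) has_sum c *\<^sub>C Phi y u) J"
        using has_sum_scaleC[OF has_sum_Phi[OF y, of u], of c]
        by (simp add: term_scale cong: has_sum_cong)
    qed
    show "norm (Phi y u) \<le> (k * M) * norm u" for u
    proof -
      have "norm (\<Sum>l\<in>F. adj (L l) (y (L l u))) \<le> (k * M) * norm u" if F: "finite F" "F \<subseteq> J" for F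
      proof (rule power2_le_imp_le)
        have "(norm (\<Sum>l\<in>F. adj (L l) (y (L l u))))\<^sup>2 \<le> (k\<^sup>2 * M) * (\<Sum>l\<in>F. (norm (L l u))\<^sup>2)"
          by (rule finite_kraus_bound[OF k(2) less_imp_le[OF k(1)] M(2) M(1) F])
        also have "\<dots> \<le> (k\<^sup>2 * M) * (M * (norm u)\<^sup>2)"
          using M F by (intro mult_left_mono) auto
        also have "\<dots> = ((k * M) * norm u)\<^sup>2" by (simp add: power2_eq_square)
        finally show "(norm (\<Sum>l\<in>F. adj (L l) (y (L l u))))\<^sup>2 \<le> ((k * M) * norm u)\<^sup>2" .
      qed (use k M in simp)
      then have "\<forall>\<^sub>F F in finite_subsets_at_top J.
          norm (\<Sum>l\<in>F. adj (L l) (y (L l u))) \<le> (k * M) * norm u"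
        by (rule eventually_finite_subsets_at_top_weakI)
      from tendsto_upperbound[OF tendsto_norm[OF has_sum_Phi[OF y, unfolded has_sum_def]] this]
      show ?thesis by simp
    qed
  qed
qed

lemma self_adjoint_Phi_id: "self_adjoint (Phi (\<lambda>u. u))"
  unfolding self_adjoint_on_def
proof (intro conjI ballI bounded_op_Phi bounded_op_id)
  fix u v
  have "((\<lambda>l. cinner (adj (L l) (L l u)) v) has_sum cinner (Phi (\<lambda>u. u) u) v) J"
    by (rule has_sum_cinner_left[OF has_sum_Phi[OF bounded_op_id]])
  moreover have "((\<lambda>l. cinner (adj (L l) (L l u)) v) has_sum cinner u (Phi (\<lambda>u. u) v)) J"
    by (rule has_sum_cong[THEN iffD1, OF _ has_sum_cinner_right[OF has_sum_Phi[OF bounded_op_id]]])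
      (simp add: bounded_L cinner_adj cinner_adj')
  ultimately show "cinner (Phi (\<lambda>u. u) u) v = cinner u (Phi (\<lambda>u. u) v)"
    by (rule has_sum_unique)
qed

text \<open>The uniform bound gives joint summability over basis and index, which licenses the
  interchanges in \<open>sq_summable_hs_lmul\<close> and \<open>cinner_hs_lmul_Phi\<close>.\<close>

lemma summable_norm_hs:
  assumes X: "hilbert_schmidt X"
  shows "(\<lambda>(e, l). (norm (L l (X e)))\<^sup>2) summable_on some_onb UNIV \<times> J"
proof -
  obtain M where M: "M > 0" "\<And>u. (\<Sum>\<^sub>\<infinity>l\<in>J. (norm (L l u))\<^sup>2) \<le> M * (norm u)\<^sup>2"
    using norm_sq_bound by blast
  have "(\<lambda>e. norm (\<Sum>\<^sub>\<infinity>l\<in>J. (norm (L l (X e)))\<^sup>2)) summable_on some_onb UNIV"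
  proof (rule Infinite_Sum.abs_summable_on_comparison_test')
    show "(\<lambda>e. M * (norm (X e))\<^sup>2) summable_on some_onb UNIV"
      by (intro summable_on_cmult_right hilbert_schmidt_summable X)
    show "norm (\<Sum>\<^sub>\<infinity>l\<in>J. (norm (L l (X e)))\<^sup>2) \<le> M * (norm (X e))\<^sup>2" for e
      using M(2)[of "X e"] infsum_nonneg[of J "\<lambda>l. (norm (L l (X e)))\<^sup>2"] by simp
  qed
  then have "(\<lambda>p. norm ((\<lambda>(e, l). (norm (L l (X e)))\<^sup>2) p)) summable_on some_onb UNIV \<times> J"
    unfolding Infinite_Sum.abs_summable_on_Sigma_iff using summable_norm_sq by simp
  then show ?thesis by (simp add: split_def)
qed

lemma sq_summable_hs_lmul: "(\<lambda>l. (norm (hs_lmul (L l) A))\<^sup>2) summable_on J"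
proof -
  have "(\<lambda>(l, e). (norm (L l (hs_op A e)))\<^sup>2) summable_on J \<times> some_onb UNIV"
    using summable_on_swap[THEN iffD1, OF summable_norm_hs[of "hs_op A"]] by (simp add: split_def)
  from Infinite_Sum.summable_on_Sigma_banach[OF this]
  have "(\<lambda>l. \<Sum>\<^sub>\<infinity>e\<in>some_onb UNIV. (norm (L l (hs_op A e)))\<^sup>2) summable_on J" by simp
  moreover have "(norm (hs_lmul (L l) A))\<^sup>2 = (\<Sum>\<^sub>\<infinity>e\<in>some_onb UNIV. (norm (L l (hs_op A e)))\<^sup>2)"
    if "l \<in> J" for l
    by (simp add: norm_hs_sq hs_op_hs_lmul[OF bounded_L[OF that]])
  ultimately show ?thesis by (simp cong: summable_on_cong)
qed

text \<open>\<open>Phi y\<close> is only a strong limit, so its series is pulled out of the trace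
  pairing by Fubini over basis and index.\<close>

lemma cinner_hs_lmul_Phi:
  assumes y: "bounded_op y"
  shows "cinner X (hs_lmul (Phi y) A) =
    (\<Sum>\<^sub>\<infinity>l\<in>J. cinner (hs_lmul (L l) X) (hs_lmul y (hs_lmul (L l) A)))"
proof -
  obtain k where k: "k > 0" "\<And>u. norm (y u) \<le> k * norm u" using bounded_op_pos_bound[OF y] by metis
  let ?t = "\<lambda>e l. cinner (L l (hs_op X e)) (y (L l (hs_op A e)))"
  have "(\<lambda>(e, l). ?t e l) summable_on some_onb UNIV \<times> J"
  proof (rule Infinite_Sum.abs_summable_summable, rule Infinite_Sum.abs_summable_on_comparison_test')
    show "(\<lambda>p. (\<lambda>(e, l). (norm (L l (hs_op X e)))\<^sup>2) p + k\<^sup>2 * (\<lambda>(e, l). (norm (L l (hs_op A e)))\<^sup>2) p)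
        summable_on some_onb UNIV \<times> J"
      by (intro summable_on_add summable_on_cmult_right summable_norm_hs) auto
    show "norm (case p of (e, l) \<Rightarrow> ?t e l) \<le>
        (\<lambda>(e, l). (norm (L l (hs_op X e)))\<^sup>2) p + k\<^sup>2 * (\<lambda>(e, l). (norm (L l (hs_op A e)))\<^sup>2) p" for p
    proof (cases p)
      case (Pair e l)
      define s t where "s = norm (L l (hs_op X e))" and "t = k * norm (L l (hs_op A e))"
      have "cmod (?t e l) \<le> s * norm (y (L l (hs_op A e)))" unfolding s_def by (rule cmod_cinner_le)
      also have "\<dots> \<le> s * t" unfolding s_def t_def by (intro mult_left_mono k) simp
      also have "\<dots> \<le> s\<^sup>2 + t\<^sup>2" by (rule mult_le_sum_sq)
      finally show ?thesis by (simp add: Pair s_def t_def power_mult_distrib)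
    qed
  qed
  then have swap: "(\<Sum>\<^sub>\<infinity>e\<in>some_onb UNIV. \<Sum>\<^sub>\<infinity>l\<in>J. ?t e l) = (\<Sum>\<^sub>\<infinity>l\<in>J. \<Sum>\<^sub>\<infinity>e\<in>some_onb UNIV. ?t e l)"
    by (rule infsum_swap_banach)
  have "cinner (hs_op X e) (Phi y (hs_op A e)) = (\<Sum>\<^sub>\<infinity>l\<in>J. ?t e l)" for e
  proof -
    have "((\<lambda>l. cinner (hs_op X e) (adj (L l) (y (L l (hs_op A e))))) has_sum
        cinner (hs_op X e) (Phi y (hs_op A e))) J"
      by (rule has_sum_cinner_right[OF has_sum_Phi[OF y]])
    then have "(?t e has_sum cinner (hs_op X e) (Phi y (hs_op A e))) J"
      by (rule has_sum_cong[THEN iffD1, rotated]) (simp add: cinner_adj bounded_L)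
    then show ?thesis by (simp add: infsumI)
  qed
  then have "cinner X (hs_lmul (Phi y) A) = (\<Sum>\<^sub>\<infinity>e\<in>some_onb UNIV. \<Sum>\<^sub>\<infinity>l\<in>J. ?t e l)"
    by (simp add: cinner_hs_def hs_op_hs_lmul bounded_op_Phi[OF y])
  also have "\<dots> = (\<Sum>\<^sub>\<infinity>l\<in>J. cinner (hs_lmul (L l) X) (hs_lmul y (hs_lmul (L l) A)))"
    unfolding swap by (rule infsum_cong) (simp add: cinner_hs_def hs_op_hs_lmul bounded_L y)
  finally show ?thesis .
qed

end


section \<open>Spans and frames of Hilbert-Schmidt operators\<close>

lemma hs_op_sum_scaleC: "hs_op (\<Sum>x\<in>F. c x *\<^sub>C x) = (\<lambda>u. \<Sum>x\<in>F. c x *\<^sub>C hs_op x u)"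
  by (induction F rule: infinite_finite_induct)
    (auto simp: zero_hs.rep_eq plus_hs.rep_eq scaleC_hs.rep_eq)

lemma op_span_hs_op: "op_span (hs_op ` Y) = hs_op ` lin_span Y"
proof (intro subset_antisym subsetI)
  fix A assume "A \<in> op_span (hs_op ` Y)"
  then obtain F c where F: "finite F" "F \<subseteq> hs_op ` Y" and A: "A = (\<lambda>u. \<Sum>B\<in>F. c B *\<^sub>C B u)"
    by (auto simp: op_span_def)
  obtain F' where F': "F' \<subseteq> Y" "inj_on hs_op F'" "F = hs_op ` F'"
    using F(2) by (auto simp: subset_image_inj)
  have "A = hs_op (\<Sum>x\<in>F'. c (hs_op x) *\<^sub>C x)"
    unfolding A hs_op_sum_scaleC F'(3) by (simp add: sum.reindex[OF F'(2)])
  moreover have "finite F'" using F(1) F'(2,3) finite_imageD by blast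
  ultimately show "A \<in> hs_op ` lin_span Y"
    using F'(1) unfolding lin_span_def
    by (intro image_eqI[of _ _ "\<Sum>x\<in>F'. c (hs_op x) *\<^sub>C x"] CollectI exI[of _ F']
        exI[of _ "\<lambda>x. c (hs_op x)"]) auto
next
  fix A assume "A \<in> hs_op ` lin_span Y"
  then obtain F c where F: "finite F" "F \<subseteq> Y" and A: "A = hs_op (\<Sum>x\<in>F. c x *\<^sub>C x)"
    by (auto simp: lin_span_def)
  have inj: "inj_on hs_op F" by (rule inj_onI) (simp add: hs_op_inject)
  have "A = (\<lambda>u. \<Sum>B\<in>hs_op ` F. c (Abs_hs B) *\<^sub>C B u)"
    unfolding A hs_op_sum_scaleC by (simp add: sum.reindex[OF inj] hs_op_inverse)
  then show "A \<in> op_span (hs_op ` Y)"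
    using F unfolding op_span_def
    by (intro CollectI exI[of _ "hs_op ` F"] exI[of _ "\<lambda>B. c (Abs_hs B)"]) auto
qed

text \<open>\<open>hs_norm\<close> of a difference is the distance in \<open>hs\<close>, so the
  closed span becomes an ordinary \<open>closure\<close>.\<close>

lemma hs_closed_span_hs_op: "hs_closed_span (hs_op ` Y) = hs_op ` closure (lin_span Y)"
proof -
  have "hs_norm (\<lambda>u. hs_op A u - hs_op B u) = dist B A" for A B :: "'a hs"
    using hs_norm_hs_op[of "A - B"] by (simp add: minus_hs.rep_eq dist_norm norm_minus_commute)
  then have "hs_op A \<in> hs_closed_span (hs_op ` Y) \<longleftrightarrow> A \<in> closure (lin_span Y)" for A
    unfolding hs_closed_span_def op_span_hs_op closure_approachable by simp
  moreover have "\<exists>A'. A = hs_op A'" if "A \<in> hs_closed_span (hs_op ` Y)" for A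
    using that hs_op_Abs_hs[of A, symmetric] unfolding hs_closed_span_def by blast
  ultimately show ?thesis by blast
qed

section \<open>From trace forms to frame operators\<close>

lemma (in sq_summable_family) frame_sum:
  "(\<Sum>\<^sub>\<infinity>l\<in>J. cinner p (a l) * cinner (a l) q) = cinner p (synth (ana q))"
proof -
  have "((\<lambda>l. cinner p (ell2_nth (ana q) l *\<^sub>C a l)) has_sum cinner p (synth (ana q))) J"
    by (rule has_sum_cinner_right[OF has_sum_synth])
  then have "((\<lambda>l. cinner p (a l) * cinner (a l) q) has_sum cinner p (synth (ana q))) J"
    by (rule has_sum_cong[THEN iffD1, rotated]) (simp add: ell2_nth_ana cinner_linear mult.commute)
  then show ?thesis by (rule infsumI)
qed

lemma (in sq_summable_family) frame_sum':
  "(\<Sum>\<^sub>\<infinity>l\<in>J. cinner p (a l) * cinner (a l) q) = cinner (synth (ana p)) q"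
  unfolding frame_sum by (metis ana_in_ell2_on cinner_ana cinner_commute)

text \<open>What the comparison rests on: a unit vector \<open>r\<close> orthogonal to both
  families, along which \<open>n\<close> and \<open>m\<close> have equal components.\<close>

locale frame_pair = a: sq_summable_family J a + b: sq_summable_family J b
  for J :: "nat set" and a b :: "nat \<Rightarrow> 'h::chilbert_space hs" +
  fixes r n m :: "'h hs"
  assumes r_norm: "cinner r r = 1"
    and r_a: "\<And>l. l \<in> J \<Longrightarrow> cinner r (a l) = 0"
    and r_b: "\<And>l. l \<in> J \<Longrightarrow> cinner r (b l) = 0"
    and n_m: "cinner r n = cinner r m"
begin

text \<open>One side of the balance condition, with \<open>z\<close> standing for the adjoint of
  \<open>x\<close>, \<open>k\<close> for N or M and \<open>c\<close> for the matching
  family.\<close>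

definition trace_form :: "'h hs \<Rightarrow> (nat \<Rightarrow> 'h hs) \<Rightarrow> ('h \<Rightarrow> 'h) \<Rightarrow> ('h \<Rightarrow> 'h) \<Rightarrow> complex" where
  "trace_form k c z y = cinner (hs_rmul z k) (hs_lmul y r) + cinner (hs_rmul z r) (hs_lmul y k) +
     (\<Sum>\<^sub>\<infinity>l\<in>J. cinner (hs_rmul z (c l)) (hs_lmul y (c l)))"

text \<open>For z = |f><e| and y = |g><h| every pairing factors, and the form becomes a matrix
  element between |h><e| and |g><f|.\<close>

lemma trace_form_rank1:
  "trace_form k c (\<lambda>u. cinner e u *\<^sub>C f) (\<lambda>u. cinner h u *\<^sub>C g) =
    cinner (hs_rank1 h e) r * cinner k (hs_rank1 g f) + cinner (hs_rank1 h e) k * cinner r (hs_rank1 g f) +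
    (\<Sum>\<^sub>\<infinity>l\<in>J. cinner (hs_rank1 h e) (c l) * cinner (c l) (hs_rank1 g f))"
proof -
  have "cinner (hs_rmul (\<lambda>u. cinner e u *\<^sub>C f) P) (hs_lmul (\<lambda>u. cinner h u *\<^sub>C g) Q) =
      cinner (hs_rank1 h e) Q * cinner P (hs_rank1 g f)" for P Q :: "'h hs"
  proof -
    have "cinner (hs_rank1 (hs_op P f) e) (hs_rank1 g (adj (hs_op Q) h)) =
        cinner (adj (hs_op Q) h) e * cinner (hs_op P f) g"
      unfolding cinner_hs_rank1 hs_op_hs_rank1 cinner_scaleC_right ..
    then show ?thesis
      by (simp only: hs_rmul_rank1 hs_lmul_rank1 cinner_adj'[OF bounded_op_hs_op] cinner_hs_rank1
          cinner_hs_rank1')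
  qed
  then show ?thesis by (simp add: trace_form_def)
qed

text \<open>The operator |r><k| + |k><r| + t, where \<open>t\<close> will be the frame operator of a
  family.\<close>

definition frame_op :: "'h hs \<Rightarrow> ('h hs \<Rightarrow> 'h hs) \<Rightarrow> 'h hs \<Rightarrow> 'h hs" where
  "frame_op k t q = cinner k q *\<^sub>C r + cinner r q *\<^sub>C k + t q"

lemma frames_eqI:
  assumes eq: "\<And>z y. bounded_op z \<Longrightarrow> bounded_op y \<Longrightarrow> trace_form n a z y = trace_form m b z y"
  shows "n = m \<and> same_frame J a b"
proof -
  let ?A = "frame_op n (\<lambda>q. a.synth (a.ana q))" and ?B = "frame_op m (\<lambda>q. b.synth (b.ana q))"
  have A: "cinner p (?A q) = cinner p r * cinner n q + cinner p n * cinner r q +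
        (\<Sum>\<^sub>\<infinity>l\<in>J. cinner p (a l) * cinner (a l) q)"
    and B: "cinner p (?B q) = cinner p r * cinner m q + cinner p m * cinner r q +
        (\<Sum>\<^sub>\<infinity>l\<in>J. cinner p (b l) * cinner (b l) q)" for p q
    by (simp_all add: frame_op_def a.frame_sum b.frame_sum cinner_linear mult.commute)
  \<comment> \<open>Symmetry lets equality on rank one vectors be extended one slot at a time: first
    on the left, then, through \<open>rank1'\<close>, on the right.\<close>
  have A': "cinner (?A p) q = cinner p (?A q)" and B': "cinner (?B p) q = cinner p (?B q)" for p q
    unfolding A B a.frame_sum' b.frame_sum'
    by (simp_all add: frame_op_def cinner_linear cinner_commute[symmetric] mult.commute)
  have rank1: "cinner (hs_rank1 h e) (?A (hs_rank1 g f)) = cinner (hs_rank1 h e) (?B (hs_rank1 g f))"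
    for h e g f :: 'h
    using eq[of "\<lambda>u. cinner e u *\<^sub>C f" "\<lambda>u. cinner h u *\<^sub>C g", OF bounded_op_rank_one bounded_op_rank_one]
    unfolding trace_form_rank1 A B .
  have "?A (hs_rank1 g f) = ?B (hs_rank1 g f)" for g f
  proof (rule cinner_eqI)
    show "cinner p (?A (hs_rank1 g f)) = cinner p (?B (hs_rank1 g f))" for p
      by (rule bounded_linear_eq_on_rank1[OF cinner.bounded_linear_left cinner.bounded_linear_left rank1])
  qed
  then have rank1': "cinner (?A p) (hs_rank1 g f) = cinner (?B p) (hs_rank1 g f)" for p g f
    by (simp add: A' B')
  have AB: "?A p = ?B p" for p
  proof (rule cinner_eqI')
    show "cinner (?A p) q = cinner (?B p) q" for q
      by (rule bounded_linear_eq_on_rank1[OF cinner.bounded_linear_right cinner.bounded_linear_right rank1'])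
  qed
  \<comment> \<open>At \<open>r\<close> the frame terms vanish and \<open>cinner r r = 1\<close>,
    which leaves \<open>cinner n r *\<^sub>C r + n\<close>; equal components along \<open>r\<close>
    then force \<open>n = m\<close>.\<close>
  have "cinner (a l) r = 0" "cinner (b l) r = 0" if "l \<in> J" for l
    using r_a[OF that] r_b[OF that] cinner_commute[of "a l" r] cinner_commute[of "b l" r] by auto
  then have "cinner p (a.synth (a.ana r)) = cinner p 0" "cinner p (b.synth (b.ana r)) = cinner p 0" for p
    unfolding a.frame_sum[symmetric] b.frame_sum[symmetric] by (simp_all add: infsum_0)
  then have "a.synth (a.ana r) = 0" "b.synth (b.ana r) = 0"
    by (blast intro: cinner_eqI)+
  then have "cinner n r *\<^sub>C r + n = cinner m r *\<^sub>C r + m"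
    using AB[of r] r_norm by (simp add: frame_op_def)
  moreover have "cinner n r = cinner m r" using n_m cinner_commute by metis
  ultimately have "n = m" by simp
  then show ?thesis
    using AB by (simp add: same_frame_def frame_op_def a.frame_sum b.frame_sum)
qed

text \<open>\<open>same_frame\<close> compares sums over \<open>l\<close> between fixed vectors.
  Inserting an orthonormal basis of \<open>hs\<close> separates the two occurrences of
  \<open>c l\<close>, so that it applies to each basis vector.\<close>

lemma trace_form_eqI:
  assumes "n = m"
    and fr: "same_frame J a b"
    and z: "bounded_op z" and y: "bounded_op y"
  shows "trace_form n a z y = trace_form m b z y"
proof -
  obtain E :: "'h hs set" where "onb_on UNIV E" using onb_exists by blast
  then interpret orthonormal_basis E by unfold_locales
  have *: "(\<Sum>\<^sub>\<infinity>l\<in>J. cinner (hs_rmul z (c l)) (hs_lmul y (c l))) =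
      (\<Sum>\<^sub>\<infinity>g\<in>E. \<Sum>\<^sub>\<infinity>l\<in>J. cinner (hs_lmul (adj y) g) (c l) * cinner (c l) (hs_rmul (adj z) g))"
    if c: "(\<lambda>l. (norm (c l))\<^sup>2) summable_on J" for c
  proof -
    have "(\<Sum>\<^sub>\<infinity>l\<in>J. cinner (hs_rmul z (c l)) (hs_lmul y (c l))) =
        (\<Sum>\<^sub>\<infinity>g\<in>E. \<Sum>\<^sub>\<infinity>l\<in>J. cinner (hs_rmul z (c l)) g * cinner g (hs_lmul y (c l)))"
      by (rule parseval_family) (rule summable_norm_sq_bounded_op[OF bounded_op_hs_rmul[OF z] c]
          summable_norm_sq_bounded_op[OF bounded_op_hs_lmul[OF y] c])+
    moreover have "cinner g (hs_lmul y (c l)) = cinner (hs_lmul (adj y) g) (c l)" for g l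
      by (simp add: cinner_hs_lmul bounded_op_adj adj_adj y)
    ultimately show ?thesis by (simp add: cinner_hs_rmul z mult.commute)
  qed
  show ?thesis
    unfolding trace_form_def using *[OF a.sq_summable] *[OF b.sq_summable] same_frameD[OF fr] \<open>n = m\<close> by simp
qed

lemma trace_form_eq_iff:
  "(\<forall>z y. bounded_op z \<and> bounded_op y \<longrightarrow> trace_form n a z y = trace_form m b z y) \<longleftrightarrow>
    n = m \<and> same_frame J a b"
  using frames_eqI trace_form_eqI by blast

end

section \<open>The detailed balance condition\<close>

text \<open>The absolute value \<open>P\<close> from \<open>trace_class\<close> squares to
  \<open>\<rho> \<circ> \<rho>\<close>, so it is \<open>\<rho>\<close> by uniqueness of roots, and
  \<open>cinner e (\<rho> e)\<close> is the square of
  \<open>norm (op_sqrt \<rho> e)\<close>.\<close>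

lemma hilbert_schmidt_op_sqrt:
  assumes pos: "positive_op \<rho>" and tc: "trace_class \<rho>"
  shows "hilbert_schmidt (op_sqrt \<rho>)"
proof -
  obtain P where P: "positive_op P" "\<And>u v. cinner (P u) (P v) = cinner (\<rho> u) (\<rho> v)"
    "(\<lambda>e. cinner e (P e)) summable_on some_onb UNIV"
    using tc unfolding trace_class_on_def by blast
  have "cinner v (P (P u)) = cinner v (\<rho> (\<rho> u))" for u v
    by (metis P(1,2) pos positive_op_cinner)
  then have "P \<circ> P = \<rho> \<circ> \<rho>" by (intro ext cinner_eqI) simp
  then have "P = \<rho>" by (rule sqrt_unique[OF P(1) pos])
  note r = positive_op_sqrt[OF pos]
  have "cinner e (\<rho> e) = of_real ((norm (op_sqrt \<rho> e))\<^sup>2)" for e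
    unfolding cinner_self[symmetric] positive_op_cinner[OF r]
    by (simp only: comp_eq_dest_lhs[OF op_sqrt_sq[OF pos]])
  then have "(\<lambda>e. Re (cinner e (\<rho> e))) = (\<lambda>e. (norm (op_sqrt \<rho> e))\<^sup>2)" by simp
  then have "(\<lambda>e. (norm (op_sqrt \<rho> e))\<^sup>2) summable_on some_onb UNIV"
    using summable_on_Re[OF P(3)] \<open>P = \<rho>\<close> by simp
  then show ?thesis using positive_op_bounded_op[OF r] by (simp add: hilbert_schmidt_def)
qed

locale detailed_balance = time_reversal_op \<theta>
  for \<theta> :: "'h::chilbert_space \<Rightarrow> 'h" +
  fixes \<rho> H G :: "'h \<Rightarrow> 'h" and \<L> :: "('h \<Rightarrow> 'h) \<Rightarrow> ('h \<Rightarrow> 'h)"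
    and J :: "nat set" and L :: "nat \<Rightarrow> 'h \<Rightarrow> 'h"
  assumes density: "density_operator \<rho>" and inj_\<rho>: "inj \<rho>"
    and \<theta>_\<rho>: "\<theta> \<circ> \<rho> = \<rho> \<circ> \<theta>"
    and GKSL: "special_GKSL \<rho> \<L> J H L"
    and G_def: "G = GKSL_G J H L"
begin

abbreviation "r \<equiv> op_sqrt \<rho>"

lemma pos_\<rho>: "positive_op \<rho>" and pos_r: "positive_op r" and r_r: "r \<circ> r = \<rho>"
  and hs_r: "hilbert_schmidt r" and trace_\<rho>: "op_trace \<rho> = 1"
  using density positive_op_sqrt op_sqrt_sq hilbert_schmidt_op_sqrt
  by (auto simp: density_operator_def)

lemma bounded_r: "bounded_op r" and adj_r: "adj r = r"
  by (simp_all add: positive_op_bounded_op pos_r adj_self_adjoint positive_op_self_adjoint)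

text \<open>As \<open>\<theta>\<close> commutes with \<open>\<rho>\<close>, conjugating
  \<open>r\<close> by \<open>\<theta>\<close> gives a positive root of \<open>\<rho>\<close>;
  uniqueness identifies it with \<open>r\<close>.\<close>

lemma tilde_r: "tilde r = r"
proof -
  have "r = \<theta> \<circ> r \<circ> \<theta>"
  proof (rule op_sqrt_eqI)
    have "cinner (\<theta> (r (\<theta> u))) v = cinner u (\<theta> (r (\<theta> v)))" for u v
      by (metis cinner_left cinner_right cinner_commute positive_op_cinner[OF pos_r])
    moreover have "0 \<le> Re (cinner u (\<theta> (r (\<theta> u))))" for u
      using positive_op_Re_ge_0[OF pos_r, of "\<theta> u"] cinner_right[of u "r (\<theta> u)"]
        positive_op_cinner[OF pos_r, of "\<theta> u" "\<theta> u"] by simp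
    ultimately show "positive_op (\<theta> \<circ> r \<circ> \<theta>)"
      unfolding positive_op_iff self_adjoint_on_def by (simp add: bounded_op_conj bounded_r)
    have "\<theta> (r (r (\<theta> u))) = \<rho> u" for u
      using fun_cong[OF r_r, of "\<theta> u"] fun_cong[OF \<theta>_\<rho>, of "\<theta> u"] by simp
    then show "(\<theta> \<circ> r \<circ> \<theta>) \<circ> (\<theta> \<circ> r \<circ> \<theta>) = \<rho>" by auto
  qed
  then show ?thesis by (simp add: tilde_def adj_r)
qed

text \<open>Index 0 is reserved for the coefficient of the identity in the independence
  condition.\<close>

lemma J_pos: "0 \<notin> J"
  using GKSL by (auto simp: special_GKSL_def)

sublocale kraus_family J L
  by unfold_locales (use GKSL in \<open>auto simp: special_GKSL_def\<close>)

lemma self_adjoint_H: "self_adjoint H"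
  using GKSL by (simp add: special_GKSL_def)

lemma bounded_H: "bounded_op H" by (rule self_adjoint_bounded_op[OF self_adjoint_H])

lemma G_eq: "G = (\<lambda>u. - (1 / 2) *\<^sub>R Phi (\<lambda>u. u) u - \<i> *\<^sub>C H u)"
  by (simp add: G_def GKSL_G_def Phi_def)

lemma bounded_G: "bounded_op G"
  unfolding G_eq by (intro bounded_op_sub bounded_op_scaleR_op bounded_op_scale bounded_H
      bounded_op_Phi bounded_op_id)

lemma adj_G: "adj G = (\<lambda>u. - (1 / 2) *\<^sub>R Phi (\<lambda>u. u) u + \<i> *\<^sub>C H u)"
  by (rule adj_eqI) (simp add: G_eq cinner_linear self_adjoint_cinner[OF self_adjoint_H]
      self_adjoint_cinner[OF self_adjoint_Phi_id])

text \<open>The commutator with \<open>H\<close> and the halves of the sum of L* L combine into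
  \<open>adj G\<close> on the left and \<open>G\<close> on the right; only \<open>Phi y\<close>
  remains as a sum over \<open>l\<close>.\<close>

lemma generator_eq:
  assumes y: "bounded_op y"
  shows "\<L> y = (\<lambda>u. adj G (y u) + y (G u) + Phi y u)"
proof
  fix u
  have 1: "((\<lambda>l. adj (L l) (L l (y u))) has_sum Phi (\<lambda>u. u) (y u)) J"
    by (rule has_sum_Phi[OF bounded_op_id])
  have 2: "((\<lambda>l. y (adj (L l) (L l u))) has_sum y (Phi (\<lambda>u. u) u)) J"
    by (rule has_sum_bounded_op[OF y has_sum_Phi[OF bounded_op_id]])
  have 3: "((\<lambda>l. - (2 *\<^sub>R adj (L l) (y (L l u)))) has_sum - (2 *\<^sub>R Phi y u)) J"
    by (rule has_sum_bounded_linear[OF bounded_linear_minus[OF bounded_linear_scaleR_right]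
          has_sum_Phi[OF y]])
  have "((\<lambda>l. adj (L l) (L l (y u)) - 2 *\<^sub>R adj (L l) (y (L l u)) + y (adj (L l) (L l u))) has_sum
      Phi (\<lambda>u. u) (y u) - 2 *\<^sub>R Phi y u + y (Phi (\<lambda>u. u) u)) J"
    using has_sum_add[OF has_sum_add[OF 1 3] 2] by simp
  then have "\<L> y u = \<i> *\<^sub>C (H (y u) - y (H u)) -
      (1 / 2) *\<^sub>R (Phi (\<lambda>u. u) (y u) - 2 *\<^sub>R Phi y u + y (Phi (\<lambda>u. u) u))"
    using GKSL y by (simp add: special_GKSL_def infsumI)
  also have "\<dots> = adj G (y u) + y (G u) + Phi y u"
    unfolding adj_G unfolding G_eq
    by (simp add: bounded_op_linear[OF y] algebra_simps scaleC_diff_right)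
  finally show "\<L> y u = adj G (y u) + y (G u) + Phi y u" .
qed

section \<open>The balance condition as an identity between Hilbert-Schmidt vectors\<close>

definition r_hs :: "'h hs" where "r_hs = Abs_hs r"
definition a_hs :: "nat \<Rightarrow> 'h hs" where "a_hs l = hs_lmul (L l) r_hs"
definition n_hs :: "'h hs" where "n_hs = hs_lmul G r_hs"

abbreviation "b_hs l \<equiv> hs_tilde (a_hs l)"
abbreviation "m_hs \<equiv> hs_tilde n_hs"

lemma hs_op_r: "hs_op r_hs = r" by (simp add: r_hs_def hs_op_Abs_hs hs_r)

lemma hs_op_a: "l \<in> J \<Longrightarrow> hs_op (a_hs l) = L l \<circ> r"
  by (simp add: a_hs_def hs_op_hs_lmul bounded_L hs_op_r)

lemma hs_op_n: "hs_op n_hs = G \<circ> r"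
  by (simp add: n_hs_def hs_op_hs_lmul bounded_G hs_op_r)

lemma hs_op_tilde_r: "bounded_op x \<Longrightarrow> hs_op (hs_tilde (hs_lmul x r_hs)) = r \<circ> \<theta> \<circ> adj x \<circ> \<theta>"
  using tilde_comp[of x r]
  by (simp add: hs_op_hs_tilde hs_op_hs_lmul hs_op_r bounded_r tilde_r) (simp add: tilde_def comp_assoc)

lemma hs_op_b: "l \<in> J \<Longrightarrow> hs_op (b_hs l) = r \<circ> \<theta> \<circ> adj (L l) \<circ> \<theta>"
  unfolding a_hs_def by (rule hs_op_tilde_r[OF bounded_L])

lemma hs_op_m: "hs_op m_hs = r \<circ> \<theta> \<circ> adj G \<circ> \<theta>"
  unfolding n_hs_def by (rule hs_op_tilde_r[OF bounded_G])

lemma hs_tilde_r: "hs_tilde r_hs = r_hs"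
  by (rule hs_eqI) (simp add: hs_op_hs_tilde hs_op_r tilde_r)

text \<open>Each factor \<open>r\<close> is absorbed into one Hilbert-Schmidt operator, so
  \<open>x\<close> ends up on the right of one copy and \<open>z\<close> on the left of the
  other.\<close>

lemma trace_r_r:
  assumes x: "bounded_op x" and z: "bounded_op z"
  shows "op_trace (r \<circ> x \<circ> r \<circ> z) = cinner (hs_rmul (adj x) r_hs) (hs_lmul z r_hs)"
proof -
  have "op_trace (r \<circ> x \<circ> r \<circ> z) = op_trace ((r \<circ> x) \<circ> (r \<circ> z))" by (simp add: comp_assoc)
  also have "\<dots> = cinner (Abs_hs (adj (r \<circ> x))) (Abs_hs (r \<circ> z))"
    by (rule op_trace_eq_cinner) (intro hilbert_schmidt_comp_right hs_r x z)+
  also have "\<dots> = cinner (hs_adj (hs_rmul x r_hs)) (hs_adj (hs_lmul (adj z) r_hs))"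
    using x z by (simp add: hs_adj_def hs_op_hs_rmul hs_op_hs_lmul hs_op_r adj_comp bounded_r
        bounded_op_adj adj_adj adj_r)
  also have "\<dots> = cinner r_hs (hs_lmul z (hs_rmul x r_hs))"
    using z by (simp add: cinner_hs_adj cinner_hs_lmul bounded_op_adj adj_adj)
  also have "\<dots> = cinner (hs_rmul (adj x) r_hs) (hs_lmul z r_hs)"
    using x z by (simp add: hs_lmul_hs_rmul cinner_hs_rmul bounded_op_adj adj_adj)
  finally show ?thesis .
qed

lemma trace_\<rho>_comp:
  assumes z: "bounded_op z"
  shows "op_trace (\<rho> \<circ> z) = cinner r_hs (hs_lmul z r_hs)"
proof -
  have "\<rho> \<circ> z = r \<circ> (\<lambda>u. u) \<circ> r \<circ> z" using r_r by (auto simp: fun_eq_iff)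
  moreover have "adj (\<lambda>u. u) = (\<lambda>u::'h. u)" by (rule adj_eqI) simp
  moreover have "hs_rmul (\<lambda>u. u) r_hs = r_hs"
    by (rule hs_eqI) (simp add: hs_op_hs_rmul bounded_op_id)
  ultimately show ?thesis using trace_r_r[OF bounded_op_id z] by simp
qed

lemma hs_lmul_comp: "bounded_op x \<Longrightarrow> bounded_op y \<Longrightarrow> hs_lmul (x \<circ> y) A = hs_lmul x (hs_lmul y A)"
  by (rule hs_eqI) (simp add: hs_op_hs_lmul bounded_op_comp)

sublocale a: sq_summable_family J a_hs
  unfolding a_hs_def by unfold_locales (rule sq_summable_hs_lmul)

lemma norm_hs_tilde: "norm (hs_tilde A) = norm A"
  using cinner_hs_tilde[of A A] unfolding cinner_self of_real_eq_iff by simp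

sublocale b: sq_summable_family J "\<lambda>l. b_hs l"
  by unfold_locales (simp add: norm_hs_tilde a.sq_summable)

lemma cinner_r_a: "l \<in> J \<Longrightarrow> cinner r_hs (a_hs l) = 0"
  using GKSL by (simp add: a_hs_def trace_\<rho>_comp[symmetric] bounded_L special_GKSL_def)

lemma cinner_r_b: "l \<in> J \<Longrightarrow> cinner r_hs (b_hs l) = 0"
  using cinner_hs_tilde[of r_hs "a_hs l"] by (simp add: hs_tilde_r cinner_r_a)

lemma cinner_r_r: "cinner r_hs r_hs = 1"
proof -
  have "hs_lmul (\<lambda>u. u) r_hs = r_hs"
    by (rule hs_eqI) (simp add: hs_op_hs_lmul bounded_op_id)
  then show ?thesis using trace_\<rho>_comp[OF bounded_op_id] trace_\<rho> by (simp add: o_def)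
qed

sublocale frames: frame_pair J a_hs "\<lambda>l. b_hs l" r_hs n_hs m_hs
  by unfold_locales (use cinner_hs_tilde[of r_hs n_hs] in
    \<open>auto simp: cinner_r_a cinner_r_b cinner_r_r hs_tilde_r\<close>)

text \<open>The trace splits along \<open>generator_eq\<close>. Moving \<open>adj G\<close> to the
  other side of the pairing turns \<open>r\<close> into N there, and \<open>Phi y\<close>
  contributes the sum over \<open>l\<close>.\<close>

lemma trace_generator:
  assumes x: "bounded_op x" and y: "bounded_op y"
  shows "op_trace (r \<circ> x \<circ> r \<circ> \<L> y) = frames.trace_form n_hs a_hs (adj x) y"
proof -
  note ax = bounded_op_adj[OF x]
  have bL: "bounded_op (\<L> y)"
    unfolding generator_eq[OF y]
    using bounded_op_plus[OF bounded_op_plus[OF bounded_op_comp[OF bounded_op_adj[OF bounded_G] y]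
          bounded_op_comp[OF y bounded_G]] bounded_op_Phi[OF y]]
    by (simp add: o_def)
  have "hs_lmul (\<L> y) r_hs = hs_lmul (adj G) (hs_lmul y r_hs) + hs_lmul y n_hs + hs_lmul (Phi y) r_hs"
  proof (rule hs_eqI)
    fix u
    have "hs_op (hs_lmul (\<L> y) r_hs) u = \<L> y (r u)" by (simp add: hs_op_hs_lmul[OF bL] hs_op_r)
    also have "\<dots> = adj G (y (r u)) + y (G (r u)) + Phi y (r u)" by (simp add: generator_eq[OF y])
    finally show "hs_op (hs_lmul (\<L> y) r_hs) u = hs_op (hs_lmul (adj G) (hs_lmul y r_hs) +
        hs_lmul y n_hs + hs_lmul (Phi y) r_hs) u"
      by (simp add: hs_op_hs_lmul plus_hs.rep_eq bounded_op_adj bounded_G y hs_op_n hs_op_r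
          bounded_op_Phi)
  qed
  then have "op_trace (r \<circ> x \<circ> r \<circ> \<L> y) =
      cinner (hs_rmul (adj x) r_hs) (hs_lmul (adj G) (hs_lmul y r_hs)) +
      cinner (hs_rmul (adj x) r_hs) (hs_lmul y n_hs) +
      cinner (hs_rmul (adj x) r_hs) (hs_lmul (Phi y) r_hs)"
    by (simp add: trace_r_r[OF x bL] cinner_linear)
  also have "cinner (hs_rmul (adj x) r_hs) (hs_lmul (adj G) (hs_lmul y r_hs)) =
      cinner (hs_rmul (adj x) n_hs) (hs_lmul y r_hs)"
    by (simp add: cinner_hs_lmul[OF bounded_G, symmetric] hs_lmul_hs_rmul[OF bounded_G ax] n_hs_def)
  also have "cinner (hs_rmul (adj x) r_hs) (hs_lmul (Phi y) r_hs) =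
      (\<Sum>\<^sub>\<infinity>l\<in>J. cinner (hs_rmul (adj x) (a_hs l)) (hs_lmul y (a_hs l)))"
    unfolding cinner_hs_lmul_Phi[OF y]
    by (rule infsum_cong) (simp add: hs_lmul_hs_rmul[OF bounded_L ax] a_hs_def)
  finally show ?thesis by (simp only: frames.trace_form_def)
qed

text \<open>This is \<open>trace_generator\<close> at \<open>tilde y\<close> and
  \<open>tilde x\<close>; transposition, an isometry fixing \<open>r\<close>, restores
  \<open>x\<close> and \<open>y\<close> and replaces N, A_l by M, B_l.\<close>

lemma trace_generator_rev:
  assumes x: "bounded_op x" and y: "bounded_op y"
  shows "op_trace (r \<circ> \<theta> \<circ> adj y \<circ> \<theta> \<circ> r \<circ> \<L> (\<theta> \<circ> adj x \<circ> \<theta>)) =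
    frames.trace_form m_hs (\<lambda>l. b_hs l) (adj x) y"
proof -
  have "op_trace (r \<circ> \<theta> \<circ> adj y \<circ> \<theta> \<circ> r \<circ> \<L> (\<theta> \<circ> adj x \<circ> \<theta>)) =
      op_trace (r \<circ> tilde y \<circ> r \<circ> \<L> (tilde x))"
    by (simp add: tilde_def comp_assoc)
  also have "\<dots> = frames.trace_form n_hs a_hs (adj (tilde y)) (tilde x)"
    by (rule trace_generator[OF bounded_op_tilde[OF y] bounded_op_tilde[OF x]])
  also have "\<dots> = frames.trace_form m_hs (\<lambda>l. b_hs l) (adj x) y"
    by (simp add: frames.trace_form_def cinner_hs_tilde_mul[OF x y] hs_tilde_r)
  finally show ?thesis .
qed

lemma SQDB_iff_frames:
  "SQDB \<rho> \<theta> \<L> \<longleftrightarrow> n_hs = m_hs \<and> same_frame J a_hs (\<lambda>l. b_hs l)"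
proof -
  have "SQDB \<rho> \<theta> \<L> \<longleftrightarrow> (\<forall>x y. bounded_op x \<and> bounded_op y \<longrightarrow>
      frames.trace_form n_hs a_hs (adj x) y = frames.trace_form m_hs (\<lambda>l. b_hs l) (adj x) y)"
    by (simp add: SQDB_def trace_generator trace_generator_rev)
  \<comment> \<open>\<open>adj\<close> is an involution of the bounded operators, so
    \<open>adj x\<close> ranges over all of them.\<close>
  also have "\<dots> \<longleftrightarrow> (\<forall>z y. bounded_op z \<and> bounded_op y \<longrightarrow>
      frames.trace_form n_hs a_hs z y = frames.trace_form m_hs (\<lambda>l. b_hs l) z y)"
    by (metis adj_adj bounded_op_adj)
  finally show ?thesis unfolding frames.trace_form_eq_iff .
qed

text \<open>If V f = 0, the strong sum S of the f_l L_l satisfies S r = 0. Hence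
  \<open>r \<circ> adj S = 0\<close>, and injectivity of \<open>\<rho>\<close> gives S = 0, to which
  the independence condition applies with coefficient 0 at the identity.\<close>

lemma independent:
  assumes f: "f \<in> ell2_on J" and 0: "a.synth f = 0"
  shows "f = 0"
proof -
  \<comment> \<open>For each \<open>u\<close> the vectors \<open>L l u\<close> are a square summable
    family, so the strong sum exists for every \<open>f\<close>.\<close>
  interpret Lu: sq_summable_family J "\<lambda>l. L l u" for u
    by unfold_locales (rule summable_norm_sq)
  define S where "S u = Lu.synth u f" for u
  have S: "((\<lambda>l. ell2_nth f l *\<^sub>C L l u) has_sum S u) J" for u
    unfolding S_def by (rule Lu.has_sum_synth)
  have S_scale: "S (c *\<^sub>C u) = c *\<^sub>C S u" for c u
  proof (rule has_sum_unique[OF S])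
    show "((\<lambda>l. ell2_nth f l *\<^sub>C L l (c *\<^sub>C u)) has_sum c *\<^sub>C S u) J"
      by (rule has_sum_cong[THEN iffD1, OF _ has_sum_scaleC[OF S]])
        (simp add: bounded_op_scaleC[OF bounded_L] scaleC_scaleC mult.commute)
  qed
  have S_add: "S (u + v) = S u + S v" for u v
  proof (rule has_sum_unique[OF S])
    show "((\<lambda>l. ell2_nth f l *\<^sub>C L l (u + v)) has_sum S u + S v) J"
      by (rule has_sum_cong[THEN iffD1, OF _ has_sum_add[OF S S]])
        (simp add: bounded_op_add[OF bounded_L] scaleC_add_right)
  qed
  obtain M where M: "M > 0" "\<And>u. (\<Sum>\<^sub>\<infinity>l\<in>J. (norm (L l u))\<^sup>2) \<le> M * (norm u)\<^sup>2"
    using norm_sq_bound by blast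
  have "norm (S u) \<le> ((1 + M) * norm f) * norm u" for u
  proof (rule norm_le_if_unit_le[OF S_scale])
    fix u :: 'h assume u: "norm u = 1"
    have "norm (S u) \<le> (1 + (\<Sum>\<^sub>\<infinity>l\<in>J. (norm (L l u))\<^sup>2)) * norm f"
      unfolding S_def by (rule Lu.norm_synth_le)
    also have "\<dots> \<le> (1 + M) * norm f"
      using M(2)[of u] u by (intro mult_right_mono) auto
    finally show "norm (S u) \<le> (1 + M) * norm f" .
  qed
  then have bS: "bounded_op S" using S_add S_scale by (rule bounded_opI[rotated 2])
  have "S (r u) = 0" for u
  proof (rule has_sum_unique[OF S])
    have "((\<lambda>l. hs_op (ell2_nth f l *\<^sub>C a_hs l) u) has_sum hs_op (a.synth f) u) J"
      by (rule has_sum_bounded_linear[OF bounded_linear_hs_op a.has_sum_synth])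
    then show "((\<lambda>l. ell2_nth f l *\<^sub>C L l (r u)) has_sum 0) J"
      unfolding 0 zero_hs.rep_eq
      by (rule has_sum_cong[THEN iffD1, rotated]) (simp add: scaleC_hs.rep_eq hs_op_a)
  qed
  then have "r (adj S v) = 0" for v
    by (intro cinner_eqI) (simp add: positive_op_cinner[OF pos_r, symmetric] cinner_adj[OF bS])
  then have "\<rho> (adj S v) = \<rho> 0" for v
    using fun_cong[OF r_r, of "adj S v"] by (simp add: bounded_op_zero bounded_r positive_op_bounded_op[OF pos_\<rho>])
  then have "adj S v = 0" for v using inj_\<rho> by (simp add: inj_eq)
  then have S0: "S u = 0" for u
    using cinner_adj[OF bS, of u "S u"] by simp
  have zero: "ell2_nth f l = 0" if "l \<notin> J" for l using f that by (simp add: ell2_on_def)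
  have "(\<lambda>l. (cmod (ell2_nth f l))\<^sup>2) summable_on insert 0 J"
    using a.nth_sq_summable[of f] by (simp add: summable_on_insert_iff)
  moreover have "ell2_nth f 0 *\<^sub>C u + (\<Sum>\<^sub>\<infinity>l\<in>J. ell2_nth f l *\<^sub>C L l u) = 0" for u
    using infsumI[OF S[of u]] S0 zero[OF J_pos] by simp
  ultimately have "\<forall>l\<in>insert 0 J. ell2_nth f l = 0"
    using GKSL unfolding special_GKSL_def by blast
  then show "f = 0" using zero by (intro ell2_eqI) (auto simp: zero_ell2.rep_eq)
qed

lemma R_matrix_eq:
  assumes "j \<in> J" "k \<in> J"
  shows "op_trace (r \<circ> adj (L j) \<circ> r \<circ> \<theta> \<circ> adj (L k) \<circ> \<theta>) = cinner (a_hs j) (b_hs k)"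
proof -
  have "adj (hs_op (a_hs j)) = r \<circ> adj (L j)"
    by (simp add: hs_op_a assms adj_comp bounded_L bounded_r adj_r)
  then have "op_trace (r \<circ> adj (L j) \<circ> r \<circ> \<theta> \<circ> adj (L k) \<circ> \<theta>) =
      op_trace (adj (hs_op (a_hs j)) \<circ> hs_op (b_hs k))"
    by (simp add: hs_op_b assms comp_assoc)
  also have "\<dots> = cinner (a_hs j) (b_hs k)"
    by (subst op_trace_eq_cinner) (auto simp: hilbert_schmidt_adj adj_adj hs_op_inverse)
  finally show ?thesis .
qed

lemma C_matrix_eq:
  assumes "j \<in> J" "k \<in> J"
  shows "op_trace (\<rho> \<circ> adj (L j) \<circ> L k) = cinner (a_hs j) (a_hs k)"
proof -
  have "op_trace (\<rho> \<circ> adj (L j) \<circ> L k) = op_trace (\<rho> \<circ> (adj (L j) \<circ> L k))" by (simp add: comp_assoc)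
  also have "\<dots> = cinner r_hs (hs_lmul (adj (L j)) (hs_lmul (L k) r_hs))"
    using assms by (simp add: trace_\<rho>_comp hs_lmul_comp bounded_op_comp bounded_op_adj bounded_L)
  also have "\<dots> = cinner (a_hs j) (a_hs k)"
    using assms by (simp add: a_hs_def cinner_hs_lmul bounded_L)
  finally show ?thesis .
qed

end

theorem theorem22:
  fixes T :: "real \<Rightarrow> ('h::chilbert_space \<Rightarrow> 'h) \<Rightarrow> ('h \<Rightarrow> 'h)"
    and \<L> :: "('h \<Rightarrow> 'h) \<Rightarrow> ('h \<Rightarrow> 'h)"
    and \<rho> \<theta> H G :: "'h \<Rightarrow> 'h"
    and J :: "nat set"
    and L :: "nat \<Rightarrow> 'h \<Rightarrow> 'h"
    and R C :: "ell2 \<Rightarrow> ell2"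
  assumes separable: "\<exists>D :: 'h set. countable D \<and> closure D = UNIV"
    and "quantum_markov_semigroup T"
    and "norm_continuous T"
    and "is_generator T \<L>"
    and "faithful_invariant_state T \<rho>"
    and "time_reversal \<theta>"
    and "\<theta> \<circ> \<rho> = \<rho> \<circ> \<theta>"
    and "special_GKSL \<rho> \<L> J H L"
    and "G = GKSL_G J H L"
    and "self_adjoint_on (ell2_on J) R" "trace_class_on (ell2_on J) R"
    and "has_matrix J R (\<lambda>j k. op_trace (op_sqrt \<rho> \<circ> adj (L j) \<circ> op_sqrt \<rho> \<circ> \<theta> \<circ> adj (L k) \<circ> \<theta>))"
    and "self_adjoint_on (ell2_on J) C" "trace_class_on (ell2_on J) C"
    and "has_matrix J C (\<lambda>k j. op_trace (\<rho> \<circ> adj (L k) \<circ> L j))"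
  shows "SQDB \<rho> \<theta> \<L> \<longleftrightarrow>
      op_sqrt \<rho> \<circ> \<theta> \<circ> adj G \<circ> \<theta> = G \<circ> op_sqrt \<rho> \<and>
      hs_closed_span {op_sqrt \<rho> \<circ> \<theta> \<circ> adj (L l) \<circ> \<theta> | l. l \<in> J} =
        hs_closed_span {L l \<circ> op_sqrt \<rho> | l. l \<in> J} \<and>
      (\<forall>f\<in>ell2_on J. R (C f) = C (R f)) \<and>
      R ` ell2_on J \<subseteq> C ` ell2_on J \<and>
      unitary_on (ell2_on J) (inv_into (ell2_on J) C \<circ> R) \<and>
      self_adjoint_on (ell2_on J) (inv_into (ell2_on J) C \<circ> R)"
proof -
  interpret detailed_balance \<theta> \<rho> H G \<L> J L
    using assms by unfold_locales (auto simp: faithful_invariant_state_def)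
  \<comment> \<open>Equal Gram matrices come from \<open>hs_tilde\<close> being an isometry.\<close>
  interpret gram: gram_pair J a_hs "\<lambda>l. b_hs l" R C
    using assms by unfold_locales
      (auto simp: has_matrix_def R_matrix_eq C_matrix_eq cinner_hs_tilde independent)
  have m: "op_sqrt \<rho> \<circ> \<theta> \<circ> adj G \<circ> \<theta> = G \<circ> op_sqrt \<rho> \<longleftrightarrow> n_hs = m_hs"
    unfolding hs_op_m[symmetric] hs_op_n[symmetric] hs_op_inject by (rule eq_commute)
  have "{op_sqrt \<rho> \<circ> \<theta> \<circ> adj (L l) \<circ> \<theta> | l. l \<in> J} = hs_op ` b_hs ` J"
    and "{L l \<circ> op_sqrt \<rho> | l. l \<in> J} = hs_op ` a_hs ` J"
    by (auto simp: image_image hs_op_a hs_op_b[symmetric] Setcompr_eq_image)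
  moreover have inj_hs_op: "inj (hs_op :: 'h hs \<Rightarrow> _)" by (rule injI) (simp add: hs_op_inject)
  ultimately have span: "hs_closed_span {op_sqrt \<rho> \<circ> \<theta> \<circ> adj (L l) \<circ> \<theta> | l. l \<in> J} =
        hs_closed_span {L l \<circ> op_sqrt \<rho> | l. l \<in> J} \<longleftrightarrow>
      closure (lin_span (a_hs ` J)) = closure (lin_span ((\<lambda>l. b_hs l) ` J))"
    using inj_image_eq_iff[OF inj_hs_op] by (simp add: hs_closed_span_hs_op) blast
  \<comment> \<open>Condition 1 is \<open>n_hs = m_hs\<close>; conditions 2 and 3 together amount to
    the frame identity.\<close>
  have frame: "same_frame J a_hs (\<lambda>l. b_hs l) \<longleftrightarrow> closure (lin_span (a_hs ` J)) = closure (lin_span ((\<lambda>l. b_hs l) ` J)) \<and>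
      (\<forall>f\<in>ell2_on J. R (C f) = C (R f)) \<and>
      R ` ell2_on J \<subseteq> C ` ell2_on J \<and>
      unitary_on (ell2_on J) (inv_into (ell2_on J) C \<circ> R) \<and>
      self_adjoint_on (ell2_on J) (inv_into (ell2_on J) C \<circ> R)"
    using gram.same_frame_imp gram.same_frame_imp_commute gram.same_frameI by blast
  show ?thesis
    unfolding SQDB_iff_frames m span using frame by blast
qed

end
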